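(* Let $(\mathfrak{X}_n)_{n\geq1}$ and $\mathfrak{X}_\infty$ be random compact metric measure spaces (random variables in $\mathbb{M}_{\mathrm{GHP}}$). Let $(a_n)_{n\ge1}$, $(b_n)_{n\ge1}$ be tame sequences, and let $(N_n)_{n\geq1}$ be random positive integers independent of $(\mathfrak{X}_n)_{n\geq1}$ and $\mathfrak{X}_\infty$. Assume: (1) $(a_n,b_n)\cdot\mathfrak{X}_{N_n}\to\mathfrak{X}_\infty$ in distribution for the GHP topology; (2) $N_n/n\to1$ in probability; (3) with $\mathbb{P}_n$ the law of $\mathfrak{X}_n$, one has $\mathbb{P}_1\unlhd_{\mathrm{st}}\mathbb{P}_2\unlhd_{\mathrm{st}}\mathbb{P}_3\unlhd_{\mathrm{st}}\cdots$. Then $(a_n,b_n)\cdot\mathfrak{X}_n\to\mathfrak{X}_\infty$ in distribution for the GHP topology.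
   Context: $\mathbb{M}_{\mathrm{GHP}}$ is the Polish space of measure-preserving isometry classes $[X,d,\mu]$ of compact metric spaces with a finite Borel measure, with the Gromov--Hausdorff--Prokhorov (GHP) metric (infimum over common isometric embeddings into a metric space of Hausdorff distance of the images plus Prokhorov distance of the pushed-forward measures). For $a,b>0$, $(a,b)\cdot[X,d,\mu]=[X,a\cdot d,b\cdot\mu]$. A positive sequence $(x_n)$ is tame if $x_{n+k_n}/x_n\to1$ whenever $k_n=o(n)$. Write $\mathcal{X}\unlhd\mathcal{X}'$ (for $\mathcal{X}=[X,d,\mu]$, $\mathcal{X}'=[X',d',\mu']$) if there is a surjective 1-Lipschitz map $\phi:X'\to X$ with $\mu(A)\le\mu'(\phi^{-1}(A))$ for all Borel $A\subset X$. For Borel probability measures $\mathbb{P},\mathbb{P}'$ on $\mathbb{M}_{\mathrm{GHP}}$, $\mathbb{P}\unlhd_{\mathrm{st}}\mathbb{P}'$ means $\mathbb{P}(A)\le\mathbb{P}'(A)$ for every Borel set $A$ that is $\unlhd$-increasing ($\mathcal{X}\in A$, $\mathcal{X}\unlhd\mathcal{X}'$ imply $\mathcal{X}'\in A$). *)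

theory Defs
  imports "HOL-Probability.Probability"
begin

text \<open>A representative (X, d, mu): carrier X (a set of labels of type real; every compact
metric space has cardinality at most the continuum), a metric d on X, and a finite Borel
measure mu on (X, d).\<close>

type_synonym mms = "real set \<times> (real \<Rightarrow> real \<Rightarrow> real) \<times> real measure"

definition metric_borel :: "'a set \<Rightarrow> ('a \<Rightarrow> 'a \<Rightarrow> real) \<Rightarrow> 'a measure" where
  "metric_borel Z dZ = sigma Z {U. openin (Metric_space.mtopology Z dZ) U}"

definition is_mms :: "mms \<Rightarrow> bool" where
  "is_mms \<XX> \<longleftrightarrow> (case \<XX> of (X, d, \<mu>) \<Rightarrow>
     X \<noteq> {} \<and> Metric_space X d \<and> compact_space (Metric_space.mtopology X d) \<and>
     finite_measure \<mu> \<and> space \<mu> = X \<and> sets \<mu> = sets (metric_borel X d))"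

definition mms_space :: "mms set" where
  "mms_space = {\<XX>. is_mms \<XX>}"

definition nbhd :: "'a set \<Rightarrow> ('a \<Rightarrow> 'a \<Rightarrow> real) \<Rightarrow> 'a set \<Rightarrow> real \<Rightarrow> 'a set" where
  "nbhd Z dZ A \<epsilon> = {z \<in> Z. \<exists>x\<in>A. dZ z x < \<epsilon>}"

definition hausdorff_dist :: "'a set \<Rightarrow> ('a \<Rightarrow> 'a \<Rightarrow> real) \<Rightarrow> 'a set \<Rightarrow> 'a set \<Rightarrow> real" where
  "hausdorff_dist Z dZ A B =
     Inf {\<epsilon>. \<epsilon> > 0 \<and> A \<subseteq> nbhd Z dZ B \<epsilon> \<and> B \<subseteq> nbhd Z dZ A \<epsilon>}"

definition prokhorov_dist :: "'a set \<Rightarrow> ('a \<Rightarrow> 'a \<Rightarrow> real) \<Rightarrow> 'a measure \<Rightarrow> 'a measure \<Rightarrow> real" where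
  "prokhorov_dist Z dZ \<mu> \<nu> =
     Inf {\<epsilon>. \<epsilon> > 0 \<and> (\<forall>F. closedin (Metric_space.mtopology Z dZ) F \<longrightarrow>
            measure \<mu> F \<le> measure \<nu> (nbhd Z dZ F \<epsilon>) + \<epsilon> \<and>
            measure \<nu> F \<le> measure \<mu> (nbhd Z dZ F \<epsilon>) + \<epsilon>)}"

definition isometric_embedding ::
  "'a set \<Rightarrow> ('a \<Rightarrow> 'a \<Rightarrow> real) \<Rightarrow> 'b set \<Rightarrow> ('b \<Rightarrow> 'b \<Rightarrow> real) \<Rightarrow> ('a \<Rightarrow> 'b) \<Rightarrow> bool" where
  "isometric_embedding X d Z dZ \<phi> \<longleftrightarrow>
     \<phi> ` X \<subseteq> Z \<and> (\<forall>x\<in>X. \<forall>y\<in>X. dZ (\<phi> x) (\<phi> y) = d x y)"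

text \<open>GHP distance: infimum over common isometric embeddings into a metric space (Z, dZ)
(whose points are again labelled by reals; the union of the two images has cardinality at most
the continuum, and one may restrict Z to that union).\<close>
definition ghp_dist :: "mms \<Rightarrow> mms \<Rightarrow> real" where
  "ghp_dist \<XX> \<YY> = (case \<XX> of (X, d, \<mu>) \<Rightarrow> case \<YY> of (Y, e, \<nu>) \<Rightarrow>
     Inf {hausdorff_dist Z dZ (\<phi> ` X) (\<psi> ` Y) +
          prokhorov_dist Z dZ (distr \<mu> (metric_borel Z dZ) \<phi>) (distr \<nu> (metric_borel Z dZ) \<psi>)
        | (Z :: real set) dZ \<phi> \<psi>. Metric_space Z dZ \<and>
            isometric_embedding X d Z dZ \<phi> \<and> isometric_embedding Y e Z dZ \<psi>})"

definition ghp_open :: "mms set \<Rightarrow> bool" where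
  "ghp_open U \<longleftrightarrow> U \<subseteq> mms_space \<and>
     (\<forall>x\<in>U. \<exists>r>0. \<forall>y\<in>mms_space. ghp_dist x y < r \<longrightarrow> y \<in> U)"

definition GHP :: "mms measure" where
  "GHP = sigma mms_space {U. ghp_open U}"

definition scale_mms :: "real \<Rightarrow> real \<Rightarrow> mms \<Rightarrow> mms" where
  "scale_mms a b \<XX> = (case \<XX> of (X, d, \<mu>) \<Rightarrow> (X, \<lambda>x y. a * d x y, scale_measure (ennreal b) \<mu>))"

text \<open>Tame sequences (indexed by n >= 1; the value at 0 is irrelevant). The shifts k_n are
integers with k_n = o(n); values at finitely many indices where n + k_n <= 0 do not affect
the limit.\<close>
definition tame :: "(nat \<Rightarrow> real) \<Rightarrow> bool" where
  "tame x \<longleftrightarrow> (\<forall>n\<ge>1. x n > 0) \<and>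
     (\<forall>k :: nat \<Rightarrow> int. ((\<lambda>n. real_of_int (k n) / real n) \<longlonglongrightarrow> 0) \<longrightarrow>
        ((\<lambda>n. x (nat (int n + k n)) / x n) \<longlonglongrightarrow> 1))"

definition mms_le :: "mms \<Rightarrow> mms \<Rightarrow> bool" where
  "mms_le \<XX> \<XX>' \<longleftrightarrow> (case \<XX> of (X, d, \<mu>) \<Rightarrow> case \<XX>' of (X', d', \<mu>') \<Rightarrow>
     (\<exists>\<phi>. \<phi> ` X' = X \<and> (\<forall>x\<in>X'. \<forall>y\<in>X'. d (\<phi> x) (\<phi> y) \<le> d' x y) \<and>
          (\<forall>A \<in> sets \<mu>. emeasure \<mu> A \<le> emeasure \<mu>' (\<phi> -` A \<inter> X'))))"

definition increasing_set :: "mms set \<Rightarrow> bool" where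
  "increasing_set A \<longleftrightarrow> (\<forall>\<XX>\<in>A. \<forall>\<XX>'\<in>mms_space. mms_le \<XX> \<XX>' \<longrightarrow> \<XX>' \<in> A)"

definition st_le :: "mms measure \<Rightarrow> mms measure \<Rightarrow> bool" where
  "st_le P P' \<longleftrightarrow> (\<forall>A \<in> sets GHP. increasing_set A \<longrightarrow> measure P A \<le> measure P' A)"

definition ghp_continuous :: "(mms \<Rightarrow> real) \<Rightarrow> bool" where
  "ghp_continuous f \<longleftrightarrow> (\<forall>x\<in>mms_space. \<forall>\<epsilon>>0. \<exists>\<delta>>0. \<forall>y\<in>mms_space.
      ghp_dist x y < \<delta> \<longrightarrow> \<bar>f y - f x\<bar> < \<epsilon>)"

definition conv_distr :: "'w measure \<Rightarrow> (nat \<Rightarrow> 'w \<Rightarrow> mms) \<Rightarrow> ('w \<Rightarrow> mms) \<Rightarrow> bool" where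
  "conv_distr M Y Yinf \<longleftrightarrow> (\<forall>f. (\<exists>B. \<forall>x\<in>mms_space. \<bar>f x\<bar> \<le> B) \<and> ghp_continuous f \<longrightarrow>
     ((\<lambda>n. \<integral>\<omega>. f (Y n \<omega>) \<partial>M) \<longlonglongrightarrow> (\<integral>\<omega>. f (Yinf \<omega>) \<partial>M)))"

end

theory Submission
  imports Defs
begin

text \<open>
  For \<open>n\<close> large, choose \<open>m\<close> slightly larger (smaller) than \<open>n\<close>, so that \<open>N m \<ge> n\<close>
  (\<open>N m \<le> n\<close>) with high probability. By independence and stochastic monotonicity, the expectation
  of an increasing test function at \<open>X n\<close> is then squeezed, up to \<open>o(1)\<close>, between its expectations
  at \<open>X (N m)\<close> for these two choices; by tameness the change from the scaling \<open>(a n, b n)\<close> to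
  \<open>(a m, b m)\<close> is absorbed by scaling with constants close to 1. So the claimed convergence holds
  when tested against bounded continuous increasing functions.

  To pass to all bounded continuous functions, consider the predicate that a space contains \<open>k\<close>
  points with prescribed lower bounds on the pairwise distances, on their sum, and on the mass of the
  set of points far from any given subset of them. This predicate is preserved upwards by the order and
  it is stable under small GHP perturbations, so the slack with which it holds is a continuous increasing
  function. Finitely many such functions with rational parameters confine a space to a GHP ball:
  compare a near-maximal configuration of one space with the configuration in the other one whose
  distances are not much smaller. The sums of distances are almost equal, hence so are the distances
  themselves, and both configurations are nets. Thus every bounded continuous function is a countable
  supremum of elements of the vector lattice spanned by the increasing test functions.
\<close>

section \<open>Compact metric measure spaces\<close>

text \<open>The order transports lower bounds only: along a surjective 1-Lipschitz map points can be
  lifted, and distances between lifts and masses of sets far from finitely many points can only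
  grow. An upper bound on one distance, or on the mass near some points, is not of this kind, so it
  must come from the failure of an increasing condition. This is why a sum of distances is recorded:
  one upper bound on it turns lower bounds on all summands into an upper bound on each. Likewise an
  upper bound on the total mass turns lower bounds on far masses into upper bounds on masses near
  finitely many points. The extremal number of separated points and the extremal sum may jump as the
  separation varies. They are therefore taken as left limits at a separation
  \<open>\<epsilon>\<close>, which leaves an interval below \<open>\<epsilon>\<close> for
  perturbations and rational roundings. Rational parameters make the family of minorants countable,
  so that dominated convergence under the limit law alone gives a lower bound on the limit of the
  integrals of a nonnegative \<open>f\<close>. Shifting \<open>f\<close> and \<open>- f\<close> by a
  constant then yields both inequalities.\<close>

locale compact_mms = Metric_space X d + finite_measure \<mu>
  for X :: "real set" and d :: "real \<Rightarrow> real \<Rightarrow> real" and \<mu> :: "real measure" +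
  assumes nonempty: "X \<noteq> {}"
    and compact: "compact_space mtopology"
    and space_eq: "space \<mu> = X"
    and sets_eq: "sets \<mu> = sets (metric_borel X d)"

lemma mms_space_iff: "(X, d, \<mu>) \<in> mms_space \<longleftrightarrow> compact_mms X d \<mu>"
  by (auto simp: mms_space_def is_mms_def compact_mms_def compact_mms_axioms_def)

lemma mms_spaceE:
  assumes "x \<in> mms_space"
  obtains X d \<mu> where "x = (X, d, \<mu>)" "compact_mms X d \<mu>"
  using assms by (metis mms_space_iff prod_cases3)

context Metric_space
begin

lemma space_metric_borel: "space (metric_borel M d) = M"
  unfolding metric_borel_def by (rule space_measure_of) (auto simp: openin_mtopology)

lemma openin_in_sets: "openin mtopology U \<Longrightarrow> U \<in> sets (metric_borel M d)"
  unfolding metric_borel_def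
  by (subst sets_measure_of) (auto simp: openin_mtopology)

lemma closedin_in_sets:
  assumes "closedin mtopology C"
  shows "C \<in> sets (metric_borel M d)"
proof -
  have "M - C \<in> sets (metric_borel M d)"
    using assms by (intro openin_in_sets) (auto simp: closedin_def)
  then have "M - (M - C) \<in> sets (metric_borel M d)"
    using sets.compl_sets[of "M - C" "metric_borel M d"] by (simp add: space_metric_borel)
  moreover have "C \<subseteq> M"
    using closedin_subset[OF assms] by simp
  ultimately show ?thesis
    by (simp add: double_diff)
qed

lemma openin_nbhd:
  assumes "A \<subseteq> M"
  shows "openin mtopology (nbhd M d A \<epsilon>)"
proof -
  have "nbhd M d A \<epsilon> = (\<Union>x\<in>A. mball x \<epsilon>)"
    using assms by (auto simp: nbhd_def mball_def commute)
  then show ?thesis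
    by auto
qed

lemma closedin_far:
  assumes "\<forall>j\<in>F. p j \<in> M"
  shows "closedin mtopology {z\<in>M. \<forall>j\<in>F. s \<le> d z (p j)}"
proof -
  have "{z\<in>M. \<forall>j\<in>F. s \<le> d z (p j)} = M - (\<Union>j\<in>F. mball (p j) s)"
    using assms by (force simp: mball_def commute)
  moreover have "openin mtopology (\<Union>j\<in>F. mball (p j) s)"
    by auto
  ultimately show ?thesis
    by (metis closedin_diff closedin_topspace topspace_mtopology)
qed

lemma continuous_isometric_preimage:
  assumes "Metric_space Z dZ" "isometric_embedding M d Z dZ \<phi>"
    and "openin (Metric_space.mtopology Z dZ) U"
  shows "openin mtopology (\<phi> -` U \<inter> M)"
proof -
  interpret Z: Metric_space Z dZ by fact
  show ?thesis
    unfolding openin_mtopology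
  proof (intro conjI allI impI)
    fix x assume x: "x \<in> \<phi> -` U \<inter> M"
    then obtain r where r: "r > 0" "Z.mball (\<phi> x) r \<subseteq> U"
      using assms(3) by (auto simp: Z.openin_mtopology)
    have "mball x r \<subseteq> \<phi> -` U \<inter> M"
    proof
      fix y assume y: "y \<in> mball x r"
      then have "\<phi> y \<in> Z.mball (\<phi> x) r"
        using x assms(2) by (auto simp: isometric_embedding_def)
      then show "y \<in> \<phi> -` U \<inter> M"
        using r y by auto
    qed
    then show "\<exists>r>0. mball x r \<subseteq> \<phi> -` U \<inter> M"
      using r by blast
  qed auto
qed

end

context compact_mms
begin

lemma closedin_sets: "closedin mtopology C \<Longrightarrow> C \<in> sets \<mu>"
  by (simp add: sets_eq closedin_in_sets)

lemma openin_sets: "openin mtopology C \<Longrightarrow> C \<in> sets \<mu>"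
  by (simp add: sets_eq openin_in_sets)

lemma far_sets: "\<forall>j\<in>F. p j \<in> X \<Longrightarrow> {z\<in>X. \<forall>j\<in>F. s \<le> d z (p j)} \<in> sets \<mu>"
  by (intro closedin_sets closedin_far)

lemma isometric_measurable:
  assumes "Metric_space Z dZ" "isometric_embedding X d Z dZ \<phi>"
  shows "\<phi> \<in> measurable \<mu> (metric_borel Z dZ)"
proof -
  interpret Z: Metric_space Z dZ by fact
  show ?thesis
    unfolding metric_borel_def
  proof (rule measurable_measure_of)
    show "{U. openin Z.mtopology U} \<subseteq> Pow Z"
      by (auto simp: Z.openin_mtopology)
    show "\<phi> \<in> space \<mu> \<rightarrow> Z"
      using assms(2) by (auto simp: isometric_embedding_def space_eq)
    fix U assume "U \<in> {U. openin Z.mtopology U}"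
    then show "\<phi> -` U \<inter> space \<mu> \<in> sets \<mu>"
      using continuous_isometric_preimage[OF assms] openin_sets by (simp add: space_eq)
  qed
qed

lemma mtotally_bounded: "mtotally_bounded X"
  using compact compactin_imp_mtotally_bounded[of X] by (simp add: compact_space_def)

lemma finite_net:
  assumes "\<epsilon> > 0"
  obtains k :: nat and p where "\<forall>i<k. p i \<in> X" "\<forall>x\<in>X. \<exists>i<k. d x (p i) < \<epsilon>"
proof -
  obtain K where K: "finite K" "K \<subseteq> X" "X \<subseteq> (\<Union>x\<in>K. mball x \<epsilon>)"
    using mtotally_bounded assms by (auto simp: mtotally_bounded_def)
  obtain p :: "nat \<Rightarrow> real" where p: "bij_betw p {0..<card K} K"
    using K(1) ex_bij_betw_nat_finite by blast
  show thesis
  proof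
    show "\<forall>i<card K. p i \<in> X"
      using p K by (auto simp: bij_betw_def)
    show "\<forall>x\<in>X. \<exists>i<card K. d x (p i) < \<epsilon>"
    proof
      fix x assume "x \<in> X"
      then obtain y where y: "y \<in> K" "d y x < \<epsilon>"
        using K by auto
      then obtain i where "i < card K" "y = p i"
        using p by (metis atLeast0LessThan bij_betw_imp_surj_on imageE lessThan_iff)
      then show "\<exists>i<card K. d x (p i) < \<epsilon>"
        using y commute by auto
    qed
  qed
qed

lemma bounded_dist:
  obtains D where "D > 0" "\<And>x y. x \<in> X \<Longrightarrow> y \<in> X \<Longrightarrow> d x y \<le> D"
proof -
  have "mbounded X"
    using mtotally_bounded by (rule mtotally_bounded_imp_mbounded)
  then obtain B where B: "\<forall>x\<in>X. \<forall>y\<in>X. d x y \<le> B"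
    using mbounded_alt by auto
  show thesis
    by (rule that[of "max B 1"]) (use B in \<open>auto simp: le_max_iff_disj\<close>)
qed

text \<open>Pigeonhole on an \<open>\<epsilon>/2\<close>-net: two separated points cannot be
  assigned to the same net point. The bound makes a greatest size available in
  \<open>near_optimal_configuration\<close>.\<close>

lemma separated_bounded:
  assumes "\<epsilon> > 0"
  shows "\<exists>K::nat. \<forall>k p. (\<forall>i<k. p i \<in> X) \<and> (\<forall>i<k. \<forall>j<k. i \<noteq> j \<longrightarrow> \<epsilon> \<le> d (p i) (p j)) \<longrightarrow> k \<le> K"
proof -
  obtain K :: nat and q where q: "\<forall>i<K. q i \<in> X" "\<forall>x\<in>X. \<exists>i<K. d x (q i) < \<epsilon>/2"
    using finite_net[of "\<epsilon>/2"] assms half_gt_zero by blast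
  show ?thesis
  proof (intro exI[of _ K] allI impI, elim conjE)
    fix k :: nat and p :: "nat \<Rightarrow> real" assume p: "\<forall>i<k. p i \<in> X" "\<forall>i<k. \<forall>j<k. i \<noteq> j \<longrightarrow> \<epsilon> \<le> d (p i) (p j)"
    then have "\<forall>i\<in>{..<k}. \<exists>j. j < K \<and> d (p i) (q j) < \<epsilon>/2"
      using q by blast
    from bchoice[OF this] obtain h where h: "\<forall>i<k. h i < K \<and> d (p i) (q (h i)) < \<epsilon>/2"
      by auto
    have "inj_on h {..<k}"
    proof (rule inj_onI, rule ccontr)
      fix i j assume ij: "i \<in> {..<k}" "j \<in> {..<k}" "h i = h j" "i \<noteq> j"
      then have "d (p i) (q (h i)) < \<epsilon>/2" "d (p j) (q (h i)) < \<epsilon>/2"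
        using h by (metis lessThan_iff)+
      moreover have "d (p i) (p j) \<le> d (p i) (q (h i)) + d (q (h i)) (p j)"
        using p q h ij by (intro triangle) auto
      ultimately have "d (p i) (p j) < \<epsilon>"
        using commute[of "q (h i)" "p j"] by linarith
      then show False
        using p(2) ij by (metis lessThan_iff not_le)
    qed
    moreover have "h ` {..<k} \<subseteq> {..<K}"
      using h by auto
    ultimately show "k \<le> K"
      using card_inj_on_le[of h "{..<k}" "{..<K}"] by simp
  qed
qed

end

text \<open>The Hausdorff and Prokhorov conditions at one threshold in one embedding, with preimages
  in place of pushed-forward measures. Its witnesses can be used directly, unlike an infimum. On
  \<open>mms_space\<close> it agrees with a bound on \<open>ghp_dist\<close> up to a factor
  2.\<close>

definition ghp_close :: "real \<Rightarrow> mms \<Rightarrow> mms \<Rightarrow> bool" where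
  "ghp_close \<rho> x y = (case x of (X, d, \<mu>) \<Rightarrow> case y of (Y, e, \<nu>) \<Rightarrow>
     (\<exists>(Z :: real set) dZ \<phi> \<psi>. Metric_space Z dZ \<and>
        isometric_embedding X d Z dZ \<phi> \<and> isometric_embedding Y e Z dZ \<psi> \<and>
        (\<forall>x\<in>X. \<exists>y\<in>Y. dZ (\<phi> x) (\<psi> y) < \<rho>) \<and> (\<forall>y\<in>Y. \<exists>x\<in>X. dZ (\<psi> y) (\<phi> x) < \<rho>) \<and>
        (\<forall>C. closedin (Metric_space.mtopology Z dZ) C \<longrightarrow>
           measure \<mu> (\<phi> -` C \<inter> X) \<le> measure \<nu> (\<psi> -` nbhd Z dZ C \<rho> \<inter> Y) + \<rho> \<and>
           measure \<nu> (\<psi> -` C \<inter> Y) \<le> measure \<mu> (\<phi> -` nbhd Z dZ C \<rho> \<inter> X) + \<rho>)))"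

lemma ghp_close_sym:
  assumes "ghp_close \<rho> x y"
  shows "ghp_close \<rho> y x"
proof -
  obtain X d \<mu> Y e \<nu> where xy: "x = (X, d, \<mu>)" "y = (Y, e, \<nu>)"
    by (metis prod_cases3)
  show ?thesis
    using assms unfolding ghp_close_def xy prod.case
  proof (elim exE, goal_cases)
    case (1 Z dZ \<phi> \<psi>)
    then show ?case
      by (intro exI[of _ Z] exI[of _ dZ] exI[of _ \<psi>] exI[of _ \<phi>]) simp
  qed
qed

locale common_embedding =
  x: compact_mms X d \<mu> + y: compact_mms Y e \<nu> + Z: Metric_space Z dZ
  for X d \<mu> Y e \<nu> and Z :: "real set" and dZ +
  fixes \<phi> \<psi> :: "real \<Rightarrow> real"
  assumes emb: "isometric_embedding X d Z dZ \<phi>" "isometric_embedding Y e Z dZ \<psi>"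
begin

abbreviation "hd_set \<equiv> {\<epsilon>. \<epsilon> > 0 \<and> \<phi> ` X \<subseteq> nbhd Z dZ (\<psi> ` Y) \<epsilon> \<and> \<psi> ` Y \<subseteq> nbhd Z dZ (\<phi> ` X) \<epsilon>}"

abbreviation "pk_set \<equiv> {\<epsilon>. \<epsilon> > 0 \<and> (\<forall>C. closedin Z.mtopology C \<longrightarrow>
   measure \<mu> (\<phi> -` C \<inter> X) \<le> measure \<nu> (\<psi> -` nbhd Z dZ C \<epsilon> \<inter> Y) + \<epsilon> \<and>
   measure \<nu> (\<psi> -` C \<inter> Y) \<le> measure \<mu> (\<phi> -` nbhd Z dZ C \<epsilon> \<inter> X) + \<epsilon>)}"

lemma hausdorff_eq: "hausdorff_dist Z dZ (\<phi> ` X) (\<psi> ` Y) = Inf hd_set"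
  by (simp add: hausdorff_dist_def)

lemma prokhorov_eq:
  "prokhorov_dist Z dZ (distr \<mu> (metric_borel Z dZ) \<phi>) (distr \<nu> (metric_borel Z dZ) \<psi>) = Inf pk_set"
proof -
  have m: "\<phi> \<in> measurable \<mu> (metric_borel Z dZ)" "\<psi> \<in> measurable \<nu> (metric_borel Z dZ)"
    using x.isometric_measurable y.isometric_measurable emb Z.Metric_space_axioms by auto
  have "C \<in> sets (metric_borel Z dZ)" "nbhd Z dZ C \<epsilon> \<in> sets (metric_borel Z dZ)"
    if "closedin Z.mtopology C" for C \<epsilon>
    using that Z.closedin_in_sets Z.openin_in_sets Z.openin_nbhd closedin_subset[OF that] by auto
  then show ?thesis
    unfolding prokhorov_dist_def
    by (intro arg_cong[where f = Inf] Collect_cong conj_cong all_cong imp_cong refl)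
      (simp_all add: measure_distr m x.space_eq y.space_eq)
qed

text \<open>The real \<open>Inf\<close> says nothing about an empty set, so a member is exhibited: a
  number exceeding both diameters plus the distance between two base points.\<close>

lemma hd_set_nonempty: "hd_set \<noteq> {}"
proof -
  obtain D where D: "D > 0" "\<And>x y. x \<in> X \<Longrightarrow> y \<in> X \<Longrightarrow> d x y \<le> D"
    using x.bounded_dist by blast
  obtain E where E: "E > 0" "\<And>x y. x \<in> Y \<Longrightarrow> y \<in> Y \<Longrightarrow> e x y \<le> E"
    using y.bounded_dist by blast
  obtain x0 y0 where xy: "x0 \<in> X" "y0 \<in> Y"
    using x.nonempty y.nonempty by auto
  define R where "R = D + E + dZ (\<phi> x0) (\<psi> y0) + 1"
  have R: "dZ (\<phi> x) (\<psi> y0) < R" if "x \<in> X" for x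
  proof -
    have "dZ (\<phi> x) (\<psi> y0) \<le> dZ (\<phi> x) (\<phi> x0) + dZ (\<phi> x0) (\<psi> y0)"
      using emb that xy by (intro Z.triangle) (auto simp: isometric_embedding_def)
    also have "dZ (\<phi> x) (\<phi> x0) \<le> D"
      using emb that xy D by (auto simp: isometric_embedding_def)
    finally show ?thesis
      using E(1) by (simp add: R_def)
  qed
  have R': "dZ (\<psi> y) (\<phi> x0) < R" if "y \<in> Y" for y
  proof -
    have "dZ (\<psi> y) (\<phi> x0) \<le> dZ (\<psi> y) (\<psi> y0) + dZ (\<psi> y0) (\<phi> x0)"
      using emb that xy by (intro Z.triangle) (auto simp: isometric_embedding_def)
    also have "dZ (\<psi> y) (\<psi> y0) \<le> E"
      using emb that xy E by (auto simp: isometric_embedding_def)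
    finally show ?thesis
      using D(1) by (simp add: R_def Z.commute)
  qed
  have "R > 0"
    using D(1) E(1) Z.nonneg[of "\<phi> x0" "\<psi> y0"] by (simp add: R_def del: Z.nonneg)
  then have "R \<in> hd_set"
    using R R' emb xy by (auto simp: nbhd_def isometric_embedding_def image_subset_iff)
  then show ?thesis
    by blast
qed

lemma pk_set_nonempty: "pk_set \<noteq> {}"
proof -
  \<comment> \<open>Above both total masses, hence the Prokhorov inequalities hold whatever the
    neighbourhoods are.\<close>
  let ?R = "measure \<mu> X + measure \<nu> Y + 1"
  have \<mu>: "measure \<mu> A \<le> b + ?R" and \<nu>: "measure \<nu> A \<le> b + ?R" if "0 \<le> b" for A and b :: real
    using that x.bounded_measure[of A] y.bounded_measure[of A]
      measure_nonneg[of \<mu> X] measure_nonneg[of \<nu> Y]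
    unfolding x.space_eq y.space_eq by linarith+
  have "?R > 0"
    using measure_nonneg[of \<mu> X] measure_nonneg[of \<nu> Y] by linarith
  then have "?R \<in> pk_set"
    by (simp add: \<mu> \<nu>)
  then show ?thesis
    by blast
qed

lemma hd_nonneg: "0 \<le> hausdorff_dist Z dZ (\<phi> ` X) (\<psi> ` Y)"
  unfolding hausdorff_eq using hd_set_nonempty by (intro cInf_greatest) auto

lemma pk_nonneg: "0 \<le> prokhorov_dist Z dZ (distr \<mu> (metric_borel Z dZ) \<phi>) (distr \<nu> (metric_borel Z dZ) \<psi>)"
  unfolding prokhorov_eq using pk_set_nonempty by (intro cInf_greatest) auto

end

section \<open>Gluing along finite nets\<close>

text \<open>Serves to relabel a glued space, which lives on a sum type, by real numbers, as
  \<open>ghp_dist\<close> requires of the ambient space.\<close>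

lemma (in Metric_space) metric_space_pullback:
  assumes "inj_on c Z" "c ` Z \<subseteq> M"
  shows "Metric_space Z (\<lambda>z w. d (c z) (c w))"
proof
  show "d (c x) (c y) = d (c y) (c x)" for x y
    by (rule commute)
  show "d (c x) (c y) = 0 \<longleftrightarrow> x = y" if "x \<in> Z" "y \<in> Z" for x y
    using that assms zero by (metis image_subset_iff inj_on_eq_iff)
  show "d (c x) (c z) \<le> d (c x) (c y) + d (c y) (c z)" if "x \<in> Z" "y \<in> Z" "z \<in> Z" for x y z
    using that assms by (intro triangle) auto
qed simp

text \<open>Length of a shortest path from \<open>x\<close> to \<open>y\<close> over one of
  \<open>k\<close> bridges, where bridge \<open>i\<close> has length \<open>\<epsilon>\<close> and
  joins \<open>p i\<close> to \<open>q i\<close>.\<close>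

definition glue_dist ::
  "nat \<Rightarrow> real \<Rightarrow> ('a \<Rightarrow> 'a \<Rightarrow> real) \<Rightarrow> (nat \<Rightarrow> 'a) \<Rightarrow> ('b \<Rightarrow> 'b \<Rightarrow> real) \<Rightarrow> (nat \<Rightarrow> 'b) \<Rightarrow> 'a \<Rightarrow> 'b \<Rightarrow> real"
  where "glue_dist k \<epsilon> d p e q x y = Min ((\<lambda>i. d x (p i) + \<epsilon> + e (q i) y) ` {..<k})"

definition glue_metric ::
  "nat \<Rightarrow> real \<Rightarrow> ('a \<Rightarrow> 'a \<Rightarrow> real) \<Rightarrow> (nat \<Rightarrow> 'a) \<Rightarrow> ('b \<Rightarrow> 'b \<Rightarrow> real) \<Rightarrow> (nat \<Rightarrow> 'b) \<Rightarrow> 'a + 'b \<Rightarrow> 'a + 'b \<Rightarrow> real"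
  where "glue_metric k \<epsilon> d p e q u v = (case u of
     Inl x \<Rightarrow> (case v of Inl x' \<Rightarrow> d x x' | Inr y \<Rightarrow> glue_dist k \<epsilon> d p e q x y)
   | Inr y \<Rightarrow> (case v of Inl x \<Rightarrow> glue_dist k \<epsilon> d p e q x y | Inr y' \<Rightarrow> e y y'))"

lemma glue_dist_le: "i < k \<Longrightarrow> glue_dist k \<epsilon> d p e q x y \<le> d x (p i) + \<epsilon> + e (q i) y"
  unfolding glue_dist_def by (intro Min_le) auto

lemma glue_dist_attained:
  assumes "k > 0"
  obtains i where "i < k" "glue_dist k \<epsilon> d p e q x y = d x (p i) + \<epsilon> + e (q i) y"
proof -
  have "glue_dist k \<epsilon> d p e q x y \<in> (\<lambda>i. d x (p i) + \<epsilon> + e (q i) y) ` {..<k}"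
    unfolding glue_dist_def using assms by (intro Min_in) auto
  then show thesis
    using that by auto
qed

text \<open>The critical triangle inequalities are those that leave one space and return to it. Such
  a path crosses two bridges and so pays \<open>2 * \<epsilon>\<close>, which is exactly the
  distortion allowed between the two configurations; hence a detour is never a shortcut.\<close>

lemma Metric_space_glue:
  fixes k :: nat
  assumes "Metric_space X d" "Metric_space Y e" and k: "k > 0" and \<epsilon>: "\<epsilon> > 0"
    and p: "\<And>i. i < k \<Longrightarrow> p i \<in> X" and q: "\<And>i. i < k \<Longrightarrow> q i \<in> Y"
    and dist: "\<And>i j. i < k \<Longrightarrow> j < k \<Longrightarrow> \<bar>d (p i) (p j) - e (q i) (q j)\<bar> \<le> 2 * \<epsilon>"
  shows "Metric_space (X <+> Y) (glue_metric k \<epsilon> d p e q)"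
proof -
  interpret X: Metric_space X d by fact
  interpret Y: Metric_space Y e by fact
  let ?D = "glue_dist k \<epsilon> d p e q"
  have pos: "?D x y > 0" for x y
    using glue_dist_attained[OF k, of \<epsilon> d p e q x y] \<epsilon> X.nonneg[of x] Y.nonneg[of _ y]
    by (metis add.commute add_strict_increasing2 add_nonneg_pos add_pos_nonneg)
  have t1: "?D x y \<le> d x x' + ?D x' y" if "x \<in> X" "x' \<in> X" "y \<in> Y" for x x' y
  proof -
    obtain i where i: "i < k" "?D x' y = d x' (p i) + \<epsilon> + e (q i) y"
      using glue_dist_attained[OF k] by metis
    show ?thesis
      using glue_dist_le[OF i(1), of \<epsilon> d p e q x y] X.triangle[OF that(1,2) p[OF i(1)]] i(2)
      by linarith
  qed
  have t2: "?D x y \<le> ?D x y' + e y' y" if "x \<in> X" "y \<in> Y" "y' \<in> Y" for x y y'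
  proof -
    obtain i where i: "i < k" "?D x y' = d x (p i) + \<epsilon> + e (q i) y'"
      using glue_dist_attained[OF k] by metis
    show ?thesis
      using glue_dist_le[OF i(1), of \<epsilon> d p e q x y] Y.triangle[OF q[OF i(1)] that(3,2)] i(2)
      by linarith
  qed
  have t3: "d x x' \<le> ?D x y + ?D x' y" if "x \<in> X" "x' \<in> X" "y \<in> Y" for x x' y
  proof -
    obtain i where i: "i < k" "?D x y = d x (p i) + \<epsilon> + e (q i) y"
      using glue_dist_attained[OF k] by metis
    obtain j where j: "j < k" "?D x' y = d x' (p j) + \<epsilon> + e (q j) y"
      using glue_dist_attained[OF k] by metis
    have "d x x' \<le> d x (p i) + d (p i) (p j) + d (p j) x'"
      using X.triangle[OF that(1) p[OF i(1)] that(2)]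
        X.triangle[OF p[OF i(1)] p[OF j(1)] that(2)] by linarith
    moreover have "e (q i) (q j) \<le> e (q i) y + e (q j) y"
      using Y.triangle[OF q[OF i(1)] that(3) q[OF j(1)]] Y.commute[of "q j" y] by simp
    ultimately show ?thesis
      using dist[OF i(1) j(1)] i(2) j(2) X.commute[of "p j" x'] by linarith
  qed
  have t4: "e y y' \<le> ?D x y + ?D x y'" if "x \<in> X" "y \<in> Y" "y' \<in> Y" for x y y'
  proof -
    obtain i where i: "i < k" "?D x y = d x (p i) + \<epsilon> + e (q i) y"
      using glue_dist_attained[OF k] by metis
    obtain j where j: "j < k" "?D x y' = d x (p j) + \<epsilon> + e (q j) y'"
      using glue_dist_attained[OF k] by metis
    have "e y y' \<le> e y (q i) + e (q i) (q j) + e (q j) y'"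
      using Y.triangle[OF that(2) q[OF i(1)] that(3)]
        Y.triangle[OF q[OF i(1)] q[OF j(1)] that(3)] by linarith
    moreover have "d (p i) (p j) \<le> d x (p i) + d x (p j)"
      using X.triangle[OF p[OF i(1)] that(1) p[OF j(1)]] X.commute[of "p i" x] by simp
    ultimately show ?thesis
      using dist[OF i(1) j(1)] i(2) j(2) Y.commute[of y "q i"] by linarith
  qed
  show ?thesis
  proof
    fix u v w
    show "0 \<le> glue_metric k \<epsilon> d p e q u v"
      using pos by (auto simp: glue_metric_def less_imp_le split: sum.splits)
    show "glue_metric k \<epsilon> d p e q u v = glue_metric k \<epsilon> d p e q v u"
      by (auto simp: glue_metric_def X.commute Y.commute split: sum.splits)
    assume u: "u \<in> X <+> Y" and v: "v \<in> X <+> Y"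
    show "glue_metric k \<epsilon> d p e q u v = 0 \<longleftrightarrow> u = v"
      using u v pos by (auto simp: glue_metric_def less_le split: sum.splits)
    assume w: "w \<in> X <+> Y"
    show "glue_metric k \<epsilon> d p e q u w \<le> glue_metric k \<epsilon> d p e q u v + glue_metric k \<epsilon> d p e q v w"
      using u v w
    proof (elim PlusE; simp add: glue_metric_def)
      fix x x' y assume "x \<in> X" "x' \<in> X" "y \<in> Y"
      then show "d x x' \<le> ?D x y + ?D x' y" "?D x y \<le> d x x' + ?D x' y" "?D x' y \<le> ?D x y + d x x'"
        using t3 t1[of x x' y] t1[of x' x y] by (auto simp: X.commute add.commute)
    next
      fix x y y' assume "x \<in> X" "y \<in> Y" "y' \<in> Y"
      then show "e y y' \<le> ?D x y + ?D x y'" "?D x y \<le> ?D x y' + e y' y" "?D x y \<le> e y y' + ?D x y'"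
        using t4 t2[of x y y'] by (auto simp: Y.commute add.commute)
    qed (auto intro: X.triangle Y.triangle)
  qed
qed

text \<open>The radius is \<open>2 * \<epsilon>\<close> to a bridge, \<open>\<epsilon>\<close>
  across it and \<open>2 * \<epsilon>\<close> away from it. In \<open>measX\<close> and
  \<open>measY\<close> the set \<open>E\<close> is made of points sharing a bridge with a point of
  \<open>C\<close>, so \<open>E\<close> lies in the neighbourhood of \<open>C\<close> of that
  radius, and its mass bounds that of the neighbourhood from below.\<close>

lemma glue_ghp_close:
  fixes k :: nat
  assumes X: "compact_mms X d \<mu>" and Y: "compact_mms Y e \<nu>" and k: "k > 0" and \<epsilon>: "\<epsilon> > 0"
    and p: "\<And>i. i < k \<Longrightarrow> p i \<in> X" and q: "\<And>i. i < k \<Longrightarrow> q i \<in> Y"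
    and dist: "\<And>i j. i < k \<Longrightarrow> j < k \<Longrightarrow> \<bar>d (p i) (p j) - e (q i) (q j)\<bar> \<le> 2 * \<epsilon>"
    and netX: "\<And>x. x \<in> X \<Longrightarrow> \<exists>i<k. d x (p i) < 2 * \<epsilon>"
    and netY: "\<And>y. y \<in> Y \<Longrightarrow> \<exists>i<k. e y (q i) < 2 * \<epsilon>"
    and measX: "\<And>C. C \<subseteq> X \<Longrightarrow> C \<in> sets \<mu> \<Longrightarrow>
      \<exists>E \<in> sets \<nu>. measure \<mu> C \<le> measure \<nu> E + \<epsilon> \<and>
        (\<forall>y\<in>E. \<exists>x\<in>C. \<exists>i<k. d x (p i) < 2 * \<epsilon> \<and> e y (q i) < 2 * \<epsilon>)"
    and measY: "\<And>C. C \<subseteq> Y \<Longrightarrow> C \<in> sets \<nu> \<Longrightarrow>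
      \<exists>E \<in> sets \<mu>. measure \<nu> C \<le> measure \<mu> E + \<epsilon> \<and>
        (\<forall>x\<in>E. \<exists>y\<in>C. \<exists>i<k. d x (p i) < 2 * \<epsilon> \<and> e y (q i) < 2 * \<epsilon>)"
  shows "ghp_close (5 * \<epsilon>) (X, d, \<mu>) (Y, e, \<nu>)"
proof -
  interpret x: compact_mms X d \<mu> by fact
  interpret y: compact_mms Y e \<nu> by fact
  interpret S: Metric_space "X <+> Y" "glue_metric k \<epsilon> d p e q"
    by (rule Metric_space_glue) (use k \<epsilon> p q dist x.Metric_space_axioms y.Metric_space_axioms in auto)
  \<comment> \<open>\<open>exp\<close> and \<open>\<psi>\<close> send the two sets of labels
    injectively into the positive and the negative half-line; \<open>c\<close> decodes the sign.
    This realizes the disjoint union inside the reals.\<close>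
  define \<psi> :: "real \<Rightarrow> real" where "\<psi> y = - exp y" for y
  define c :: "real \<Rightarrow> real + real" where "c z = (if z > 0 then Inl (ln z) else Inr (ln (- z)))" for z
  define Z where "Z = exp ` X \<union> \<psi> ` Y"
  define dZ where "dZ z w = glue_metric k \<epsilon> d p e q (c z) (c w)" for z w
  have c: "c (exp x) = Inl x" "c (\<psi> x) = Inr x" for x
    by (auto simp: c_def \<psi>_def)
  have Z: "Metric_space Z dZ"
    unfolding dZ_def
    by (rule S.metric_space_pullback) (auto simp: Z_def c inj_on_def)
  interpret Z: Metric_space Z dZ by fact
  have emb: "isometric_embedding X d Z dZ exp" "isometric_embedding Y e Z dZ \<psi>"
    by (auto simp: isometric_embedding_def Z_def dZ_def c glue_metric_def)
  have cross: "dZ (exp x) (\<psi> y) < 5 * \<epsilon>" if "i < k" "d x (p i) < 2 * \<epsilon>" "e y (q i) < 2 * \<epsilon>" for x y i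
    using glue_dist_le[OF that(1), of \<epsilon> d p e q x y] that y.commute[of y "q i"]
    by (simp add: dZ_def c glue_metric_def)
  have inZ: "exp x \<in> Z" if "x \<in> X" for x
    using that by (simp add: Z_def)
  have inZ': "\<psi> y \<in> Z" if "y \<in> Y" for y
    using that by (simp add: Z_def)
  interpret common_embedding X d \<mu> Y e \<nu> Z dZ exp \<psi>
    by unfold_locales (fact emb)+
  have zero: "d (p i) (p i) = 0" "e (q i) (q i) = 0" if "i < k" for i
    using p q that by auto
  have h1: "\<exists>y\<in>Y. dZ (exp x) (\<psi> y) < 5 * \<epsilon>" if x: "x \<in> X" for x
  proof -
    obtain i where i: "i < k" "d x (p i) < 2 * \<epsilon>"
      using netX x by auto
    then show ?thesis
      using cross[of i x "q i"] zero[OF i(1)] \<epsilon> q by auto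
  qed
  have h2: "\<exists>x\<in>X. dZ (\<psi> y) (exp x) < 5 * \<epsilon>" if y: "y \<in> Y" for y
  proof -
    obtain i where i: "i < k" "e y (q i) < 2 * \<epsilon>"
      using netY y by auto
    then have "dZ (exp (p i)) (\<psi> y) < 5 * \<epsilon>"
      using cross[of i "p i" y] zero[OF i(1)] \<epsilon> by simp
    then show ?thesis
      using p[OF i(1)] by (auto simp: Z.commute[of "\<psi> y"])
  qed
  have mm: "exp -` C \<inter> X \<in> sets \<mu>" "\<psi> -` C \<inter> Y \<in> sets \<nu>" if "C \<in> sets (metric_borel Z dZ)" for C
    using measurable_sets[OF x.isometric_measurable[OF Z emb(1)] that]
      measurable_sets[OF y.isometric_measurable[OF Z emb(2)] that]
    by (auto simp: x.space_eq y.space_eq)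
  have "measure \<mu> (exp -` C \<inter> X) \<le> measure \<nu> (\<psi> -` nbhd Z dZ C (5*\<epsilon>) \<inter> Y) + 5*\<epsilon> \<and>
        measure \<nu> (\<psi> -` C \<inter> Y) \<le> measure \<mu> (exp -` nbhd Z dZ C (5*\<epsilon>) \<inter> X) + 5*\<epsilon>"
    if C: "closedin Z.mtopology C" for C
  proof
    have Cs: "C \<in> sets (metric_borel Z dZ)" "nbhd Z dZ C (5*\<epsilon>) \<in> sets (metric_borel Z dZ)"
      using C Z.closedin_in_sets Z.openin_in_sets Z.openin_nbhd closedin_subset[OF C] by auto
    obtain E where E: "E \<in> sets \<nu>" "measure \<mu> (exp -` C \<inter> X) \<le> measure \<nu> E + \<epsilon>"
      "\<forall>y\<in>E. \<exists>x\<in>exp -` C \<inter> X. \<exists>i<k. d x (p i) < 2 * \<epsilon> \<and> e y (q i) < 2 * \<epsilon>"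
      using measX[OF _ mm(1)[OF Cs(1)]] by auto
    have "E \<subseteq> \<psi> -` nbhd Z dZ C (5*\<epsilon>) \<inter> Y"
    proof
      fix y assume y: "y \<in> E"
      then have "y \<in> Y"
        using E(1) sets.sets_into_space y.space_eq by blast
      moreover obtain x i where "x \<in> X" "exp x \<in> C" "i < k" "d x (p i) < 2 * \<epsilon>" "e y (q i) < 2 * \<epsilon>"
        using E(3) y by auto
      ultimately show "y \<in> \<psi> -` nbhd Z dZ C (5*\<epsilon>) \<inter> Y"
        using cross[of i x y] inZ' Z.commute unfolding nbhd_def by auto
    qed
    then have "measure \<nu> E \<le> measure \<nu> (\<psi> -` nbhd Z dZ C (5*\<epsilon>) \<inter> Y)"
      by (intro y.finite_measure_mono mm Cs)
    then show "measure \<mu> (exp -` C \<inter> X) \<le> measure \<nu> (\<psi> -` nbhd Z dZ C (5*\<epsilon>) \<inter> Y) + 5*\<epsilon>"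
      using E(2) \<epsilon> by linarith
    obtain E where E: "E \<in> sets \<mu>" "measure \<nu> (\<psi> -` C \<inter> Y) \<le> measure \<mu> E + \<epsilon>"
      "\<forall>x\<in>E. \<exists>y\<in>\<psi> -` C \<inter> Y. \<exists>i<k. d x (p i) < 2 * \<epsilon> \<and> e y (q i) < 2 * \<epsilon>"
      using measY[OF _ mm(2)[OF Cs(1)]] by auto
    have "E \<subseteq> exp -` nbhd Z dZ C (5*\<epsilon>) \<inter> X"
    proof
      fix x assume x: "x \<in> E"
      then have "x \<in> X"
        using E(1) sets.sets_into_space x.space_eq by blast
      moreover obtain y i where "y \<in> Y" "\<psi> y \<in> C" "i < k" "d x (p i) < 2 * \<epsilon>" "e y (q i) < 2 * \<epsilon>"
        using E(3) x by auto
      ultimately show "x \<in> exp -` nbhd Z dZ C (5*\<epsilon>) \<inter> X"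
        using cross[of i x y] inZ unfolding nbhd_def by auto
    qed
    then have "measure \<mu> E \<le> measure \<mu> (exp -` nbhd Z dZ C (5*\<epsilon>) \<inter> X)"
      by (intro x.finite_measure_mono mm Cs)
    then show "measure \<nu> (\<psi> -` C \<inter> Y) \<le> measure \<mu> (exp -` nbhd Z dZ C (5*\<epsilon>) \<inter> X) + 5*\<epsilon>"
      using E(2) \<epsilon> by linarith
  qed
  then show ?thesis
    unfolding ghp_close_def prod.case
    using Z emb h1 h2 by (intro exI[of _ Z] exI[of _ dZ] exI[of _ exp] exI[of _ \<psi>]) simp
qed

text \<open>Gluing along a single bridge whose length \<open>R\<close> exceeds diameters and masses:
  all closeness conditions become trivial, with \<open>E\<close> empty. This shows that the infimum
  in \<open>ghp_dist\<close> ranges over a nonempty set.\<close>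

lemma ex_common_embedding:
  assumes X: "compact_mms X d \<mu>" and Y: "compact_mms Y e \<nu>"
  shows "\<exists>(Z :: real set) dZ \<phi> \<psi>. Metric_space Z dZ \<and>
    isometric_embedding X d Z dZ \<phi> \<and> isometric_embedding Y e Z dZ \<psi>"
proof -
  interpret x: compact_mms X d \<mu> by fact
  interpret y: compact_mms Y e \<nu> by fact
  obtain D where D: "D > 0" "\<And>x y. x \<in> X \<Longrightarrow> y \<in> X \<Longrightarrow> d x y \<le> D"
    using x.bounded_dist by blast
  obtain E where E: "E > 0" "\<And>x y. x \<in> Y \<Longrightarrow> y \<in> Y \<Longrightarrow> e x y \<le> E"
    using y.bounded_dist by blast
  obtain x0 y0 where xy: "x0 \<in> X" "y0 \<in> Y"
    using x.nonempty y.nonempty by auto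
  define R where "R = D + E + measure \<mu> X + measure \<nu> Y"
  have R: "D \<le> R" "E \<le> R" "R > 0" "measure \<mu> A \<le> R" "measure \<nu> B \<le> R" for A B
    using D(1) E(1) measure_nonneg[of \<mu> X] measure_nonneg[of \<nu> Y] x.bounded_measure[of A] y.bounded_measure[of B]
    unfolding R_def x.space_eq y.space_eq by linarith+
  have dR: "d x x0 < 2 * R" if "x \<in> X" for x
    using D(2)[OF that xy(1)] R by linarith
  have eR: "e y y0 < 2 * R" if "y \<in> Y" for y
    using E(2)[OF that xy(2)] R by linarith
  have "ghp_close (5 * R) (X, d, \<mu>) (Y, e, \<nu>)"
    by (rule glue_ghp_close[OF X Y, of 1 R "\<lambda>_. x0" "\<lambda>_. y0"])
      (use R xy dR eR in \<open>auto intro!: bexI[of _ "{}"]\<close>)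
  then show ?thesis
    unfolding ghp_close_def by auto
qed

text \<open>Some embedding has Hausdorff plus Prokhorov distance below \<open>\<rho>\<close>. Both
  terms are nonnegative, so each has an admissible threshold below \<open>\<rho>\<close>, and
  enlarging a threshold preserves its condition.\<close>

lemma ghp_dist_imp_close:
  assumes "x \<in> mms_space" "y \<in> mms_space" "ghp_dist x y < \<rho>"
  shows "ghp_close \<rho> x y"
proof -
  obtain X d \<mu> where x: "x = (X, d, \<mu>)" and X: "compact_mms X d \<mu>"
    using assms(1) by (rule mms_spaceE)
  obtain Y e \<nu> where y: "y = (Y, e, \<nu>)" and Y: "compact_mms Y e \<nu>"
    using assms(2) by (rule mms_spaceE)
  interpret x: compact_mms X d \<mu> by fact
  interpret y: compact_mms Y e \<nu> by fact
  have "\<exists>s\<in>{hausdorff_dist Z dZ (\<phi> ` X) (\<psi> ` Y) +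
          prokhorov_dist Z dZ (distr \<mu> (metric_borel Z dZ) \<phi>) (distr \<nu> (metric_borel Z dZ) \<psi>)
        | (Z :: real set) dZ \<phi> \<psi>. Metric_space Z dZ \<and>
            isometric_embedding X d Z dZ \<phi> \<and> isometric_embedding Y e Z dZ \<psi>}. s < \<rho>"
    using assms(3) ex_common_embedding[OF X Y]
    unfolding x y ghp_dist_def prod.case by (intro cInf_lessD) blast+
  then obtain Z :: "real set" and dZ \<phi> \<psi> where Z: "Metric_space Z dZ"
    and emb: "isometric_embedding X d Z dZ \<phi>" "isometric_embedding Y e Z dZ \<psi>"
    and less: "hausdorff_dist Z dZ (\<phi> ` X) (\<psi> ` Y) +
      prokhorov_dist Z dZ (distr \<mu> (metric_borel Z dZ) \<phi>) (distr \<nu> (metric_borel Z dZ) \<psi>) < \<rho>"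
    by blast
  interpret Z: Metric_space Z dZ by fact
  interpret common_embedding X d \<mu> Y e \<nu> Z dZ \<phi> \<psi>
    by unfold_locales (fact emb)+
  have Inf_less: "Inf hd_set < \<rho>" "Inf pk_set < \<rho>"
    using less hd_nonneg pk_nonneg unfolding hausdorff_eq prokhorov_eq by linarith+
  from cInf_lessD[OF hd_set_nonempty Inf_less(1)] obtain s where s: "s \<in> hd_set" "s < \<rho>" ..
  from cInf_lessD[OF pk_set_nonempty Inf_less(2)] obtain t where t: "t \<in> pk_set" "t < \<rho>" ..
  have mm: "\<phi> -` U \<inter> X \<in> sets \<mu>" "\<psi> -` U \<inter> Y \<in> sets \<nu>" if "openin Z.mtopology U" for U
    using x.openin_sets[OF x.continuous_isometric_preimage[OF Z emb(1) that]]
      y.openin_sets[OF y.continuous_isometric_preimage[OF Z emb(2) that]] by auto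
  have "measure \<mu> (\<phi> -` C \<inter> X) \<le> measure \<nu> (\<psi> -` nbhd Z dZ C \<rho> \<inter> Y) + \<rho> \<and>
           measure \<nu> (\<psi> -` C \<inter> Y) \<le> measure \<mu> (\<phi> -` nbhd Z dZ C \<rho> \<inter> X) + \<rho>"
    if C: "closedin Z.mtopology C" for C
  proof -
    have "nbhd Z dZ C t \<subseteq> nbhd Z dZ C \<rho>"
      using t(2) by (force simp: nbhd_def)
    moreover have "openin Z.mtopology (nbhd Z dZ C \<rho>)"
      using closedin_subset[OF C] by (intro Z.openin_nbhd) simp
    ultimately have "measure \<nu> (\<psi> -` nbhd Z dZ C t \<inter> Y) \<le> measure \<nu> (\<psi> -` nbhd Z dZ C \<rho> \<inter> Y)"
      "measure \<mu> (\<phi> -` nbhd Z dZ C t \<inter> X) \<le> measure \<mu> (\<phi> -` nbhd Z dZ C \<rho> \<inter> X)"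
      using mm by (auto intro!: x.finite_measure_mono y.finite_measure_mono)
    moreover have "measure \<mu> (\<phi> -` C \<inter> X) \<le> measure \<nu> (\<psi> -` nbhd Z dZ C t \<inter> Y) + t \<and>
           measure \<nu> (\<psi> -` C \<inter> Y) \<le> measure \<mu> (\<phi> -` nbhd Z dZ C t \<inter> X) + t"
      using t(1) C by simp
    ultimately show ?thesis
      using t(2) by linarith
  qed
  moreover have "\<exists>y\<in>Y. dZ (\<phi> x) (\<psi> y) < \<rho>" if "x \<in> X" for x
  proof -
    have "\<phi> x \<in> nbhd Z dZ (\<psi> ` Y) s"
      using s(1) that by blast
    then show ?thesis
      using s(2) by (auto simp: nbhd_def intro: less_trans)
  qed
  moreover have "\<exists>x\<in>X. dZ (\<psi> y) (\<phi> x) < \<rho>" if "y \<in> Y" for y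
  proof -
    have "\<psi> y \<in> nbhd Z dZ (\<phi> ` X) s"
      using s(1) that by blast
    then show ?thesis
      using s(2) by (auto simp: nbhd_def intro: less_trans)
  qed
  ultimately show ?thesis
    unfolding ghp_close_def prod.case x y
    using Z emb by (intro exI[of _ Z] exI[of _ dZ] exI[of _ \<phi>] exI[of _ \<psi>]) simp
qed

text \<open>The factor 2 arises because \<open>ghp_dist\<close> adds the two distances, each of
  which is at most \<open>\<rho>\<close> here.\<close>

lemma ghp_close_imp_dist_le:
  assumes "x \<in> mms_space" "y \<in> mms_space" "ghp_close \<rho> x y" "\<rho> > 0"
  shows "ghp_dist x y \<le> 2 * \<rho>"
proof -
  obtain X d \<mu> where x: "x = (X, d, \<mu>)" and X: "compact_mms X d \<mu>"
    using assms(1) by (rule mms_spaceE)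
  obtain Y e \<nu> where y: "y = (Y, e, \<nu>)" and Y: "compact_mms Y e \<nu>"
    using assms(2) by (rule mms_spaceE)
  let ?S = "{hausdorff_dist Z dZ (\<phi> ` X) (\<psi> ` Y) +
          prokhorov_dist Z dZ (distr \<mu> (metric_borel Z dZ) \<phi>) (distr \<nu> (metric_borel Z dZ) \<psi>)
        | (Z :: real set) dZ \<phi> \<psi>. Metric_space Z dZ \<and>
            isometric_embedding X d Z dZ \<phi> \<and> isometric_embedding Y e Z dZ \<psi>}"
  have ce: "common_embedding X d \<mu> Y e \<nu> Z dZ \<phi> \<psi>"
    if "Metric_space Z dZ" "isometric_embedding X d Z dZ \<phi>" "isometric_embedding Y e Z dZ \<psi>" for Z dZ \<phi> \<psi>
    using that X Y by (simp add: common_embedding_def common_embedding_axioms_def)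
  have bdd: "bdd_below ?S"
  proof (rule bdd_belowI[of _ 0])
    fix s assume "s \<in> ?S"
    then obtain Z :: "real set" and dZ \<phi> \<psi> where "common_embedding X d \<mu> Y e \<nu> Z dZ \<phi> \<psi>"
      and s: "s = hausdorff_dist Z dZ (\<phi> ` X) (\<psi> ` Y) +
          prokhorov_dist Z dZ (distr \<mu> (metric_borel Z dZ) \<phi>) (distr \<nu> (metric_borel Z dZ) \<psi>)"
      using ce by blast
    then interpret common_embedding X d \<mu> Y e \<nu> Z dZ \<phi> \<psi> by simp
    show "0 \<le> s"
      unfolding s using hd_nonneg pk_nonneg by simp
  qed
  obtain Z :: "real set" and dZ \<phi> \<psi> where Z: "Metric_space Z dZ"
    and emb: "isometric_embedding X d Z dZ \<phi>" "isometric_embedding Y e Z dZ \<psi>"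
    and near: "\<forall>x\<in>X. \<exists>y\<in>Y. dZ (\<phi> x) (\<psi> y) < \<rho>" "\<forall>y\<in>Y. \<exists>x\<in>X. dZ (\<psi> y) (\<phi> x) < \<rho>"
    and meas: "\<forall>C. closedin (Metric_space.mtopology Z dZ) C \<longrightarrow>
           measure \<mu> (\<phi> -` C \<inter> X) \<le> measure \<nu> (\<psi> -` nbhd Z dZ C \<rho> \<inter> Y) + \<rho> \<and>
           measure \<nu> (\<psi> -` C \<inter> Y) \<le> measure \<mu> (\<phi> -` nbhd Z dZ C \<rho> \<inter> X) + \<rho>"
    using assms(3) unfolding x y ghp_close_def prod.case by blast
  interpret common_embedding X d \<mu> Y e \<nu> Z dZ \<phi> \<psi>
    using ce Z emb .
  have "\<rho> \<in> hd_set"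
    using near emb assms(4) by (auto simp: nbhd_def isometric_embedding_def image_subset_iff)
  then have "hausdorff_dist Z dZ (\<phi> ` X) (\<psi> ` Y) \<le> \<rho>"
    unfolding hausdorff_eq by (rule cInf_lower) (auto intro!: bdd_belowI[of _ 0])
  moreover have "\<rho> \<in> pk_set"
    using meas assms(4) by simp
  then have "prokhorov_dist Z dZ (distr \<mu> (metric_borel Z dZ) \<phi>) (distr \<nu> (metric_borel Z dZ) \<psi>) \<le> \<rho>"
    unfolding prokhorov_eq by (rule cInf_lower) (auto intro!: bdd_belowI[of _ 0])
  moreover have "ghp_dist x y \<le> hausdorff_dist Z dZ (\<phi> ` X) (\<psi> ` Y) +
      prokhorov_dist Z dZ (distr \<mu> (metric_borel Z dZ) \<phi>) (distr \<nu> (metric_borel Z dZ) \<psi>)"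
    unfolding ghp_dist_def x y prod.case
    by (rule cInf_lower[OF _ bdd]) (use Z emb in blast)
  ultimately show ?thesis
    by linarith
qed

section \<open>Configurations realized in a space\<close>

text \<open>Lower bounds only, so that the order preserves the predicate. Masses are taken far from
  \<open>p\<close>, not near it, because preimages of far sets stay far under a 1-Lipschitz map. For
  \<open>F = {}\<close> the far set is the whole space. The diagonal is exempt from
  \<open>c\<close>, as its distances vanish.\<close>

definition realizes ::
  "nat \<Rightarrow> (nat \<times> nat \<Rightarrow> real) \<Rightarrow> real \<Rightarrow> real \<Rightarrow> (nat set \<Rightarrow> real) \<Rightarrow> mms \<Rightarrow> bool" where
  "realizes k c \<sigma> s m x = (case x of (X, d, \<mu>) \<Rightarrow>
     (\<exists>p. (\<forall>i<k. p i \<in> X) \<and> (\<forall>i<k. \<forall>j<k. i \<noteq> j \<longrightarrow> c (i, j) \<le> d (p i) (p j)) \<and>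
        \<sigma> \<le> (\<Sum>i<k. \<Sum>j<k. d (p i) (p j)) \<and>
        (\<forall>F\<subseteq>{..<k}. m F \<le> measure \<mu> {z\<in>X. \<forall>j\<in>F. s \<le> d z (p j)})))"

lemma realizesI:
  assumes "\<And>i. i < k \<Longrightarrow> p i \<in> X"
    and "\<And>i j. i < k \<Longrightarrow> j < k \<Longrightarrow> i \<noteq> j \<Longrightarrow> c (i, j) \<le> d (p i) (p j)"
    and "\<sigma> \<le> (\<Sum>i<k. \<Sum>j<k. d (p i) (p j))"
    and "\<And>F. F \<subseteq> {..<k} \<Longrightarrow> m F \<le> measure \<mu> {z\<in>X. \<forall>j\<in>F. s \<le> d z (p j)}"
  shows "realizes k c \<sigma> s m (X, d, \<mu>)"
  unfolding realizes_def prod.case using assms by (intro exI[of _ p]) blast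

lemma realizesE:
  assumes "realizes k c \<sigma> s m (X, d, \<mu>)"
  obtains p where "\<forall>i<k. p i \<in> X"
    "\<forall>i<k. \<forall>j<k. i \<noteq> j \<longrightarrow> c (i, j) \<le> d (p i) (p j)"
    "\<sigma> \<le> (\<Sum>i<k. \<Sum>j<k. d (p i) (p j))"
    "\<forall>F\<subseteq>{..<k}. m F \<le> measure \<mu> {z\<in>X. \<forall>j\<in>F. s \<le> d z (p j)}"
  using assms unfolding realizes_def prod.case by (elim exE conjE)

lemma realizes_antimono:
  assumes "x \<in> mms_space" "realizes k c \<sigma> s m x"
    and "\<And>i j. i < k \<Longrightarrow> j < k \<Longrightarrow> c' (i, j) \<le> c (i, j)" "\<sigma>' \<le> \<sigma>" "s' \<le> s"
    and "\<And>F. F \<subseteq> {..<k} \<Longrightarrow> m' F \<le> m F"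
  shows "realizes k c' \<sigma>' s' m' x"
proof -
  obtain X d \<mu> where x: "x = (X, d, \<mu>)" and "compact_mms X d \<mu>"
    using assms(1) by (rule mms_spaceE)
  then interpret compact_mms X d \<mu> by simp
  obtain p where p: "\<forall>i<k. p i \<in> X"
    "\<forall>i<k. \<forall>j<k. i \<noteq> j \<longrightarrow> c (i, j) \<le> d (p i) (p j)"
    "\<sigma> \<le> (\<Sum>i<k. \<Sum>j<k. d (p i) (p j))"
    "\<forall>F\<subseteq>{..<k}. m F \<le> measure \<mu> {z\<in>X. \<forall>j\<in>F. s \<le> d z (p j)}"
    using assms(2) unfolding x by (rule realizesE)
  note p = p[rule_format]
  show ?thesis
    unfolding x
  proof (rule realizesI[of _ p])
    show "c' (i, j) \<le> d (p i) (p j)" if "i < k" "j < k" "i \<noteq> j" for i j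
      using p(2)[OF that] assms(3)[OF that(1,2)] by linarith
    show "m' F \<le> measure \<mu> {z\<in>X. \<forall>j\<in>F. s' \<le> d z (p j)}" if F: "F \<subseteq> {..<k}" for F
    proof -
      have "measure \<mu> {z\<in>X. \<forall>j\<in>F. s \<le> d z (p j)} \<le> measure \<mu> {z\<in>X. \<forall>j\<in>F. s' \<le> d z (p j)}"
        using F p(1) assms(5) by (intro finite_measure_mono far_sets) force+
      then show ?thesis
        using p(4)[OF F] assms(6)[OF F] by linarith
    qed
  qed (use p assms in auto)
qed

text \<open>Lift each \<open>p i\<close> to a preimage \<open>q i\<close>. Distances grow, and a
  point whose image is far from \<open>p j\<close> is itself far from \<open>q j\<close>, so the far
  mass grows too.\<close>

lemma realizes_increasing:
  assumes "x \<in> mms_space" "y \<in> mms_space" "mms_le x y" "realizes k c \<sigma> s m x"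
  shows "realizes k c \<sigma> s m y"
proof -
  obtain X d \<mu> where x: "x = (X, d, \<mu>)" and X: "compact_mms X d \<mu>"
    using assms(1) by (rule mms_spaceE)
  obtain Y e \<nu> where y: "y = (Y, e, \<nu>)" and Y: "compact_mms Y e \<nu>"
    using assms(2) by (rule mms_spaceE)
  interpret x: compact_mms X d \<mu> by fact
  interpret y: compact_mms Y e \<nu> by fact
  obtain p where p: "\<forall>i<k. p i \<in> X"
    "\<forall>i<k. \<forall>j<k. i \<noteq> j \<longrightarrow> c (i, j) \<le> d (p i) (p j)"
    "\<sigma> \<le> (\<Sum>i<k. \<Sum>j<k. d (p i) (p j))"
    "\<forall>F\<subseteq>{..<k}. m F \<le> measure \<mu> {z\<in>X. \<forall>j\<in>F. s \<le> d z (p j)}"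
    using assms(4) unfolding x by (rule realizesE)
  note p = p[rule_format]
  obtain \<phi> where \<phi>: "\<phi> ` Y = X" "\<And>u v. u \<in> Y \<Longrightarrow> v \<in> Y \<Longrightarrow> d (\<phi> u) (\<phi> v) \<le> e u v"
    "\<And>A. A \<in> sets \<mu> \<Longrightarrow> emeasure \<mu> A \<le> emeasure \<nu> (\<phi> -` A \<inter> Y)"
    using assms(3) unfolding x y mms_le_def prod.case by blast
  have "\<forall>i\<in>{..<k}. \<exists>v. v \<in> Y \<and> \<phi> v = p i"
    using p(1) \<phi>(1) by force
  from bchoice[OF this] obtain q where q: "q i \<in> Y" "\<phi> (q i) = p i" if "i < k" for i
    by auto
  have le: "d (p i) (p j) \<le> e (q i) (q j)" if "i < k" "j < k" for i j
    using \<phi>(2)[OF q(1)[OF that(1)] q(1)[OF that(2)]] q(2) that by simp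
  show ?thesis
    unfolding y
  proof (rule realizesI[of _ q])
    show "c (i, j) \<le> e (q i) (q j)" if "i < k" "j < k" "i \<noteq> j" for i j
      using p(2)[OF that] le[OF that(1,2)] by linarith
    have "(\<Sum>i<k. \<Sum>j<k. d (p i) (p j)) \<le> (\<Sum>i<k. \<Sum>j<k. e (q i) (q j))"
      using le by (intro sum_mono) auto
    then show "\<sigma> \<le> (\<Sum>i<k. \<Sum>j<k. e (q i) (q j))"
      using p(3) by linarith
    show "m F \<le> measure \<nu> {z\<in>Y. \<forall>j\<in>F. s \<le> e z (q j)}" if F: "F \<subseteq> {..<k}" for F
    proof -
      let ?A = "{z\<in>X. \<forall>j\<in>F. s \<le> d z (p j)}" and ?B = "{z\<in>Y. \<forall>j\<in>F. s \<le> e z (q j)}"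
      have A: "?A \<in> sets \<mu>"
        using F p(1) by (intro x.far_sets) auto
      have B: "?B \<in> sets \<nu>"
        using F q(1) by (intro y.far_sets) auto
      have "\<phi> -` ?A \<inter> Y \<subseteq> ?B"
      proof safe
        fix z j assume z: "z \<in> Y" "\<phi> z \<in> X" "\<forall>j\<in>F. s \<le> d (\<phi> z) (p j)" and j: "j \<in> F"
        then have "s \<le> d (\<phi> z) (\<phi> (q j))"
          using F q(2) by auto
        also have "\<dots> \<le> e z (q j)"
          using F j q(1) z by (intro \<phi>) auto
        finally show "s \<le> e z (q j)" .
      qed
      then have "emeasure \<mu> ?A \<le> emeasure \<nu> ?B"
        using \<phi>(3)[OF A] emeasure_mono[OF _ B] order_trans by blast
      then have "measure \<mu> ?A \<le> measure \<nu> ?B"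
        by (simp add: x.emeasure_eq_measure y.emeasure_eq_measure)
      then show ?thesis
        using p(4)[OF F] by linarith
    qed
  qed (use q in auto)
qed

text \<open>The points move by less than \<open>\<rho>\<close> each, which costs
  \<open>2 * \<rho>\<close> for each of the \<open>k * k\<close> distances in the sum. The far
  radius loses \<open>\<rho>\<close> for the moved point \<open>q j\<close> and
  \<open>\<rho>\<close> for the Prokhorov neighbourhood; the mass loses the additive
  \<open>\<rho>\<close>.\<close>

lemma realizes_ghp_close:
  assumes "x \<in> mms_space" "y \<in> mms_space" "ghp_close \<rho> x y" "realizes k c \<sigma> s m x"
  shows "realizes k (\<lambda>ij. c ij - 2 * \<rho>) (\<sigma> - 2 * \<rho> * (real k)\<^sup>2) (s - 2 * \<rho>) (\<lambda>F. m F - \<rho>) y"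
proof -
  obtain X d \<mu> where x: "x = (X, d, \<mu>)" and X: "compact_mms X d \<mu>"
    using assms(1) by (rule mms_spaceE)
  obtain Y e \<nu> where y: "y = (Y, e, \<nu>)" and Y: "compact_mms Y e \<nu>"
    using assms(2) by (rule mms_spaceE)
  interpret x: compact_mms X d \<mu> by fact
  interpret y: compact_mms Y e \<nu> by fact
  obtain p where p: "\<forall>i<k. p i \<in> X"
    "\<forall>i<k. \<forall>j<k. i \<noteq> j \<longrightarrow> c (i, j) \<le> d (p i) (p j)"
    "\<sigma> \<le> (\<Sum>i<k. \<Sum>j<k. d (p i) (p j))"
    "\<forall>F\<subseteq>{..<k}. m F \<le> measure \<mu> {z\<in>X. \<forall>j\<in>F. s \<le> d z (p j)}"
    using assms(4) unfolding x by (rule realizesE)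
  note p = p[rule_format]
  obtain Z :: "real set" and dZ \<phi> \<psi> where Z: "Metric_space Z dZ"
    and emb: "isometric_embedding X d Z dZ \<phi>" "isometric_embedding Y e Z dZ \<psi>"
    and near: "\<forall>x\<in>X. \<exists>y\<in>Y. dZ (\<phi> x) (\<psi> y) < \<rho>" "\<forall>y\<in>Y. \<exists>x\<in>X. dZ (\<psi> y) (\<phi> x) < \<rho>"
    and meas: "\<forall>C. closedin (Metric_space.mtopology Z dZ) C \<longrightarrow>
           measure \<mu> (\<phi> -` C \<inter> X) \<le> measure \<nu> (\<psi> -` nbhd Z dZ C \<rho> \<inter> Y) + \<rho> \<and>
           measure \<nu> (\<psi> -` C \<inter> Y) \<le> measure \<mu> (\<phi> -` nbhd Z dZ C \<rho> \<inter> X) + \<rho>"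
    using assms(3) unfolding x y ghp_close_def prod.case by (elim exE conjE)
  interpret Z: Metric_space Z dZ by fact
  have \<phi>: "\<And>z. z \<in> X \<Longrightarrow> \<phi> z \<in> Z" "\<And>z w. z \<in> X \<Longrightarrow> w \<in> X \<Longrightarrow> dZ (\<phi> z) (\<phi> w) = d z w"
    using emb by (auto simp: isometric_embedding_def)
  have \<psi>: "\<And>z. z \<in> Y \<Longrightarrow> \<psi> z \<in> Z" "\<And>z w. z \<in> Y \<Longrightarrow> w \<in> Y \<Longrightarrow> dZ (\<psi> z) (\<psi> w) = e z w"
    using emb by (auto simp: isometric_embedding_def)
  have "\<forall>i\<in>{..<k}. \<exists>v. v \<in> Y \<and> dZ (\<phi> (p i)) (\<psi> v) < \<rho>"
    using p(1) near(1) by auto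
  from bchoice[OF this] obtain q where q: "q i \<in> Y" "dZ (\<phi> (p i)) (\<psi> (q i)) < \<rho>" if "i < k" for i
    by auto
  have le: "d (p i) (p j) - 2 * \<rho> \<le> e (q i) (q j)" if i: "i < k" and j: "j < k" for i j
  proof -
    have "dZ (\<phi> (p i)) (\<phi> (p j)) \<le> dZ (\<phi> (p i)) (\<psi> (q i)) + dZ (\<psi> (q i)) (\<phi> (p j))"
      using p(1) q(1) \<phi> \<psi> i j by (intro Z.triangle) auto
    moreover have "dZ (\<psi> (q i)) (\<phi> (p j)) \<le> dZ (\<psi> (q i)) (\<psi> (q j)) + dZ (\<phi> (p j)) (\<psi> (q j))"
      using Z.triangle[of "\<psi> (q i)" "\<psi> (q j)" "\<phi> (p j)"] p(1) q(1) \<phi> \<psi> i j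
      by (auto simp: Z.commute)
    ultimately show ?thesis
      using q(2)[OF i] q(2)[OF j] \<phi>(2) \<psi>(2) p(1) q(1) i j by force
  qed
  show ?thesis
    unfolding y
  proof (rule realizesI[of _ q])
    show "c (i, j) - 2 * \<rho> \<le> e (q i) (q j)" if "i < k" "j < k" "i \<noteq> j" for i j
      using p(2)[OF that] le[OF that(1,2)] by linarith
    have "(\<Sum>i<k. \<Sum>j<k. d (p i) (p j) - 2 * \<rho>) \<le> (\<Sum>i<k. \<Sum>j<k. e (q i) (q j))"
      using le by (intro sum_mono) auto
    then show "\<sigma> - 2 * \<rho> * (real k)\<^sup>2 \<le> (\<Sum>i<k. \<Sum>j<k. e (q i) (q j))"
      using p(3) by (simp add: sum_subtractf power2_eq_square mult_ac)
    show "m F - \<rho> \<le> measure \<nu> {z\<in>Y. \<forall>j\<in>F. s - 2 * \<rho> \<le> e z (q j)}" if F: "F \<subseteq> {..<k}" for F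
    proof -
      let ?A = "{z\<in>X. \<forall>j\<in>F. s \<le> d z (p j)}" and ?B = "{z\<in>Y. \<forall>j\<in>F. s - 2 * \<rho> \<le> e z (q j)}"
      \<comment> \<open>The Prokhorov inequality speaks of closed subsets of \<open>Z\<close>, so
        the far set is formed in \<open>Z\<close> and then pulled back to \<open>X\<close>.\<close>
      let ?C = "{z\<in>Z. \<forall>j\<in>F. s \<le> dZ z (\<phi> (p j))}"
      have B: "?B \<in> sets \<nu>"
        using F q(1) by (intro y.far_sets) auto
      have "closedin Z.mtopology ?C"
        using Z.closedin_far[of F "\<lambda>j. \<phi> (p j)" s] F p(1) \<phi>(1) by blast
      then have "measure \<mu> (\<phi> -` ?C \<inter> X) \<le> measure \<nu> (\<psi> -` nbhd Z dZ ?C \<rho> \<inter> Y) + \<rho>"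
        using meas by blast
      moreover have "measure \<mu> (\<phi> -` ?C \<inter> X) = measure \<mu> ?A"
      proof -
        have "dZ (\<phi> z) (\<phi> (p j)) = d z (p j)" if "z \<in> X" "j \<in> F" for z j
          using F p(1) that by (intro \<phi>) auto
        then have "\<phi> -` ?C \<inter> X = ?A"
          using \<phi>(1) by auto
        then show ?thesis
          by simp
      qed
      moreover have "\<psi> -` nbhd Z dZ ?C \<rho> \<inter> Y \<subseteq> ?B"
      proof safe
        fix z j assume z: "z \<in> Y" "\<psi> z \<in> nbhd Z dZ ?C \<rho>" and j: "j \<in> F"
        then obtain w where w: "w \<in> Z" "s \<le> dZ w (\<phi> (p j))" "dZ (\<psi> z) w < \<rho>"
          by (auto simp: nbhd_def)
        have jk: "j < k"
          using F j by auto
        have in_Z: "\<psi> z \<in> Z" "\<psi> (q j) \<in> Z" "\<phi> (p j) \<in> Z"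
          using z jk p(1) q(1) \<phi>(1) \<psi>(1) by auto
        have "dZ w (\<phi> (p j)) \<le> dZ (\<psi> z) w + dZ (\<psi> z) (\<psi> (q j)) + dZ (\<phi> (p j)) (\<psi> (q j))"
          using Z.triangle[OF w(1) in_Z(1,3)] Z.triangle[OF in_Z]
          by (simp add: Z.commute)
        then show "s - 2 * \<rho> \<le> e z (q j)"
          using w q[OF jk] \<psi>(2)[OF z(1) q(1)[OF jk]] by linarith
      qed
      then have "measure \<nu> (\<psi> -` nbhd Z dZ ?C \<rho> \<inter> Y) \<le> measure \<nu> ?B"
        by (intro y.finite_measure_mono B)
      ultimately show ?thesis
        using p(4)[OF F] by linarith
    qed
  qed (use q in auto)
qed

section \<open>Levels of profiles as continuous increasing functions\<close>

type_synonym profile = "nat \<times> (nat \<times> nat \<Rightarrow> real) \<times> real \<times> real \<times> (nat set \<Rightarrow> real) \<times> real"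

definition realizes_at :: "profile \<Rightarrow> real \<Rightarrow> mms \<Rightarrow> bool" where
  "realizes_at \<theta> t x = (case \<theta> of (k, c, \<sigma>, s, m, \<delta>) \<Rightarrow>
     realizes k (\<lambda>ij. c ij + \<delta> * t) (\<sigma> + \<delta> * t) (s + \<delta> * t) (\<lambda>F. m F + \<delta> * t) x)"

text \<open>The slack, in units of the rate \<open>\<delta>\<close>, with which the profile is
  realized, cut off at 1. Inserting 0 keeps the supremum meaningful and gives level 0 to spaces that
  miss the profile.\<close>

definition profile_level :: "profile \<Rightarrow> mms \<Rightarrow> real" where
  "profile_level \<theta> x = Sup (insert 0 {t\<in>{0..1}. realizes_at \<theta> t x})"

text \<open>The extensional products \<open>Pi\<^sub>E\<close> fix the values outside finite index
  sets; together with rationality this makes the set countable.\<close>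

definition profiles :: "profile set" where
  "profiles = (SIGMA k:UNIV. Pi\<^sub>E ({..<k} \<times> {..<k}) (\<lambda>_. \<rat>) \<times> \<rat> \<times> \<rat> \<times>
     Pi\<^sub>E (Pow {..<k}) (\<lambda>_. \<rat>) \<times> {\<delta>\<in>\<rat>. \<delta> > 0})"

lemma countable_profiles: "countable profiles"
  unfolding profiles_def
  by (intro countable_SIGMA countable_PiE countable_rat countableI_type)
    (auto intro: countable_subset[OF _ countable_rat])

lemma profilesE:
  assumes "\<theta> \<in> profiles"
  obtains k c \<sigma> s m \<delta> where "\<theta> = (k, c, \<sigma>, s, m, \<delta>)" "\<delta> > 0"
  using assms by (auto simp: profiles_def)

lemma bdd_above_level: "bdd_above (insert 0 {t\<in>{0..1}. realizes_at \<theta> t x})"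
  by (auto intro!: bdd_aboveI[of _ 1])

lemma profile_level_nonneg: "0 \<le> profile_level \<theta> x"
  unfolding profile_level_def by (intro cSup_upper bdd_above_level) auto

lemma profile_level_le_1: "profile_level \<theta> x \<le> 1"
  unfolding profile_level_def by (intro cSup_least) auto

lemma profile_level_ge: "realizes_at \<theta> t x \<Longrightarrow> 0 \<le> t \<Longrightarrow> t \<le> 1 \<Longrightarrow> t \<le> profile_level \<theta> x"
  unfolding profile_level_def by (intro cSup_upper bdd_above_level) auto

lemma realizes_at_antimono:
  assumes "\<theta> \<in> profiles" "x \<in> mms_space" "realizes_at \<theta> t x" "u \<le> t"
  shows "realizes_at \<theta> u x"
proof -
  obtain k c \<sigma> s m \<delta> where \<theta>: "\<theta> = (k, c, \<sigma>, s, m, \<delta>)" and \<delta>: "\<delta> > 0"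
    using assms(1) by (rule profilesE)
  then have "\<delta> * u \<le> \<delta> * t"
    using assms(4) by simp
  then show ?thesis
    using assms(3) unfolding \<theta> realizes_at_def prod.case
    by (rule_tac realizes_antimono[OF assms(2)]) auto
qed

lemma profile_level_gt:
  assumes "\<theta> \<in> profiles" "x \<in> mms_space" "t < profile_level \<theta> x" "0 \<le> t"
  shows "realizes_at \<theta> t x"
proof -
  obtain u where "u \<in> insert 0 {t\<in>{0..1}. realizes_at \<theta> t x}" "t < u"
    using assms(3) less_cSup_iff[OF _ bdd_above_level] unfolding profile_level_def by blast
  then show ?thesis
    using realizes_at_antimono[OF assms(1,2), of u t] assms(4) by auto
qed

text \<open>Common source of monotonicity, with \<open>\<eta> = 0\<close>, and of continuity, with
  \<open>\<eta> = \<epsilon> / 2\<close>.\<close>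

lemma profile_level_le_shift:
  assumes "\<theta> \<in> profiles" "x \<in> mms_space" "0 \<le> \<eta>"
    and shift: "\<And>t. realizes_at \<theta> t x \<Longrightarrow> realizes_at \<theta> (t - \<eta>) y"
  shows "profile_level \<theta> x \<le> profile_level \<theta> y + \<eta>"
proof (rule ccontr)
  assume "\<not> ?thesis"
  then obtain t where t: "profile_level \<theta> y + \<eta> < t" "t < profile_level \<theta> x"
    by (meson dense not_le)
  then have "0 \<le> t - \<eta>" "t - \<eta> \<le> 1" "0 \<le> t"
    using profile_level_nonneg[of \<theta> y] profile_level_le_1[of \<theta> x] assms(3) by linarith+
  then have "t - \<eta> \<le> profile_level \<theta> y"
    using profile_level_gt[OF assms(1,2) t(2)] shift by (intro profile_level_ge) auto
  then show False
    using t by simp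
qed

lemma profile_level_increasing:
  assumes "\<theta> \<in> profiles" "x \<in> mms_space" "y \<in> mms_space" "mms_le x y"
  shows "profile_level \<theta> x \<le> profile_level \<theta> y"
  using profile_level_le_shift[OF assms(1,2), of 0 y] realizes_increasing[OF assms(2-4)]
  by (auto simp: realizes_at_def split: prod.splits)

lemma ghp_continuous_profile_level:
  assumes \<theta>: "\<theta> \<in> profiles"
  shows "ghp_continuous (profile_level \<theta>)"
  unfolding ghp_continuous_def
proof (intro ballI allI impI)
  fix x and \<epsilon> :: real assume x: "x \<in> mms_space" and \<epsilon>: "0 < \<epsilon>"
  obtain k c \<sigma> s m \<delta> where \<theta>_eq: "\<theta> = (k, c, \<sigma>, s, m, \<delta>)" and \<delta>: "\<delta> > 0"
    using \<theta> by (rule profilesE)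
  \<comment> \<open>Every loss in \<open>realizes_ghp_close\<close> is at most
    \<open>2 * \<rho>\<close> times \<open>k^2 + 1\<close>, which equals
    \<open>\<delta> * (\<epsilon> / 2)\<close>, that is, a drop of the level by
    \<open>\<epsilon> / 2\<close>.\<close>
  define \<rho> where "\<rho> = \<delta> * \<epsilon> / (4 * ((real k)\<^sup>2 + 1))"
  have k: "(real k)\<^sup>2 + 1 > 0"
    by (simp add: add_nonneg_pos)
  have \<rho>: "\<rho> > 0" "2 * \<rho> * ((real k)\<^sup>2 + 1) = \<delta> * (\<epsilon> / 2)"
    using \<delta> \<epsilon> k by (auto simp: \<rho>_def divide_simps)
  have b: "2 * \<rho> \<le> \<delta> * (\<epsilon> / 2)" "\<rho> \<le> \<delta> * (\<epsilon> / 2)" "2 * \<rho> * (real k)\<^sup>2 \<le> \<delta> * (\<epsilon> / 2)"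
  proof -
    have "0 \<le> \<rho> * (real k)\<^sup>2"
      using \<rho>(1) by simp
    moreover have "2 * \<rho> * ((real k)\<^sup>2 + 1) = 2 * (\<rho> * (real k)\<^sup>2) + 2 * \<rho>"
      by (simp add: algebra_simps)
    ultimately show "2 * \<rho> \<le> \<delta> * (\<epsilon> / 2)" "\<rho> \<le> \<delta> * (\<epsilon> / 2)" "2 * \<rho> * (real k)\<^sup>2 \<le> \<delta> * (\<epsilon> / 2)"
      using \<rho> by linarith+
  qed
  have shift: "profile_level \<theta> u \<le> profile_level \<theta> v + \<epsilon> / 2"
    if uv: "u \<in> mms_space" "v \<in> mms_space" "ghp_close \<rho> u v" for u v
  proof (rule profile_level_le_shift[OF \<theta> uv(1)])
    fix t assume "realizes_at \<theta> t u"
    from realizes_ghp_close[OF uv this[unfolded realizes_at_def \<theta>_eq prod.case]]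
    show "realizes_at \<theta> (t - \<epsilon> / 2) v"
      unfolding realizes_at_def \<theta>_eq prod.case
      by (rule realizes_antimono[OF uv(2)]) (use b in \<open>auto simp: right_diff_distrib\<close>)
  qed (use \<epsilon> in simp)
  show "\<exists>\<delta>>0. \<forall>y\<in>mms_space. ghp_dist x y < \<delta> \<longrightarrow> \<bar>profile_level \<theta> y - profile_level \<theta> x\<bar> < \<epsilon>"
  proof (intro exI[of _ \<rho>] conjI ballI impI \<rho>(1))
    fix y assume y: "y \<in> mms_space" "ghp_dist x y < \<rho>"
    then have "ghp_close \<rho> x y"
      using x by (intro ghp_dist_imp_close)
    then have "profile_level \<theta> x \<le> profile_level \<theta> y + \<epsilon> / 2" "profile_level \<theta> y \<le> profile_level \<theta> x + \<epsilon> / 2"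
      using shift[OF x y(1)] shift[OF y(1) x] ghp_close_sym by blast+
    then show "\<bar>profile_level \<theta> y - profile_level \<theta> x\<bar> < \<epsilon>"
      using \<epsilon> by linarith
  qed
qed

section \<open>Localization by increasing functions\<close>

lemma profiles_intro:
  assumes "\<And>i j. i < k \<Longrightarrow> j < k \<Longrightarrow> c (i, j) \<in> \<rat>" "\<sigma> \<in> \<rat>" "s \<in> \<rat>"
    "\<And>F. F \<subseteq> {..<k} \<Longrightarrow> m F \<in> \<rat>" "\<delta> \<in> \<rat>" "\<delta> > 0"
  shows "(k, restrict c ({..<k} \<times> {..<k}), \<sigma>, s, restrict m (Pow {..<k}), \<delta>) \<in> profiles"
  using assms by (auto simp: profiles_def)

lemma realizes_at_restrict:
  assumes "x \<in> mms_space"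
  shows "realizes_at (k, restrict c ({..<k} \<times> {..<k}), \<sigma>, s, restrict m (Pow {..<k}), \<delta>) t x \<longleftrightarrow>
    realizes k (\<lambda>ij. c ij + \<delta> * t) (\<sigma> + \<delta> * t) (s + \<delta> * t) (\<lambda>F. m F + \<delta> * t) x"
  unfolding realizes_at_def prod.case
  by (rule iffI; erule realizes_antimono[OF assms]) auto

context compact_mms
begin

text \<open>As the separation tends to \<open>\<epsilon>\<close> from below, the maximal number of
  points and the maximal sum of distances decrease. \<open>k\<close> and \<open>L\<close> are their
  limiting values. Some \<open>r < \<epsilon>\<close> already shows the upper bounds to within
  \<open>\<kappa>\<close>, whereas near-extremal configurations exist at every separation below
  \<open>\<epsilon>\<close>, in particular at some larger than \<open>r\<close>. That gap gives
  stability.\<close>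

lemma near_optimal_configuration:
  assumes "\<epsilon> > 0" "\<kappa> > 0"
  obtains k :: nat and r L where "k > 0" "0 < r" "r < \<epsilon>"
    "\<nexists>p. (\<forall>i<Suc k. p i \<in> X) \<and> (\<forall>i<Suc k. \<forall>j<Suc k. i \<noteq> j \<longrightarrow> r \<le> d (p i) (p j))"
    "\<nexists>p. (\<forall>i<k. p i \<in> X) \<and> (\<forall>i<k. \<forall>j<k. i \<noteq> j \<longrightarrow> r \<le> d (p i) (p j)) \<and>
       L + \<kappa> \<le> (\<Sum>i<k. \<Sum>j<k. d (p i) (p j))"
    "\<forall>r'<\<epsilon>. \<exists>p. (\<forall>i<k. p i \<in> X) \<and> (\<forall>i<k. \<forall>j<k. i \<noteq> j \<longrightarrow> r' \<le> d (p i) (p j)) \<and>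
       L - \<kappa> \<le> (\<Sum>i<k. \<Sum>j<k. d (p i) (p j))"
proof -
  define sep where "sep k r p \<longleftrightarrow> (\<forall>i<k. p i \<in> X) \<and> (\<forall>i<k. \<forall>j<k. i \<noteq> j \<longrightarrow> r \<le> d (p i) (p j))"
    for k r and p :: "nat \<Rightarrow> real"
  define \<Sigma> where "\<Sigma> k p = (\<Sum>i<k. \<Sum>j<k. d (p i) (p j))" for k :: nat and p :: "nat \<Rightarrow> real"
  have sep_mono: "sep k r p" if "sep k r' p" "r \<le> r'" for k r r' p
    using that unfolding sep_def by (meson order_trans)
  obtain x0 where x0: "x0 \<in> X"
    using nonempty by auto
  obtain K :: nat where
    K: "\<forall>k p. (\<forall>i<k. p i \<in> X) \<and> (\<forall>i<k. \<forall>j<k. i \<noteq> j \<longrightarrow> \<epsilon>/2 \<le> d (p i) (p j)) \<longrightarrow> k \<le> K"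
    using separated_bounded[OF half_gt_zero[OF assms(1)]] ..
  define Q where "Q k \<longleftrightarrow> (\<forall>r<\<epsilon>. \<exists>p. sep k r p)" for k
  have Q1: "Q 1"
    unfolding Q_def sep_def using x0 by (auto intro!: exI[of _ "\<lambda>_. x0"])
  have QK: "k \<le> K" if Q: "Q k" for k
  proof -
    have "\<epsilon>/2 < \<epsilon>"
      using assms(1) by simp
    then obtain p where "sep k (\<epsilon>/2) p"
      using Q unfolding Q_def by blast
    then show ?thesis
      using K unfolding sep_def by blast
  qed
  define k where "k = (GREATEST k. Q k)"
  have Qk: "Q k"
    unfolding k_def by (rule GreatestI_nat[of Q 1 K]) (use Q1 QK in auto)
  have k_ge: "1 \<le> k"
    unfolding k_def by (rule Greatest_le_nat[of Q 1 K]) (use Q1 QK in auto)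
  have "\<not> Q (Suc k)"
  proof
    assume "Q (Suc k)"
    then have "Suc k \<le> k"
      unfolding k_def by (rule Greatest_le_nat[of Q _ K]) (use QK in auto)
    then show False by simp
  qed
  then obtain r1 where r1: "r1 < \<epsilon>" "\<And>p. \<not> sep (Suc k) r1 p"
    unfolding Q_def by blast
  obtain D where D: "D > 0" "\<And>x y. x \<in> X \<Longrightarrow> y \<in> X \<Longrightarrow> d x y \<le> D"
    using bounded_dist by blast
  \<comment> \<open>Sums reachable at every separation below \<open>\<epsilon>\<close>; the
    configuration may depend on \<open>r\<close>, so no limit configuration has to be
    extracted.\<close>
  define A where "A = {\<sigma>. \<forall>r<\<epsilon>. \<exists>p. sep k r p \<and> \<sigma> \<le> \<Sigma> k p}"
  have "0 \<le> \<Sigma> k p" for p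
    unfolding \<Sigma>_def by (intro sum_nonneg) simp
  then have "0 \<in> A"
    using Qk unfolding A_def Q_def by auto
  have bdd: "bdd_above A"
  proof (rule bdd_aboveI[of _ "(\<Sum>i<k. \<Sum>j<k. D)"])
    fix \<sigma> assume "\<sigma> \<in> A"
    then obtain p where p: "sep k 0 p" "\<sigma> \<le> \<Sigma> k p"
      using assms(1) unfolding A_def by blast
    have "\<Sigma> k p \<le> (\<Sum>i<k. \<Sum>j<k. D)"
      unfolding \<Sigma>_def using p(1) D(2) by (intro sum_mono) (auto simp: sep_def)
    then show "\<sigma> \<le> (\<Sum>i<k. \<Sum>j<k. D)"
      using p(2) by linarith
  qed
  define L where "L = Sup A"
  have "L + \<kappa> \<notin> A"
    using cSup_upper[OF _ bdd] assms(2) unfolding L_def by force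
  then obtain r2 where r2: "r2 < \<epsilon>" "\<And>p. sep k r2 p \<Longrightarrow> \<Sigma> k p < L + \<kappa>"
    unfolding A_def by force
  have "L - \<kappa> < Sup A"
    using assms(2) by (simp add: L_def)
  then obtain \<sigma> where \<sigma>: "\<sigma> \<in> A" "L - \<kappa> < \<sigma>"
    using less_cSup_iff[OF _ bdd] \<open>0 \<in> A\<close> by blast
  \<comment> \<open>Raising the separation keeps both impossibilities; \<open>\<epsilon>/2\<close>
    makes \<open>r\<close> positive.\<close>
  define r where "r = max (\<epsilon>/2) (max r1 r2)"
  have r: "0 < r" "r < \<epsilon>" "r1 \<le> r" "r2 \<le> r"
    using assms(1) r1(1) r2(1) by (auto simp: r_def)
  show thesis
  proof (rule that[of k r L])
    show "\<nexists>p. (\<forall>i<Suc k. p i \<in> X) \<and> (\<forall>i<Suc k. \<forall>j<Suc k. i \<noteq> j \<longrightarrow> r \<le> d (p i) (p j))"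
      using r1(2) sep_mono[OF _ r(3)] unfolding sep_def[symmetric] by blast
    show "\<nexists>p. (\<forall>i<k. p i \<in> X) \<and> (\<forall>i<k. \<forall>j<k. i \<noteq> j \<longrightarrow> r \<le> d (p i) (p j)) \<and>
       L + \<kappa> \<le> (\<Sum>i<k. \<Sum>j<k. d (p i) (p j))"
    proof
      assume "\<exists>p. (\<forall>i<k. p i \<in> X) \<and> (\<forall>i<k. \<forall>j<k. i \<noteq> j \<longrightarrow> r \<le> d (p i) (p j)) \<and>
        L + \<kappa> \<le> (\<Sum>i<k. \<Sum>j<k. d (p i) (p j))"
      then obtain p where p: "sep k r p" "L + \<kappa> \<le> \<Sigma> k p"
        unfolding sep_def \<Sigma>_def by auto
      show False
        using r2(2)[OF sep_mono[OF p(1) r(4)]] p(2) by simp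
    qed
    show "\<forall>r'<\<epsilon>. \<exists>p. (\<forall>i<k. p i \<in> X) \<and> (\<forall>i<k. \<forall>j<k. i \<noteq> j \<longrightarrow> r' \<le> d (p i) (p j)) \<and>
       L - \<kappa> \<le> (\<Sum>i<k. \<Sum>j<k. d (p i) (p j))"
    proof (intro allI impI)
      fix r' assume "r' < \<epsilon>"
      then obtain p where "sep k r' p" "\<sigma> \<le> \<Sigma> k p"
        using \<sigma>(1) unfolding A_def by blast
      then show "\<exists>p. (\<forall>i<k. p i \<in> X) \<and> (\<forall>i<k. \<forall>j<k. i \<noteq> j \<longrightarrow> r' \<le> d (p i) (p j)) \<and>
         L - \<kappa> \<le> (\<Sum>i<k. \<Sum>j<k. d (p i) (p j))"
        using \<sigma>(2) unfolding \<Sigma>_def sep_def by (intro exI[of _ p]) auto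
    qed
  qed (use k_ge r in auto)
qed

end

text \<open>A point at distance at least \<open>r\<close> from all \<open>p i\<close> could be added
  as point number \<open>k\<close>, contradicting maximality.\<close>

lemma maximal_separated_is_net:
  fixes k :: nat and p :: "nat \<Rightarrow> 'a"
  assumes "Metric_space X d"
    and "\<nexists>p. (\<forall>i<Suc k. p i \<in> X) \<and> (\<forall>i<Suc k. \<forall>j<Suc k. i \<noteq> j \<longrightarrow> r \<le> d (p i) (p j))"
    and "\<And>i. i < k \<Longrightarrow> p i \<in> X" "\<And>i j. i < k \<Longrightarrow> j < k \<Longrightarrow> i \<noteq> j \<Longrightarrow> r \<le> d (p i) (p j)"
    and "x \<in> X"
  shows "\<exists>i<k. d x (p i) < r"
proof (rule ccontr)
  interpret Metric_space X d by fact
  assume "\<not> ?thesis"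
  then have far: "r \<le> d x (p i)" if "i < k" for i
    using that by (meson not_less)
  then have "r \<le> d (p i) x" if "i < k" for i
    using that by (simp add: commute[of _ x])
  then have "(\<forall>i<Suc k. (p(k := x)) i \<in> X) \<and>
      (\<forall>i<Suc k. \<forall>j<Suc k. i \<noteq> j \<longrightarrow> r \<le> d ((p(k := x)) i) ((p(k := x)) j))"
    using assms(3-5) far by (auto simp: less_Suc_eq)
  then show False
    using assms(2) by blast
qed

lemma rational_between:
  assumes "(a::real) < b"
  obtains q where "q \<in> \<rat>" "a < q" "q < b"
  using Rats_dense_in_real[OF assms] by blast

text \<open>The lower profile yields a configuration in the second space whose distances are almost
at least those of a near-optimal configuration of the first one; the upper profiles bound the sum
of its distances, so that no single distance can be much larger either.\<close>
lemma profile_level_localizes: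
  assumes x: "x \<in> mms_space" and r0: "r0 > 0"
  obtains \<theta> \<Theta> where "\<theta> \<in> profiles" "\<Theta> \<subseteq> profiles" "finite \<Theta>"
    "profile_level \<theta> x = 1" "\<And>\<theta>'. \<theta>' \<in> \<Theta> \<Longrightarrow> profile_level \<theta>' x = 0"
    "\<And>y. y \<in> mms_space \<Longrightarrow> profile_level \<theta> y > 0 \<Longrightarrow> (\<And>\<theta>'. \<theta>' \<in> \<Theta> \<Longrightarrow> profile_level \<theta>' y < 1) \<Longrightarrow>
      ghp_dist x y < r0"
proof -
  obtain X d \<mu> where x_eq: "x = (X, d, \<mu>)" and X: "compact_mms X d \<mu>"
    using x by (rule mms_spaceE)
  interpret x: compact_mms X d \<mu> by fact
  \<comment> \<open>Gluing gives closeness \<open>5 * \<epsilon>\<close>, and passing to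
    \<open>ghp_dist\<close> doubles it.\<close>
  obtain \<epsilon> where \<epsilon>: "\<epsilon> \<in> \<rat>" "0 < \<epsilon>" "\<epsilon> < r0 / 10"
    using rational_between[of 0 "r0/10"] r0 by auto
  have \<epsilon>6: "\<epsilon>/6 > 0" using \<epsilon> by simp
  obtain k r L where k: "k > 0" and r: "0 < r" "r < \<epsilon>"
    and no_sep: "\<nexists>p. (\<forall>i<Suc k. p i \<in> X) \<and> (\<forall>i<Suc k. \<forall>j<Suc k. i \<noteq> j \<longrightarrow> r \<le> d (p i) (p j))"
    and no_large: "\<nexists>p. (\<forall>i<k. p i \<in> X) \<and> (\<forall>i<k. \<forall>j<k. i \<noteq> j \<longrightarrow> r \<le> d (p i) (p j)) \<and>
       L + \<epsilon>/6 \<le> (\<Sum>i<k. \<Sum>j<k. d (p i) (p j))"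
    and ex_large: "\<forall>r'<\<epsilon>. \<exists>p. (\<forall>i<k. p i \<in> X) \<and> (\<forall>i<k. \<forall>j<k. i \<noteq> j \<longrightarrow> r' \<le> d (p i) (p j)) \<and>
       L - \<epsilon>/6 \<le> (\<Sum>i<k. \<Sum>j<k. d (p i) (p j))"
    by (rule x.near_optimal_configuration[OF \<epsilon>(2) \<epsilon>6])
  obtain r1 where r1: "r1 \<in> \<rat>" "r < r1" "r1 < \<epsilon>"
    using rational_between r(2) by blast
  \<comment> \<open>The three terms ensure that a bound of \<open>-1\<close> stays negative when
    raised by \<open>\<eta>\<close>, that \<open>r1 + 3 * \<eta> < \<epsilon>\<close>, and that
    \<open>4 * \<eta> + 8 * (\<eta> * k^2) < \<epsilon>\<close>. The last pays for an error
    \<open>2 * \<eta>\<close> in each of \<open>k * k\<close> distances and for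
    \<open>4 * \<eta>\<close> of mass.\<close>
  define b where "b = min 1 (min ((\<epsilon> - r1) / 3) (\<epsilon> / (4 * (1 + 2 * (real k)\<^sup>2))))"
  have "0 < b"
    using r1 \<epsilon>(2) by (auto simp: b_def add_pos_nonneg)
  then obtain \<eta> where "\<eta> \<in> \<rat>" "0 < \<eta>" "\<eta> < b"
    by (rule rational_between)
  then have \<eta>: "\<eta> \<in> \<rat>" "0 < \<eta>" "\<eta> < 1" "\<eta> < (\<epsilon> - r1) / 3" "\<eta> < \<epsilon> / (4 * (1 + 2 * (real k)\<^sup>2))"
    by (simp_all add: b_def)
  have kpos: "0 < 4 * (1 + 2 * (real k)\<^sup>2)"
    by (simp add: add_pos_nonneg)
  have "\<eta> * (4 * (1 + 2 * (real k)\<^sup>2)) < \<epsilon>"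
    using \<eta>(5) kpos by (simp add: pos_less_divide_eq)
  then have \<eta>': "4 * \<eta> + 8 * (\<eta> * (real k)\<^sup>2) < \<epsilon>"
    by (simp add: algebra_simps)
  have \<eta>k: "0 \<le> \<eta> * (real k)\<^sup>2"
    using \<eta>(2) by simp
  have \<eta>4: "4 * \<eta> < \<epsilon>"
    using \<eta>' \<eta>k by linarith
  have "r1 + 3 * \<eta> < \<epsilon>"
    using \<eta>(4) by simp
  from ex_large[rule_format, OF this]
  obtain p where p: "\<forall>i<k. p i \<in> X" "\<forall>i<k. \<forall>j<k. i \<noteq> j \<longrightarrow> r1 + 3 * \<eta> \<le> d (p i) (p j)"
    "L - \<epsilon>/6 \<le> (\<Sum>i<k. \<Sum>j<k. d (p i) (p j))"
    by (elim exE conjE)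
  note p = p[rule_format]
  define M where "M F = measure \<mu> {z\<in>X. \<forall>j\<in>F. 2 * \<epsilon> \<le> d z (p j)}" for F
  \<comment> \<open>Rounding down by more than \<open>\<eta>\<close> lets the first space realize
    \<open>\<theta>\<close> at \<open>t = 1\<close>; rounding by less than \<open>2 * \<eta>\<close>
    bounds what another space loses when it realizes \<open>\<theta>\<close> only at
    \<open>t = 0\<close>.\<close>
  have "\<exists>q\<in>\<rat>. a - 2 * \<eta> < q \<and> q < a - \<eta>" for a
    using rational_between[of "a - 2 * \<eta>" "a - \<eta>"] \<eta>(2) by auto
  then obtain rat where rat: "\<And>a. rat a \<in> \<rat>" "\<And>a. a - 2 * \<eta> < rat a" "\<And>a. rat a < a - \<eta>"
    by metis
  obtain S where S: "S \<in> \<rat>" "L + \<epsilon>/6 < S" "S < L + 2 * (\<epsilon>/6)"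
    using rational_between[of "L + \<epsilon>/6" "L + 2 * (\<epsilon>/6)"] \<epsilon> by auto
  obtain T where T: "T \<in> \<rat>" "measure \<mu> X < T" "T < measure \<mu> X + \<eta>"
    using rational_between[of "measure \<mu> X" "measure \<mu> X + \<eta>"] \<eta> by auto
  define prof :: "nat \<Rightarrow> (nat \<times> nat \<Rightarrow> real) \<Rightarrow> real \<Rightarrow> real \<Rightarrow> (nat set \<Rightarrow> real) \<Rightarrow> profile"
    where "prof k c \<sigma> s m = (k, restrict c ({..<k} \<times> {..<k}), \<sigma>, s, restrict m (Pow {..<k}), \<eta>)"
    for k c \<sigma> s m
  have prof: "realizes_at (prof k c \<sigma> s m) t y \<longleftrightarrow>
      realizes k (\<lambda>ij. c ij + \<eta> * t) (\<sigma> + \<eta> * t) (s + \<eta> * t) (\<lambda>F. m F + \<eta> * t) y"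
    if "y \<in> mms_space" for k c \<sigma> s m t y
    unfolding prof_def by (rule realizes_at_restrict[OF that])
  \<comment> \<open>At \<open>t = 1\<close> the far radius is exactly \<open>2 * \<epsilon>\<close>,
    the one used in \<open>M\<close>. A bound of \<open>-1\<close> here and below switches the
    corresponding constraint off.\<close>
  define \<theta> where "\<theta> = prof k (\<lambda>(i, j). rat (d (p i) (p j))) (-1) (2 * \<epsilon> - \<eta>) (\<lambda>F. rat (M F))"
  \<comment> \<open>The upper profiles: failure of \<open>\<theta>1\<close> forbids one more
    separated point, failure of \<open>\<theta>2\<close> bounds the sum of distances, and
    \<open>\<theta>3\<close>, whose only index subset is the empty one, bounds the total
    mass.\<close>
  define \<theta>1 where "\<theta>1 = prof (Suc k) (\<lambda>_. r1) (-1) 0 (\<lambda>_. -1)"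
  define \<theta>2 where "\<theta>2 = prof k (\<lambda>_. r1) S 0 (\<lambda>_. -1)"
  define \<theta>3 where "\<theta>3 = prof 0 (\<lambda>_. 0) (-1) 0 (\<lambda>_. T)"
  have in_profiles: "\<theta> \<in> profiles" "\<theta>1 \<in> profiles" "\<theta>2 \<in> profiles" "\<theta>3 \<in> profiles"
    unfolding \<theta>_def \<theta>1_def \<theta>2_def \<theta>3_def prof_def
    by (intro profiles_intro; use rat \<epsilon> \<eta> r1 S T in auto)+
  have "realizes_at \<theta> 1 x"
    unfolding \<theta>_def prof[OF x] unfolding x_eq
  proof (rule realizesI[of _ p])
    show "(case (i, j) of (i, j) \<Rightarrow> rat (d (p i) (p j))) + \<eta> * 1 \<le> d (p i) (p j)" for i j
      using rat(3)[of "d (p i) (p j)"] by simp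
    have "0 \<le> (\<Sum>i<k. \<Sum>j<k. d (p i) (p j))"
      by (intro sum_nonneg) simp
    then show "- 1 + \<eta> * 1 \<le> (\<Sum>i<k. \<Sum>j<k. d (p i) (p j))"
      using \<eta>(3) by linarith
    show "rat (M F) + \<eta> * 1 \<le> measure \<mu> {z\<in>X. \<forall>j\<in>F. 2 * \<epsilon> - \<eta> + \<eta> * 1 \<le> d z (p j)}" for F
      using rat(3)[of "M F"] by (simp add: M_def)
  qed (use p in auto)
  then have level: "profile_level \<theta> x = 1"
    using profile_level_ge[of \<theta> 1 x] profile_level_le_1[of \<theta> x] by simp
  have "\<not> realizes_at \<theta>1 0 x"
  proof
    assume "realizes_at \<theta>1 0 x"
    then obtain u where u: "\<forall>i<Suc k. u i \<in> X" "\<forall>i<Suc k. \<forall>j<Suc k. i \<noteq> j \<longrightarrow> r1 \<le> d (u i) (u j)"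
      unfolding \<theta>1_def prof[OF x] unfolding x_eq realizes_def prod.case
      by (elim exE conjE) (rule that; simp)
    have "\<forall>i<Suc k. \<forall>j<Suc k. i \<noteq> j \<longrightarrow> r \<le> d (u i) (u j)"
      using u(2) r1(2) by fastforce
    then show False
      using no_sep u(1) by blast
  qed
  moreover have "\<not> realizes_at \<theta>2 0 x"
  proof
    assume "realizes_at \<theta>2 0 x"
    then obtain u where u: "\<forall>i<k. u i \<in> X" "\<forall>i<k. \<forall>j<k. i \<noteq> j \<longrightarrow> r1 \<le> d (u i) (u j)"
       "S \<le> (\<Sum>i<k. \<Sum>j<k. d (u i) (u j))"
      unfolding \<theta>2_def prof[OF x] unfolding x_eq realizes_def prod.case
      by (elim exE conjE) (rule that; simp)
    have "\<forall>i<k. \<forall>j<k. i \<noteq> j \<longrightarrow> r \<le> d (u i) (u j)"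
      using u(2) r1(2) by fastforce
    moreover have "L + \<epsilon>/6 \<le> (\<Sum>i<k. \<Sum>j<k. d (u i) (u j))"
      using u(3) S(2) by linarith
    ultimately show False
      using no_large u(1) by blast
  qed
  moreover have "\<not> realizes_at \<theta>3 0 x"
    unfolding \<theta>3_def prof[OF x] unfolding x_eq realizes_def prod.case using T(2) by auto
  ultimately have level': "profile_level \<theta>' x = 0" if "\<theta>' \<in> {\<theta>1, \<theta>2, \<theta>3}" for \<theta>'
    using that in_profiles profile_level_gt[of \<theta>' x 0] x profile_level_nonneg[of \<theta>' x] by (auto simp: less_le)
  have "ghp_dist x y < r0"
    if y: "y \<in> mms_space" and low: "profile_level \<theta> y > 0"
      and up: "\<And>\<theta>'. \<theta>' \<in> {\<theta>1, \<theta>2, \<theta>3} \<Longrightarrow> profile_level \<theta>' y < 1" for y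
  proof -
    obtain Y e \<nu> where y_eq: "y = (Y, e, \<nu>)" and Y: "compact_mms Y e \<nu>"
      using y by (rule mms_spaceE)
    interpret y: compact_mms Y e \<nu> by fact
    have upper: "\<not> realizes_at \<theta>' 1 y" if "\<theta>' \<in> {\<theta>1, \<theta>2, \<theta>3}" for \<theta>'
      using up[OF that] profile_level_ge[of \<theta>' 1 y] by auto
    have "realizes_at \<theta> 0 y"
      using low in_profiles y by (intro profile_level_gt) auto
    then obtain q where q: "\<forall>i<k. q i \<in> Y"
      "\<forall>i<k. \<forall>j<k. i \<noteq> j \<longrightarrow> rat (d (p i) (p j)) \<le> e (q i) (q j)"
      "\<forall>F\<subseteq>{..<k}. rat (M F) \<le> measure \<nu> {z\<in>Y. \<forall>j\<in>F. 2 * \<epsilon> - \<eta> \<le> e z (q j)}"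
      unfolding \<theta>_def prof[OF y] unfolding y_eq realizes_def prod.case
      by (elim exE conjE) (rule that; simp)
    note q = q[rule_format]
    \<comment> \<open>The case \<open>i = j\<close> is separate, since \<open>realizes\<close>
      constrains only off-diagonal distances.\<close>
    have e_ge: "d (p i) (p j) - 2 * \<eta> \<le> e (q i) (q j)" if "i < k" "j < k" for i j
      using q(2)[OF that] rat(2)[of "d (p i) (p j)"] p(1) q(1) \<eta>(2) that
      by (cases "i = j") auto
    \<comment> \<open>The margin \<open>3 * \<eta>\<close> in the choice of \<open>p\<close> is
      spent here: after losing \<open>2 * \<eta>\<close>, the separation still meets the value that
      \<open>\<theta>1\<close> and \<open>\<theta>2\<close> ask for at \<open>t = 1\<close>.\<close>
    have q_sep: "r1 + \<eta> \<le> e (q i) (q j)" if "i < k" "j < k" "i \<noteq> j" for i j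
      using e_ge[OF that(1,2)] p(2)[OF that] by linarith
    have esum: "(\<Sum>i<k. \<Sum>j<k. e (q i) (q j)) < S + \<eta>"
    proof (rule ccontr)
      assume "\<not> ?thesis"
      then have "realizes_at \<theta>2 1 y"
        unfolding \<theta>2_def prof[OF y] unfolding y_eq
        by (intro realizesI[of _ q]) (use q(1) q_sep \<eta> in \<open>auto intro: order_trans[OF _ measure_nonneg]\<close>)
      then show False
        using upper by simp
    qed
    have e_le: "e (q i) (q j) \<le> d (p i) (p j) + 2 * \<epsilon>" if i: "i < k" and j: "j < k" for i j
    proof -
      \<comment> \<open>All these terms are nonnegative by \<open>e_ge\<close>, so a single one is
        at most their sum, and the sum is small because \<open>p\<close> is near-optimal and
        \<open>\<theta>2\<close> fails at \<open>t = 1\<close>.\<close>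
      let ?f = "\<lambda>(i, j). e (q i) (q j) - d (p i) (p j) + 2 * \<eta>"
      have "?f (i, j) \<le> sum ?f ({..<k} \<times> {..<k})"
        using i j e_ge by (intro member_le_sum) (auto simp: add.commute diff_le_eq algebra_simps)
      also have "\<dots> = (\<Sum>i<k. \<Sum>j<k. e (q i) (q j)) - (\<Sum>i<k. \<Sum>j<k. d (p i) (p j)) + 2 * (\<eta> * (real k)\<^sup>2)"
        by (simp add: sum.cartesian_product[symmetric] sum.distrib sum_subtractf power2_eq_square)
      also have "\<dots> < 2 * \<epsilon>"
        using esum p(3) S(3) \<eta>' \<eta>(2) \<eta>k by linarith
      finally show ?thesis
        using \<eta>(2) by simp
    qed
    have netX: "\<exists>i<k. d z (p i) < \<epsilon>" if "z \<in> X" for z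
    proof -
      have "r \<le> d (p i) (p j)" if "i < k" "j < k" "i \<noteq> j" for i j
        using p(2)[OF that] r1(2) \<eta>(2) by linarith
      then have "\<exists>i<k. d z (p i) < r"
        using maximal_separated_is_net[OF x.Metric_space_axioms no_sep, of p z] p(1) that by blast
      then show ?thesis
        using r(2) by (meson less_trans)
    qed
    have netY: "\<exists>i<k. e z (q i) < \<epsilon>" if "z \<in> Y" for z
    proof -
      have "\<nexists>p. (\<forall>i<Suc k. p i \<in> Y) \<and> (\<forall>i<Suc k. \<forall>j<Suc k. i \<noteq> j \<longrightarrow> r1 + \<eta> \<le> e (p i) (p j))"
      proof
        assume "\<exists>p. (\<forall>i<Suc k. p i \<in> Y) \<and> (\<forall>i<Suc k. \<forall>j<Suc k. i \<noteq> j \<longrightarrow> r1 + \<eta> \<le> e (p i) (p j))"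
        then obtain u where u: "\<forall>i<Suc k. u i \<in> Y" "\<forall>i<Suc k. \<forall>j<Suc k. i \<noteq> j \<longrightarrow> r1 + \<eta> \<le> e (u i) (u j)"
          by blast
        have "0 \<le> (\<Sum>i<Suc k. \<Sum>j<Suc k. e (u i) (u j))"
          by (intro sum_nonneg) simp
        then have "realizes_at \<theta>1 1 y"
          unfolding \<theta>1_def prof[OF y] unfolding y_eq
          using u \<eta> by (intro realizesI[of _ u]) (auto intro: order_trans[OF _ measure_nonneg])
        then show False
          using upper by simp
      qed
      then have "\<exists>i<k. e z (q i) < r1 + \<eta>"
        using maximal_separated_is_net[OF y.Metric_space_axioms, of k "r1 + \<eta>" q z] q(1) q_sep that by blast
      moreover have "r1 + \<eta> < \<epsilon>"
        using \<open>r1 + 3 * \<eta> < \<epsilon>\<close> \<eta>(2) by linarith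
      ultimately show ?thesis
        by (meson less_trans)
    qed
    have mass: "measure \<nu> Y < measure \<mu> X + 2 * \<eta>"
    proof (rule ccontr)
      assume "\<not> ?thesis"
      then have "T + \<eta> \<le> measure \<nu> Y"
        using T(3) by linarith
      then have "realizes_at \<theta>3 1 y"
        unfolding \<theta>3_def prof[OF y] unfolding y_eq
        using \<eta> by (intro realizesI[of _ q]) auto
      then show False
        using upper by simp
    qed
    have far: "M F \<le> measure \<nu> {z\<in>Y. \<forall>j\<in>F. 2 * \<epsilon> - \<eta> \<le> e z (q j)} + 2 * \<eta>" if "F \<subseteq> {..<k}" for F
      using q(3)[OF that] rat(2)[of "M F"] by linarith
    have farX: "{z\<in>X. \<forall>j\<in>F. 2 * \<epsilon> \<le> d z (p j)} \<in> sets \<mu>" if "F \<subseteq> {..<k}" for F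
      using that p(1) by (intro x.far_sets) auto
    have farY: "{z\<in>Y. \<forall>j\<in>F. 2 * \<epsilon> - \<eta> \<le> e z (q j)} \<in> sets \<nu>" if "F \<subseteq> {..<k}" for F
      using that q(1) by (intro y.far_sets) auto
    have "ghp_close (5 * \<epsilon>) (X, d, \<mu>) (Y, e, \<nu>)"
    proof (rule glue_ghp_close[OF X Y k \<epsilon>(2), of p q])
      show "\<bar>d (p i) (p j) - e (q i) (q j)\<bar> \<le> 2 * \<epsilon>" if "i < k" "j < k" for i j
        using e_ge[OF that] e_le[OF that] \<eta>4 \<epsilon>(2) by linarith
      show "\<exists>i<k. d z (p i) < 2 * \<epsilon>" if "z \<in> X" for z
        using netX[OF that] \<epsilon>(2) by force
      show "\<exists>i<k. e z (q i) < 2 * \<epsilon>" if "z \<in> Y" for z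
        using netY[OF that] \<epsilon>(2) by force
    next
      fix C assume C: "C \<subseteq> X" "C \<in> sets \<mu>"
      \<comment> \<open>\<open>C\<close> lies in the far set of \<open>F\<close>, whose mass carries
        over to \<open>?E\<close>. A point of \<open>?E\<close> is within \<open>\<epsilon>\<close>
        of some \<open>q i\<close>; since \<open>\<epsilon> < 2 * \<epsilon> - \<eta>\<close> this
        \<open>i\<close> is outside \<open>F\<close>, so \<open>C\<close> has a point near
        \<open>p i\<close>.\<close>
      define F where "F = {j. j < k \<and> (\<forall>z\<in>C. 2 * \<epsilon> \<le> d z (p j))}"
      have F: "F \<subseteq> {..<k}"
        by (auto simp: F_def)
      let ?E = "{z\<in>Y. \<forall>j\<in>F. 2 * \<epsilon> - \<eta> \<le> e z (q j)}"
      have "measure \<mu> C \<le> M F"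
        unfolding M_def using C by (intro x.finite_measure_mono farX F) (auto simp: F_def)
      then have "measure \<mu> C \<le> measure \<nu> ?E + \<epsilon>"
        using far[OF F] \<eta>4 \<eta>(2) by linarith
      moreover have "\<exists>w\<in>C. \<exists>i<k. d w (p i) < 2 * \<epsilon> \<and> e z (q i) < 2 * \<epsilon>" if z: "z \<in> ?E" for z
      proof -
        obtain i where i: "i < k" "e z (q i) < \<epsilon>"
          using netY z by auto
        then have "i \<notin> F"
          using z \<eta>4 \<epsilon>(2) by force
        then show ?thesis
          using i \<epsilon>(2) by (force simp: F_def not_le)
      qed
      ultimately show "\<exists>E\<in>sets \<nu>. measure \<mu> C \<le> measure \<nu> E + \<epsilon> \<and>
          (\<forall>y\<in>E. \<exists>x\<in>C. \<exists>i<k. d x (p i) < 2 * \<epsilon> \<and> e y (q i) < 2 * \<epsilon>)"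
        using farY[OF F] by blast
    next
      fix C assume C: "C \<subseteq> Y" "C \<in> sets \<nu>"
      \<comment> \<open>Masses in \<open>Y\<close> are bounded from above only through the total
        mass. Hence \<open>C\<close> is placed in the complement of a far set \<open>?B\<close>: the
        total mass costs \<open>2 * \<eta>\<close> and the far mass another
        \<open>2 * \<eta>\<close>.\<close>
      define F where "F = {j. j < k \<and> (\<exists>z\<in>C. e z (q j) < \<epsilon>)}"
      have F: "F \<subseteq> {..<k}"
        by (auto simp: F_def)
      let ?A = "{z\<in>X. \<forall>j\<in>F. 2 * \<epsilon> \<le> d z (p j)}" and ?B = "{z\<in>Y. \<forall>j\<in>F. 2 * \<epsilon> - \<eta> \<le> e z (q j)}"
      have "C \<subseteq> Y - ?B"
      proof
        fix z assume z: "z \<in> C"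
        then obtain i where i: "i < k" "e z (q i) < \<epsilon>"
          using netY C by blast
        then have "i \<in> F"
          using z by (auto simp: F_def)
        then show "z \<in> Y - ?B"
          using z i C \<eta>4 \<epsilon>(2) by force
      qed
      then have "measure \<nu> C \<le> measure \<nu> (Y - ?B)"
        using farY[OF F] y.space_eq sets.top[of \<nu>] by (intro y.finite_measure_mono) auto
      also have "\<dots> = measure \<nu> Y - measure \<nu> ?B"
        using y.finite_measure_compl[OF farY[OF F]] by (simp add: y.space_eq)
      also have "\<dots> \<le> measure \<mu> X - M F + 4 * \<eta>"
        using mass far[OF F] by linarith
      also have "\<dots> \<le> measure \<mu> (X - ?A) + \<epsilon>"
        using x.finite_measure_compl[OF farX[OF F]] \<eta>4 by (simp add: x.space_eq M_def)
      finally have "measure \<nu> C \<le> measure \<mu> (X - ?A) + \<epsilon>" .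
      moreover have "X - ?A \<in> sets \<mu>"
        using sets.compl_sets[OF farX[OF F]] by (simp add: x.space_eq)
      moreover have "\<exists>z\<in>C. \<exists>i<k. d w (p i) < 2 * \<epsilon> \<and> e z (q i) < 2 * \<epsilon>" if w: "w \<in> X - ?A" for w
      proof -
        obtain j where "j \<in> F" "d w (p j) < 2 * \<epsilon>"
          using w by (auto simp: not_le)
        then show ?thesis
          using \<epsilon>(2) by (force simp: F_def)
      qed
      ultimately show "\<exists>E\<in>sets \<mu>. measure \<nu> C \<le> measure \<mu> E + \<epsilon> \<and>
          (\<forall>x\<in>E. \<exists>y\<in>C. \<exists>i<k. d x (p i) < 2 * \<epsilon> \<and> e y (q i) < 2 * \<epsilon>)"
        by blast
    qed (use p q in auto)
    then have "ghp_dist x y \<le> 10 * \<epsilon>"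
      using ghp_close_imp_dist_le[OF x y, of "5 * \<epsilon>"] \<epsilon>(2) by (simp add: x_eq y_eq)
    then show ?thesis
      using \<epsilon>(3) by linarith
  qed
  then show thesis
    using that[of \<theta> "{\<theta>1, \<theta>2, \<theta>3}"] in_profiles level level' by blast
qed

section \<open>Scaling and increasing test functions\<close>

context Metric_space
begin

lemma Metric_space_scale: "a > 0 \<Longrightarrow> Metric_space M (\<lambda>x y. a * d x y)"
  by unfold_locales (auto simp: commute distrib_left[symmetric] triangle)

lemma mtopology_scale:
  assumes "a > 0"
  shows "Metric_space.mtopology M (\<lambda>x y. a * d x y) = mtopology"
proof -
  interpret S: Metric_space M "\<lambda>x y. a * d x y"
    using assms by (rule Metric_space_scale)
  have ball: "S.mball x (a * r) = mball x r" for x r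
    using assms by (auto simp: S.mball_def mball_def)
  have "openin S.mtopology U \<longleftrightarrow> openin mtopology U" for U
  proof
    assume U: "openin S.mtopology U"
    show "openin mtopology U"
      unfolding openin_mtopology
    proof (intro conjI allI impI)
      fix x assume "x \<in> U"
      then obtain r where "r > 0" "S.mball x r \<subseteq> U"
        using U by (auto simp: S.openin_mtopology)
      then show "\<exists>r>0. mball x r \<subseteq> U"
        using ball[of x "r / a"] assms by (intro exI[of _ "r / a"]) auto
    qed (use U in \<open>auto simp: S.openin_mtopology\<close>)
  next
    assume U: "openin mtopology U"
    show "openin S.mtopology U"
      unfolding S.openin_mtopology
    proof (intro conjI allI impI)
      fix x assume "x \<in> U"
      then obtain r where "r > 0" "mball x r \<subseteq> U"
        using U by (auto simp: openin_mtopology)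
      then show "\<exists>r>0. S.mball x r \<subseteq> U"
        using ball[of x r] assms by (intro exI[of _ "a * r"]) auto
    qed (use U in \<open>auto simp: openin_mtopology\<close>)
  qed
  then show ?thesis
    by (simp add: topology_eq)
qed

end

lemma scale_mms_in_space:
  assumes "x \<in> mms_space" "a > 0"
  shows "scale_mms a b x \<in> mms_space"
proof -
  obtain X d \<mu> where x: "x = (X, d, \<mu>)" and X: "compact_mms X d \<mu>"
    using assms(1) by (rule mms_spaceE)
  interpret compact_mms X d \<mu> by fact
  have "finite_measure (scale_measure (ennreal b) \<mu>)"
    by (rule finite_measureI) (simp add: space_scale_measure ennreal_mult_eq_top_iff)
  then have "compact_mms X (\<lambda>x y. a * d x y) (scale_measure (ennreal b) \<mu>)"
    using assms(2) nonempty compact sets_eq space_eq Metric_space_scale[of a]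
    by (auto simp: compact_mms_def compact_mms_axioms_def mtopology_scale space_scale_measure metric_borel_def)
  then show ?thesis
    by (simp add: x scale_mms_def mms_space_iff)
qed

lemma scale_scale_mms:
  assumes "0 \<le> b" "0 \<le> b'"
  shows "scale_mms a b (scale_mms a' b' x) = scale_mms (a * a') (b * b') x"
  using assms by (auto simp: scale_mms_def ennreal_mult mult.assoc split: prod.splits)

lemma mms_le_scale_cong:
  assumes "mms_le x y" "0 \<le> a"
  shows "mms_le (scale_mms a b x) (scale_mms a b y)"
proof -
  obtain X d \<mu> Y e \<nu> where xy: "x = (X, d, \<mu>)" "y = (Y, e, \<nu>)"
    by (metis prod_cases3)
  obtain \<phi> where "\<phi> ` Y = X" "\<forall>u\<in>Y. \<forall>v\<in>Y. d (\<phi> u) (\<phi> v) \<le> e u v"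
    "\<forall>A \<in> sets \<mu>. emeasure \<mu> A \<le> emeasure \<nu> (\<phi> -` A \<inter> Y)"
    using assms(1) unfolding mms_le_def xy prod.case by (elim exE conjE)
  then show ?thesis
    using assms(2) unfolding mms_le_def xy scale_mms_def prod.case
    by (intro exI[of _ \<phi>]) (auto intro!: mult_left_mono)
qed

text \<open>The identity map is the witness. This is what lets factors close to 1 absorb the change
  of scaling constants.\<close>

lemma mms_le_scale_mono:
  assumes "x \<in> mms_space" "a \<le> a'" "b \<le> b'"
  shows "mms_le (scale_mms a b x) (scale_mms a' b' x)"
proof -
  obtain X d \<mu> where x: "x = (X, d, \<mu>)" and X: "compact_mms X d \<mu>"
    using assms(1) by (rule mms_spaceE)
  interpret compact_mms X d \<mu> by fact
  have "A \<inter> X = A" if "A \<in> sets \<mu>" for A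
    using sets.sets_into_space[OF that] space_eq by blast
  then show ?thesis
    using assms(2,3) unfolding mms_le_def x scale_mms_def prod.case
    by (intro exI[of _ "\<lambda>x. x"]) (auto intro!: mult_right_mono ennreal_leI)
qed

text \<open>Distances scale by \<open>a\<close> and masses by \<open>b\<close>, but the same
  threshold serves both, hence the maximum.\<close>

lemma ghp_close_scale:
  assumes "x \<in> mms_space" "y \<in> mms_space" "a > 0" "b > 0" "\<rho> > 0" "ghp_close \<rho> x y"
  shows "ghp_close (max a b * \<rho>) (scale_mms a b x) (scale_mms a b y)"
proof -
  obtain X d \<mu> where x: "x = (X, d, \<mu>)" and X: "compact_mms X d \<mu>"
    using assms(1) by (rule mms_spaceE)
  obtain Y e \<nu> where y: "y = (Y, e, \<nu>)" and Y: "compact_mms Y e \<nu>"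
    using assms(2) by (rule mms_spaceE)
  interpret x: compact_mms X d \<mu> by fact
  interpret y: compact_mms Y e \<nu> by fact
  obtain Z :: "real set" and dZ \<phi> \<psi> where Z: "Metric_space Z dZ"
    and emb: "isometric_embedding X d Z dZ \<phi>" "isometric_embedding Y e Z dZ \<psi>"
    and near: "\<forall>x\<in>X. \<exists>y\<in>Y. dZ (\<phi> x) (\<psi> y) < \<rho>" "\<forall>y\<in>Y. \<exists>x\<in>X. dZ (\<psi> y) (\<phi> x) < \<rho>"
    and meas: "\<forall>C. closedin (Metric_space.mtopology Z dZ) C \<longrightarrow>
           measure \<mu> (\<phi> -` C \<inter> X) \<le> measure \<nu> (\<psi> -` nbhd Z dZ C \<rho> \<inter> Y) + \<rho> \<and>
           measure \<nu> (\<psi> -` C \<inter> Y) \<le> measure \<mu> (\<phi> -` nbhd Z dZ C \<rho> \<inter> X) + \<rho>"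
    using assms(6) unfolding x y ghp_close_def prod.case by (elim exE conjE)
  interpret Z: Metric_space Z dZ by fact
  let ?c = "max a b * \<rho>" and ?e = "\<lambda>u v. a * dZ u v"
  interpret S: Metric_space Z ?e
    using assms(3) by (rule Z.Metric_space_scale)
  have emb': "isometric_embedding X (\<lambda>u v. a * d u v) Z ?e \<phi>" "isometric_embedding Y (\<lambda>u v. a * e u v) Z ?e \<psi>"
    using emb by (auto simp: isometric_embedding_def)
  have c: "a * \<rho> \<le> ?c" "b * \<rho> \<le> ?c"
    using assms(5) by (auto intro!: mult_right_mono)
  have less: "a * t < ?c" if "t < \<rho>" for t
    using that c(1) assms(3) by (meson less_le_trans mult_strict_left_mono)
  have near': "\<forall>x\<in>X. \<exists>y\<in>Y. a * dZ (\<phi> x) (\<psi> y) < ?c" "\<forall>y\<in>Y. \<exists>x\<in>X. a * dZ (\<psi> y) (\<phi> x) < ?c"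
    using near less by blast+
  have mm: "\<phi> -` U \<inter> X \<in> sets \<mu>" "\<psi> -` U \<inter> Y \<in> sets \<nu>" if "openin Z.mtopology U" for U
    using x.openin_sets[OF x.continuous_isometric_preimage[OF Z emb(1) that]]
      y.openin_sets[OF y.continuous_isometric_preimage[OF Z emb(2) that]] by auto
  have "b * measure \<mu> (\<phi> -` C \<inter> X) \<le> b * measure \<nu> (\<psi> -` nbhd Z ?e C ?c \<inter> Y) + ?c \<and>
        b * measure \<nu> (\<psi> -` C \<inter> Y) \<le> b * measure \<mu> (\<phi> -` nbhd Z ?e C ?c \<inter> X) + ?c"
    if C: "closedin Z.mtopology C" for C
  proof -
    have CZ: "C \<subseteq> Z"
      using closedin_subset[OF C] by simp
    have sub: "nbhd Z dZ C \<rho> \<subseteq> nbhd Z ?e C ?c"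
      using less by (auto simp: nbhd_def)
    have "openin Z.mtopology (nbhd Z ?e C ?c)"
      using S.openin_nbhd[OF CZ] Z.mtopology_scale[OF assms(3)] by simp
    then have "measure \<nu> (\<psi> -` nbhd Z dZ C \<rho> \<inter> Y) \<le> measure \<nu> (\<psi> -` nbhd Z ?e C ?c \<inter> Y)"
      "measure \<mu> (\<phi> -` nbhd Z dZ C \<rho> \<inter> X) \<le> measure \<mu> (\<phi> -` nbhd Z ?e C ?c \<inter> X)"
      using mm sub by (auto intro!: x.finite_measure_mono y.finite_measure_mono)
    then have "measure \<mu> (\<phi> -` C \<inter> X) \<le> measure \<nu> (\<psi> -` nbhd Z ?e C ?c \<inter> Y) + \<rho>"
      "measure \<nu> (\<psi> -` C \<inter> Y) \<le> measure \<mu> (\<phi> -` nbhd Z ?e C ?c \<inter> X) + \<rho>"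
      using meas C by fastforce+
    then have "b * measure \<mu> (\<phi> -` C \<inter> X) \<le> b * (measure \<nu> (\<psi> -` nbhd Z ?e C ?c \<inter> Y) + \<rho>)"
      "b * measure \<nu> (\<psi> -` C \<inter> Y) \<le> b * (measure \<mu> (\<phi> -` nbhd Z ?e C ?c \<inter> X) + \<rho>)"
      using assms(4) by (auto intro!: mult_left_mono)
    then show ?thesis
      using c(2) by (simp add: distrib_left)
  qed
  then show ?thesis
    unfolding ghp_close_def prod.case x y scale_mms_def
    using S.Metric_space_axioms emb' near' assms(4)
    by (intro exI[of _ Z] exI[of _ ?e] exI[of _ \<phi>] exI[of _ \<psi>]) (simp add: Z.mtopology_scale[OF assms(3)])
qed

text \<open>A finite net is glued to itself. The distortion is at most the factor
  \<open>\<bar>l - 1\<bar>\<close> times a diameter bound, and each mass changes by at most that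
  factor times the total mass.\<close>

lemma ghp_close_scale_near_1:
  assumes x: "x \<in> mms_space" and \<rho>: "\<rho> > 0"
  shows "\<exists>\<eta>>0. \<forall>l>0. \<bar>l - 1\<bar> < \<eta> \<longrightarrow> ghp_close (5 * \<rho>) x (scale_mms l l x)"
proof -
  obtain X d \<mu> where x_eq: "x = (X, d, \<mu>)" and X: "compact_mms X d \<mu>"
    using x by (rule mms_spaceE)
  interpret compact_mms X d \<mu> by fact
  obtain D where D: "D > 0" "\<And>x y. x \<in> X \<Longrightarrow> y \<in> X \<Longrightarrow> d x y \<le> D"
    using bounded_dist by blast
  obtain k :: nat and p where p: "\<forall>i<k. p i \<in> X" "\<forall>x\<in>X. \<exists>i<k. d x (p i) < \<rho>"
    using \<rho> by (rule finite_net)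
  have k: "k > 0"
    using p(2) nonempty by auto
  define m where "m = measure \<mu> X"
  have m: "0 \<le> m" "measure \<mu> A \<le> m" for A
    using bounded_measure[of A] by (auto simp: m_def space_eq)
  \<comment> \<open>The term 1 forces \<open>l < 2\<close>, so a net of mesh \<open>\<rho>\<close>
    still has mesh \<open>2 * \<rho>\<close> after scaling; the quotient controls the distortion of
    distances and masses at once.\<close>
  define \<eta> where "\<eta> = min 1 (\<rho> / (D + m + 1))"
  have pos: "0 < D + m + 1"
    using D(1) m(1) by simp
  have \<eta>: "\<eta> > 0"
    using \<rho> pos by (simp add: \<eta>_def)
  have "ghp_close (5 * \<rho>) x (scale_mms l l x)" if l: "l > 0" "\<bar>l - 1\<bar> < \<eta>" for l
  proof -
    have "\<bar>l - 1\<bar> < \<rho> / (D + m + 1)"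
      using l(2) by (simp add: \<eta>_def)
    then have "\<bar>l - 1\<bar> * (D + m + 1) < \<rho>"
      using pos by (simp add: pos_less_divide_eq)
    then have lD: "\<bar>l - 1\<bar> * D + \<bar>l - 1\<bar> * m < \<rho>"
      by (simp add: distrib_left)
    have lm: "\<bar>l - 1\<bar> * t < \<rho>" if "t \<le> D \<or> t \<le> m" for t
    proof -
      have "\<bar>l - 1\<bar> * t \<le> \<bar>l - 1\<bar> * D \<or> \<bar>l - 1\<bar> * t \<le> \<bar>l - 1\<bar> * m"
        using that mult_left_mono[of t _ "\<bar>l - 1\<bar>"] by auto
      moreover have "0 \<le> \<bar>l - 1\<bar> * D" "0 \<le> \<bar>l - 1\<bar> * m"
        using D(1) m(1) by simp_all
      ultimately show ?thesis
        using lD by linarith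
    qed
    have "\<bar>l - 1\<bar> < 1"
      using l(2) by (simp add: \<eta>_def)
    then have l2: "l < 2"
      by linarith
    have near: "\<exists>i<k. d z (p i) < 2 * \<rho> \<and> l * d z (p i) < 2 * \<rho>" if z: "z \<in> X" for z
    proof -
      obtain i where i: "i < k" "d z (p i) < \<rho>"
        using p(2) z by auto
      have "l * d z (p i) \<le> 2 * d z (p i)"
        using l2 by (intro mult_right_mono) auto
      then show ?thesis
        using i \<rho> by (intro exI[of _ i]) linarith
    qed
    have near_C: "\<forall>z\<in>C. \<exists>w\<in>C. \<exists>i<k. d w (p i) < 2 * \<rho> \<and> l * d z (p i) < 2 * \<rho>"
      "\<forall>z\<in>C. \<exists>w\<in>C. \<exists>i<k. d z (p i) < 2 * \<rho> \<and> l * d w (p i) < 2 * \<rho>" if "C \<subseteq> X" for C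
      using near that by blast+
    have sX: "scale_mms l l x \<in> mms_space"
      using x l(1) by (rule scale_mms_in_space)
    have dl: "\<bar>t - l * t\<bar> < \<rho>" if "0 \<le> t" "t \<le> D \<or> t \<le> m" for t
    proof -
      have "\<bar>t - l * t\<bar> = \<bar>(1 - l) * t\<bar>"
        by (simp add: left_diff_distrib)
      also have "\<dots> = \<bar>l - 1\<bar> * t"
        using that(1) by (simp add: abs_mult abs_minus_commute)
      finally show ?thesis
        using lm[OF that(2)] by simp
    qed
    have eqm: "measure (scale_measure (ennreal l) \<mu>) A = l * measure \<mu> A" for A
      using l(1) by simp
    show ?thesis
      unfolding x_eq scale_mms_def prod.case
    proof (rule glue_ghp_close[OF X _ k \<rho>, of _ _ _ p p])
      show "compact_mms X (\<lambda>x y. l * d x y) (scale_measure (ennreal l) \<mu>)"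
        using sX by (simp add: x_eq scale_mms_def mms_space_iff)
      show "\<bar>d (p i) (p j) - l * d (p i) (p j)\<bar> \<le> 2 * \<rho>" if "i < k" "j < k" for i j
        using dl[of "d (p i) (p j)"] D(2) p(1) that \<rho> by force
      show "\<exists>i<k. d z (p i) < 2 * \<rho>" "\<exists>i<k. l * d z (p i) < 2 * \<rho>" if "z \<in> X" for z
        using near[OF that] by auto
    next
      fix C assume C: "C \<subseteq> X" "C \<in> sets \<mu>"
      show "\<exists>E\<in>sets (scale_measure (ennreal l) \<mu>). measure \<mu> C \<le> measure (scale_measure (ennreal l) \<mu>) E + \<rho> \<and>
          (\<forall>y\<in>E. \<exists>x\<in>C. \<exists>i<k. d x (p i) < 2 * \<rho> \<and> l * d y (p i) < 2 * \<rho>)"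
        using C near_C[OF C(1)] dl[of "measure \<mu> C"] m(2)[of C] unfolding eqm
        by (intro bexI[of _ C] conjI) (simp_all add: abs_less_iff)
    next
      fix C assume C: "C \<subseteq> X" "C \<in> sets (scale_measure (ennreal l) \<mu>)"
      show "\<exists>E\<in>sets \<mu>. measure (scale_measure (ennreal l) \<mu>) C \<le> measure \<mu> E + \<rho> \<and>
          (\<forall>x\<in>E. \<exists>y\<in>C. \<exists>i<k. d x (p i) < 2 * \<rho> \<and> l * d y (p i) < 2 * \<rho>)"
        using C near_C[OF C(1)] dl[of "measure \<mu> C"] m(2)[of C] unfolding eqm
        by (intro bexI[of _ C] conjI) (simp_all add: abs_less_iff)
    qed (use p in auto)
  qed
  then show ?thesis
    using \<eta> by blast
qed

text \<open>Continuity as \<open>tendsto\<close> along this filter makes the limit rules for sums,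
  products, maxima and compositions available.\<close>

definition ghp_nhds :: "mms \<Rightarrow> mms filter" where
  "ghp_nhds x = (INF r\<in>{0<..}. principal {y\<in>mms_space. ghp_dist x y < r})"

lemma eventually_ghp_nhds:
  "eventually P (ghp_nhds x) \<longleftrightarrow> (\<exists>r>0. \<forall>y\<in>mms_space. ghp_dist x y < r \<longrightarrow> P y)"
  unfolding ghp_nhds_def
proof (subst eventually_INF_base)
  fix r s :: real assume "r \<in> {0<..}" "s \<in> {0<..}"
  then show "\<exists>t\<in>{0<..}. principal {y\<in>mms_space. ghp_dist x y < t} \<le>
      principal {y\<in>mms_space. ghp_dist x y < r} \<sqinter> principal {y\<in>mms_space. ghp_dist x y < s}"
    by (intro bexI[of _ "min r s"]) auto
qed (auto simp: eventually_principal)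

lemma ghp_continuous_iff_tendsto:
  "ghp_continuous f \<longleftrightarrow> (\<forall>x\<in>mms_space. (f \<longlongrightarrow> f x) (ghp_nhds x))"
  by (auto simp: ghp_continuous_def tendsto_iff eventually_ghp_nhds dist_real_def)

lemma ghp_continuous_tendsto: "ghp_continuous f \<Longrightarrow> x \<in> mms_space \<Longrightarrow> (f \<longlongrightarrow> f x) (ghp_nhds x)"
  by (simp add: ghp_continuous_iff_tendsto)

lemma filterlim_scale_mms:
  assumes "x \<in> mms_space" "a > 0" "b > 0"
  shows "filterlim (scale_mms a b) (ghp_nhds (scale_mms a b x)) (ghp_nhds x)"
  unfolding filterlim_iff
proof (intro allI impI)
  fix P assume "eventually P (ghp_nhds (scale_mms a b x))"
  then obtain r where r: "r > 0" "\<And>y. y \<in> mms_space \<Longrightarrow> ghp_dist (scale_mms a b x) y < r \<Longrightarrow> P y"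
    unfolding eventually_ghp_nhds by blast
  \<comment> \<open>Closeness becomes \<open>r / 4\<close> after scaling, so the distance is at most
    \<open>r / 2\<close>, strictly below \<open>r\<close>.\<close>
  define \<rho> where "\<rho> = r / (4 * max a b)"
  have \<rho>: "\<rho> > 0" "max a b * \<rho> = r / 4"
    using r(1) assms by (auto simp: \<rho>_def max_def)
  show "eventually (\<lambda>y. P (scale_mms a b y)) (ghp_nhds x)"
    unfolding eventually_ghp_nhds
  proof (intro exI[of _ \<rho>] conjI ballI impI \<rho>(1))
    fix y assume y: "y \<in> mms_space" "ghp_dist x y < \<rho>"
    then have "ghp_close (r / 4) (scale_mms a b x) (scale_mms a b y)"
      using ghp_close_scale[OF assms(1) y(1) assms(2,3) \<rho>(1)] ghp_dist_imp_close[OF assms(1) y] \<rho>(2) by simp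
    then have "ghp_dist (scale_mms a b x) (scale_mms a b y) \<le> 2 * (r / 4)"
      using r(1) y(1) assms by (intro ghp_close_imp_dist_le scale_mms_in_space) auto
    then show "P (scale_mms a b y)"
      using r y(1) assms by (intro r(2) scale_mms_in_space) auto
  qed
qed

lemma filterlim_scale_near_1:
  assumes x: "x \<in> mms_space"
  shows "filterlim (\<lambda>l. scale_mms l l x) (ghp_nhds x) (nhds 1)"
  unfolding filterlim_iff
proof (intro allI impI)
  fix P assume "eventually P (ghp_nhds x)"
  then obtain r where r: "r > 0" "\<And>y. y \<in> mms_space \<Longrightarrow> ghp_dist x y < r \<Longrightarrow> P y"
    unfolding eventually_ghp_nhds by blast
  obtain \<eta> where \<eta>: "\<eta> > 0" "\<And>l. l > 0 \<Longrightarrow> \<bar>l - 1\<bar> < \<eta> \<Longrightarrow> ghp_close (5 * (r / 20)) x (scale_mms l l x)"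
    using ghp_close_scale_near_1[OF x, of "r / 20"] r(1) by auto
  show "eventually (\<lambda>l. P (scale_mms l l x)) (nhds 1)"
    unfolding eventually_nhds_metric
  proof (intro exI[of _ "min \<eta> 1"] conjI allI impI)
    fix l :: real assume "dist l 1 < min \<eta> 1"
    then have l: "l > 0" "\<bar>l - 1\<bar> < \<eta>"
      by (auto simp: dist_real_def)
    have "ghp_dist x (scale_mms l l x) \<le> 2 * (5 * (r / 20))"
      using x l r(1) \<eta>(2) by (intro ghp_close_imp_dist_le scale_mms_in_space) auto
    then show "P (scale_mms l l x)"
      using r x l by (intro r(2) scale_mms_in_space) auto
  qed (use \<eta> in auto)
qed

lemma ghp_continuous_scale:
  assumes "ghp_continuous f" "a > 0" "b > 0"
  shows "ghp_continuous (\<lambda>x. f (scale_mms a b x))"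
  unfolding ghp_continuous_iff_tendsto
  using assms by (auto intro!: filterlim_compose[OF ghp_continuous_tendsto filterlim_scale_mms] scale_mms_in_space)

lemma space_GHP: "space GHP = mms_space"
  unfolding GHP_def by (rule space_measure_of) (auto simp: ghp_open_def)

lemma ghp_open_sets: "ghp_open U \<Longrightarrow> U \<in> sets GHP"
  unfolding GHP_def by (subst sets_measure_of) (auto simp: ghp_open_def)

lemma ghp_open_greater:
  assumes "ghp_continuous f"
  shows "ghp_open {x\<in>mms_space. t < f x}"
  unfolding ghp_open_def
proof (intro conjI ballI)
  fix x assume x: "x \<in> {x\<in>mms_space. t < f x}"
  then have "eventually (\<lambda>y. t < f y) (ghp_nhds x)"
    using order_tendstoD(1)[OF ghp_continuous_tendsto[OF assms]] by auto
  then show "\<exists>r>0. \<forall>y\<in>mms_space. ghp_dist x y < r \<longrightarrow> y \<in> {x\<in>mms_space. t < f x}"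
    by (auto simp: eventually_ghp_nhds)
qed auto

lemma ghp_continuous_measurable:
  assumes "ghp_continuous f"
  shows "f \<in> borel_measurable GHP"
  by (rule borel_measurableI_greater) (use ghp_open_sets[OF ghp_open_greater[OF assms]] in \<open>simp add: space_GHP\<close>)

section \<open>Increasing test functions and the vector lattice they generate\<close>

definition monotone_test :: "(mms \<Rightarrow> real) \<Rightarrow> bool" where
  "monotone_test u \<longleftrightarrow> ghp_continuous u \<and> (\<exists>B. \<forall>x\<in>mms_space. \<bar>u x\<bar> \<le> B) \<and>
     (\<forall>x\<in>mms_space. \<forall>y\<in>mms_space. mms_le x y \<longrightarrow> u x \<le> u y)"

lemma monotone_testI:
  assumes "ghp_continuous u" "\<And>x. x \<in> mms_space \<Longrightarrow> \<bar>u x\<bar> \<le> B"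
    and "\<And>x y. x \<in> mms_space \<Longrightarrow> y \<in> mms_space \<Longrightarrow> mms_le x y \<Longrightarrow> u x \<le> u y"
  shows "monotone_test u"
  unfolding monotone_test_def using assms by blast

lemma monotone_testD:
  assumes "monotone_test u"
  shows "ghp_continuous u" "\<And>x y. x \<in> mms_space \<Longrightarrow> y \<in> mms_space \<Longrightarrow> mms_le x y \<Longrightarrow> u x \<le> u y"
  using assms by (auto simp: monotone_test_def)

lemma monotone_test_bounded:
  assumes "monotone_test u"
  obtains B where "\<forall>x\<in>mms_space. \<bar>u x\<bar> \<le> B"
  using assms by (auto simp: monotone_test_def)

lemma monotone_test_const: "monotone_test (\<lambda>_. c)"
  by (auto simp: monotone_test_def ghp_continuous_iff_tendsto)

lemma monotone_test_add:
  assumes "monotone_test u" "monotone_test v"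
  shows "monotone_test (\<lambda>x. u x + v x)"
proof -
  obtain B C where B: "\<forall>x\<in>mms_space. \<bar>u x\<bar> \<le> B" "\<forall>x\<in>mms_space. \<bar>v x\<bar> \<le> C"
    using assms by (auto simp: monotone_test_def)
  have "\<forall>x\<in>mms_space. \<bar>u x + v x\<bar> \<le> B + C"
    using B by (auto intro: order_trans[OF abs_triangle_ineq] add_mono)
  moreover have "\<forall>x\<in>mms_space. \<forall>y\<in>mms_space. mms_le x y \<longrightarrow> u x + v x \<le> u y + v y"
    using assms by (auto simp: monotone_test_def intro!: add_mono)
  ultimately show ?thesis
    using assms by (auto simp: monotone_test_def ghp_continuous_iff_tendsto intro!: tendsto_add)
qed

lemma monotone_test_max:
  assumes "monotone_test u" "monotone_test v"
  shows "monotone_test (\<lambda>x. max (u x) (v x))"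
proof -
  obtain B C where B: "\<forall>x\<in>mms_space. \<bar>u x\<bar> \<le> B" "\<forall>x\<in>mms_space. \<bar>v x\<bar> \<le> C"
    using assms by (auto simp: monotone_test_def)
  have "\<bar>max (u x) (v x)\<bar> \<le> max B C" if "x \<in> mms_space" for x
    using B[THEN bspec, OF that] by linarith
  moreover have "max (u x) (v x) \<le> max (u y) (v y)" if "x \<in> mms_space" "y \<in> mms_space" "mms_le x y" for x y
    using assms that by (intro max.mono) (auto simp: monotone_test_def)
  moreover have "ghp_continuous (\<lambda>x. max (u x) (v x))"
    using assms by (auto simp: monotone_test_def ghp_continuous_iff_tendsto intro!: tendsto_max)
  ultimately show ?thesis
    by (rule_tac monotone_testI)
qed

lemma monotone_test_mult:
  assumes "monotone_test u" "0 \<le> c"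
  shows "monotone_test (\<lambda>x. c * u x)"
proof -
  obtain B where B: "\<forall>x\<in>mms_space. \<bar>u x\<bar> \<le> B"
    using assms by (auto simp: monotone_test_def)
  have "\<forall>x\<in>mms_space. \<bar>c * u x\<bar> \<le> c * B"
    using B assms(2) by (auto simp: abs_mult intro!: mult_left_mono)
  then show ?thesis
    using assms by (auto simp: monotone_test_def ghp_continuous_iff_tendsto intro!: tendsto_mult_left mult_left_mono)
qed

lemma monotone_test_scale:
  assumes "monotone_test u" "a > 0" "b > 0"
  shows "monotone_test (\<lambda>x. u (scale_mms a b x))"
proof -
  obtain B where "\<forall>x\<in>mms_space. \<bar>u x\<bar> \<le> B"
    using assms(1) by (rule monotone_test_bounded)
  then show ?thesis
    using assms monotone_testD[OF assms(1)] scale_mms_in_space mms_le_scale_cong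
    by (intro monotone_testI[of _ B] ghp_continuous_scale) (simp_all add: less_imp_le)
qed

lemma monotone_test_profile_level: "\<theta> \<in> profiles \<Longrightarrow> monotone_test (profile_level \<theta>)"
  by (rule monotone_testI[of _ 1])
    (simp_all add: ghp_continuous_profile_level profile_level_increasing profile_level_nonneg profile_level_le_1)

definition test_difference :: "(mms \<Rightarrow> real) \<Rightarrow> bool" where
  "test_difference h \<longleftrightarrow> (\<exists>u v. monotone_test u \<and> monotone_test v \<and> h = (\<lambda>x. u x - v x))"

lemma test_differenceI: "monotone_test u \<Longrightarrow> monotone_test v \<Longrightarrow> h = (\<lambda>x. u x - v x) \<Longrightarrow> test_difference h"
  by (auto simp: test_difference_def)

lemma test_difference_monotone: "monotone_test u \<Longrightarrow> test_difference u"
  by (rule test_differenceI[OF _ monotone_test_const[of 0]]) auto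

lemma test_difference_diff:
  assumes "test_difference f" "test_difference g"
  shows "test_difference (\<lambda>x. f x - g x)"
proof -
  obtain u v u' v' where *: "monotone_test u" "monotone_test v" "monotone_test u'" "monotone_test v'"
    "f = (\<lambda>x. u x - v x)" "g = (\<lambda>x. u' x - v' x)"
    using assms by (auto simp: test_difference_def)
  show ?thesis
    by (rule test_differenceI[OF monotone_test_add[OF *(1,4)] monotone_test_add[OF *(2,3)]])
      (auto simp: *(5,6))
qed

text \<open>The maximum of \<open>u - v\<close> and \<open>u' - v'\<close> is
  \<open>max (u + v') (u' + v)\<close> minus \<open>v + v'\<close>, and maxima and sums of
  increasing functions are increasing.\<close>

lemma test_difference_max:
  assumes "test_difference f" "test_difference g"
  shows "test_difference (\<lambda>x. max (f x) (g x))"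
proof -
  obtain u v u' v' where *: "monotone_test u" "monotone_test v" "monotone_test u'" "monotone_test v'"
    "f = (\<lambda>x. u x - v x)" "g = (\<lambda>x. u' x - v' x)"
    using assms by (auto simp: test_difference_def)
  show ?thesis
    by (rule test_differenceI[OF monotone_test_max[OF monotone_test_add[OF *(1,4)] monotone_test_add[OF *(3,2)]]
          monotone_test_add[OF *(2,4)]])
      (auto simp: *(5,6) max_def)
qed

lemma test_difference_min:
  assumes "test_difference f" "test_difference g"
  shows "test_difference (\<lambda>x. min (f x) (g x))"
proof -
  have const: "test_difference (\<lambda>_. 0)"
    by (intro test_difference_monotone monotone_test_const)
  have "test_difference (\<lambda>x. 0 - max (0 - f x) (0 - g x))"
    using assms const by (intro test_difference_diff test_difference_max)
  moreover have "(\<lambda>x. 0 - max (0 - f x) (0 - g x)) = (\<lambda>x. min (f x) (g x))"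
    by (auto simp: max_def min_def)
  ultimately show ?thesis
    by simp
qed

lemma test_difference_mult:
  assumes "test_difference f" "0 \<le> c"
  shows "test_difference (\<lambda>x. c * f x)"
proof -
  obtain u v where *: "monotone_test u" "monotone_test v" "f = (\<lambda>x. u x - v x)"
    using assms by (auto simp: test_difference_def)
  show ?thesis
    by (rule test_differenceI[OF monotone_test_mult[OF *(1) assms(2)] monotone_test_mult[OF *(2) assms(2)]])
      (auto simp: *(3) right_diff_distrib)
qed

lemma test_difference_Max:
  assumes "finite I" "I \<noteq> {}" "\<And>i. i \<in> I \<Longrightarrow> test_difference (h i)"
  shows "test_difference (\<lambda>x. Max ((\<lambda>i. h i x) ` I))"
  using assms
proof (induction I rule: finite_ne_induct)
  case (insert i I)
  then show ?case
    using test_difference_max[of "h i" "\<lambda>x. Max ((\<lambda>i. h i x) ` I)"] by simp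
qed simp

text \<open>A localized plateau of height \<open>q\<close>. With the profiles of
  \<open>profile_level_localizes\<close> the minimum is 1 at the centre, and it can be positive only
  inside the prescribed ball.\<close>

definition bump :: "real \<times> profile \<times> profile set \<Rightarrow> mms \<Rightarrow> real" where
  "bump \<beta> x = (case \<beta> of (q, \<theta>, \<Theta>) \<Rightarrow>
     q * Min (insert (profile_level \<theta> x) ((\<lambda>\<theta>'. 1 - profile_level \<theta>' x) ` \<Theta>)))"

definition bump_parameters :: "(real \<times> profile \<times> profile set) set" where
  "bump_parameters = (\<rat> \<inter> {0..}) \<times> profiles \<times> {\<Theta>. finite \<Theta> \<and> \<Theta> \<subseteq> profiles}"

lemma countable_bump_parameters: "countable bump_parameters"
  unfolding bump_parameters_def
  using countable_profiles countable_Collect_finite_subset[OF countable_profiles]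
  by (auto intro!: countable_SIGMA countable_Int1 countable_rat)

lemma test_difference_bump:
  assumes "\<beta> \<in> bump_parameters"
  shows "test_difference (bump \<beta>)"
proof -
  obtain q \<theta> \<Theta> where \<beta>: "\<beta> = (q, \<theta>, \<Theta>)" and q: "0 \<le> q" and \<theta>: "\<theta> \<in> profiles"
    and \<Theta>: "finite \<Theta>" "\<Theta> \<subseteq> profiles"
    using assms by (auto simp: bump_parameters_def)
  have "test_difference (\<lambda>x. Min (insert (profile_level \<theta> x) ((\<lambda>\<theta>'. 1 - profile_level \<theta>' x) ` \<Theta>)))"
    using \<Theta>
  proof (induction \<Theta> rule: finite_induct)
    case empty
    then show ?case
      using \<theta> by (simp add: test_difference_monotone monotone_test_profile_level)
  next
    case (insert \<theta>' \<Theta>)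
    have "test_difference (\<lambda>x. 1 - profile_level \<theta>' x)"
      using insert.prems by (intro test_difference_diff test_difference_monotone
          monotone_test_const monotone_test_profile_level) auto
    then have "test_difference (\<lambda>x. min (1 - profile_level \<theta>' x)
        (Min (insert (profile_level \<theta> x) ((\<lambda>\<theta>'. 1 - profile_level \<theta>' x) ` \<Theta>))))"
      using insert by (intro test_difference_min) auto
    then show ?case
      using insert.hyps(1) by (simp add: insert_commute[of "profile_level \<theta> _"])
  qed
  then show ?thesis
    using test_difference_mult[OF _ q] by (simp add: bump_def[abs_def] \<beta>)
qed

lemma bump_nonneg:
  assumes "\<beta> \<in> bump_parameters"
  shows "0 \<le> bump \<beta> x"
proof -
  obtain q \<theta> \<Theta> where \<beta>: "\<beta> = (q, \<theta>, \<Theta>)" and q: "0 \<le> q" and \<Theta>: "finite \<Theta>"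
    using assms by (auto simp: bump_parameters_def)
  have "0 \<le> Min (insert (profile_level \<theta> x) ((\<lambda>\<theta>'. 1 - profile_level \<theta>' x) ` \<Theta>))"
    using \<Theta> by (simp add: profile_level_nonneg profile_level_le_1)
  then show ?thesis
    using q by (simp add: bump_def \<beta>)
qed

lemma ex_bump_below:
  assumes f: "ghp_continuous f" "\<And>x. x \<in> mms_space \<Longrightarrow> 0 \<le> f x"
    and x: "x \<in> mms_space" and c: "c < f x"
  shows "\<exists>\<beta>\<in>bump_parameters. (\<forall>y\<in>mms_space. bump \<beta> y \<le> f y) \<and> c < bump \<beta> x"
proof -
  \<comment> \<open>The alternative \<open>q = 0\<close> covers \<open>f x = 0\<close>, where no
    nonnegative rational lies strictly below \<open>f x\<close>.\<close>
  obtain q where q: "q \<in> \<rat>" "0 \<le> q" "c < q" "q < f x \<or> q = 0"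
  proof (cases "c < 0")
    case True
    then show thesis
      by (intro that[of 0]) auto
  next
    case False
    then show thesis
      using rational_between[OF c] by (metis not_less order.trans less_imp_le that)
  qed
  have "\<exists>r>0. \<forall>y\<in>mms_space. ghp_dist x y < r \<longrightarrow> q \<le> f y"
    using q(4)
  proof
    assume "q < f x"
    then have "eventually (\<lambda>y. q < f y) (ghp_nhds x)"
      using order_tendstoD(1)[OF ghp_continuous_tendsto[OF f(1) x]] by auto
    then show ?thesis
      by (auto simp: eventually_ghp_nhds intro: less_imp_le)
  qed (use f(2) in \<open>auto intro: exI[of _ 1]\<close>)
  then obtain r where r: "r > 0" "\<And>y. y \<in> mms_space \<Longrightarrow> ghp_dist x y < r \<Longrightarrow> q \<le> f y"
    by blast
  show ?thesis
  proof (rule profile_level_localizes[OF x r(1)])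
    fix \<theta> \<Theta> assume \<theta>: "\<theta> \<in> profiles" "\<Theta> \<subseteq> profiles" "finite \<Theta>"
      "profile_level \<theta> x = 1" "\<And>\<theta>'. \<theta>' \<in> \<Theta> \<Longrightarrow> profile_level \<theta>' x = 0"
      "\<And>y. y \<in> mms_space \<Longrightarrow> profile_level \<theta> y > 0 \<Longrightarrow> (\<And>\<theta>'. \<theta>' \<in> \<Theta> \<Longrightarrow> profile_level \<theta>' y < 1) \<Longrightarrow>
        ghp_dist x y < r"
    let ?\<beta> = "(q, \<theta>, \<Theta>)"
    let ?m = "\<lambda>y. Min (insert (profile_level \<theta> y) ((\<lambda>\<theta>'. 1 - profile_level \<theta>' y) ` \<Theta>))"
    have \<beta>: "?\<beta> \<in> bump_parameters"
      using q \<theta>(1-3) by (auto simp: bump_parameters_def)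
    have "?m x = 1"
      using \<theta>(3-5) by (intro Min_eqI) auto
    then have "c < bump ?\<beta> x"
      using q(3) by (simp add: bump_def)
    moreover have "bump ?\<beta> y \<le> f y" if y: "y \<in> mms_space" for y
    proof (cases "?m y > 0")
      case True
      then have "profile_level \<theta> y > 0" "\<And>\<theta>'. \<theta>' \<in> \<Theta> \<Longrightarrow> profile_level \<theta>' y < 1"
        using \<theta>(3) by auto
      then have "q \<le> f y"
        using r(2) \<theta>(6) y by blast
      moreover have "?m y \<le> profile_level \<theta> y"
        using \<theta>(3) by (intro Min_le) auto
      then have "q * ?m y \<le> q * 1"
        using profile_level_le_1[of \<theta> y] q(2) by (intro mult_left_mono) linarith+
      ultimately show ?thesis
        by (simp add: bump_def)
    next
      case False
      then have "q * ?m y \<le> 0"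
        using q(2) by (intro mult_nonneg_nonpos) auto
      then show ?thesis
        using f(2)[OF y] by (simp add: bump_def)
    qed
    ultimately show ?thesis
      using \<beta> by blast
  qed
qed

section \<open>Convergence in distribution from increasing test functions\<close>

lemma measurable_scale_mms:
  assumes "a > 0" "b > 0"
  shows "scale_mms a b \<in> measurable GHP GHP"
proof -
  have "scale_mms a b -` U \<inter> space GHP \<in> sets GHP" if U: "ghp_open U" for U
  proof (rule ghp_open_sets)
    show "ghp_open (scale_mms a b -` U \<inter> space GHP)"
      unfolding ghp_open_def space_GHP
    proof (intro conjI ballI)
      fix x assume x: "x \<in> scale_mms a b -` U \<inter> mms_space"
      then have "eventually (\<lambda>y. y \<in> U) (ghp_nhds (scale_mms a b x))"
        using U by (auto simp: eventually_ghp_nhds ghp_open_def)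
      then have "eventually (\<lambda>y. scale_mms a b y \<in> U) (ghp_nhds x)"
        using filterlim_scale_mms[of x a b] x assms by (auto simp: filterlim_iff)
      then show "\<exists>r>0. \<forall>y\<in>mms_space. ghp_dist x y < r \<longrightarrow> y \<in> scale_mms a b -` U \<inter> mms_space"
        by (auto simp: eventually_ghp_nhds)
    qed auto
  qed
  then have "scale_mms a b \<in> measurable GHP (sigma mms_space {U. ghp_open U})"
    using assms by (intro measurable_measure_of) (auto simp: ghp_open_def space_GHP intro!: scale_mms_in_space)
  then show ?thesis
    by (simp add: GHP_def)
qed

context prob_space
begin

lemma integrable_ghp_continuous:
  assumes "Y \<in> measurable M GHP" "ghp_continuous f" "\<forall>x\<in>mms_space. \<bar>f x\<bar> \<le> B"
  shows "integrable M (\<lambda>\<omega>. f (Y \<omega>))"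
proof (rule integrable_const_bound[of _ B])
  show "AE \<omega> in M. norm (f (Y \<omega>)) \<le> B"
    using measurable_space[OF assms(1)] assms(3) by (auto simp: space_GHP)
  show "(\<lambda>\<omega>. f (Y \<omega>)) \<in> borel_measurable M"
    using measurable_compose[OF assms(1) ghp_continuous_measurable[OF assms(2)]] .
qed

lemma integrable_monotone_test:
  assumes "Y \<in> measurable M GHP" "monotone_test u"
  shows "integrable M (\<lambda>\<omega>. u (Y \<omega>))"
  using assms(2) integrable_ghp_continuous[OF assms(1)] unfolding monotone_test_def by blast

text \<open>A discrete layer-cake formula: \<open>n * w\<close> is within 1 of the number of grid
  points \<open>i / n\<close> below \<open>w\<close>, and the expectation of that number is a finite
  sum of tail probabilities. The error \<open>\<delta>\<close> enters \<open>n\<close> times and is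
  divided by \<open>n\<close> again.\<close>

lemma expectation_le_of_tail_le:
  fixes U V :: "'a \<Rightarrow> real"
  assumes [measurable]: "U \<in> borel_measurable M" "V \<in> borel_measurable M"
    and U: "\<And>\<omega>. \<omega> \<in> space M \<Longrightarrow> 0 \<le> U \<omega> \<and> U \<omega> \<le> 1"
    and V: "\<And>\<omega>. \<omega> \<in> space M \<Longrightarrow> 0 \<le> V \<omega> \<and> V \<omega> \<le> 1"
    and tail: "\<And>t. prob {\<omega>\<in>space M. t < U \<omega>} \<le> prob {\<omega>\<in>space M. t < V \<omega>} + \<delta>"
  shows "expectation U \<le> expectation V + \<delta>"
proof (rule field_le_epsilon)
  fix \<epsilon> :: real assume "\<epsilon> > 0"
  then obtain n :: nat where n: "n > 0" "1 / real n < \<epsilon>"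
    using ex_inverse_of_nat_less by (metis inverse_eq_divide)
  define S where "S w = (\<Sum>i\<in>{1..n}. if real i / real n < w then 1 else 0 :: real)" for w
  have S: "real n * w - 1 \<le> S w \<and> S w \<le> real n * w" if w: "0 \<le> w" "w \<le> 1" for w
  proof -
    have nw: "0 \<le> real n * w" "real n * w \<le> real n"
      using w by (auto simp: mult_left_le)
    have "i \<in> {1..n} \<and> real i / real n < w \<longleftrightarrow> i \<in> {1..<nat \<lceil>real n * w\<rceil>}" for i
    proof -
      have "real i / real n < w \<longleftrightarrow> real i < real n * w"
        using n(1) by (simp add: divide_less_eq mult.commute)
      also have "\<dots> \<longleftrightarrow> i < nat \<lceil>real n * w\<rceil>"
        by linarith
      finally show ?thesis
        using nw(2) by auto linarith
    qed
    then have "{i\<in>{1..n}. real i / real n < w} = {1..<nat \<lceil>real n * w\<rceil>}"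
      by blast
    moreover have "S w = real (card {i\<in>{1..n}. real i / real n < w})"
      unfolding S_def by (simp add: sum.If_cases Int_def)
    \<comment> \<open>Truncated subtraction matters at \<open>w = 0\<close>, where the count is
      0.\<close>
    ultimately have "S w = real (nat \<lceil>real n * w\<rceil> - 1)"
      by simp
    then show ?thesis
      using nw by linarith
  qed
  have int: "integrable M U" "integrable M V"
    using U V by (auto intro!: integrable_const_bound[of _ 1])
  have E: "expectation (\<lambda>\<omega>. S (W \<omega>)) = (\<Sum>i\<in>{1..n}. prob {\<omega>\<in>space M. real i / real n < W \<omega>})"
    and intS: "integrable M (\<lambda>\<omega>. S (W \<omega>))"
    if [measurable]: "W \<in> borel_measurable M" for W
  proof -
    have *: "S (W \<omega>) = (\<Sum>i\<in>{1..n}. indicator {\<omega>\<in>space M. real i / real n < W \<omega>} \<omega>)" if "\<omega> \<in> space M" for \<omega>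
      unfolding S_def using that by (intro sum.cong) (auto simp: indicator_def)
    have i: "integrable M (\<lambda>\<omega>. \<Sum>i\<in>{1..n}. indicator {\<omega>\<in>space M. real i / real n < W \<omega>} \<omega> :: real)"
      by (intro Bochner_Integration.integrable_sum integrable_real_indicator) (auto simp: emeasure_eq_measure)
    show "integrable M (\<lambda>\<omega>. S (W \<omega>))"
      using i * by (subst Bochner_Integration.integrable_cong[OF refl *]) auto
    have "expectation (\<lambda>\<omega>. S (W \<omega>)) = expectation (\<lambda>\<omega>. \<Sum>i\<in>{1..n}. indicator {\<omega>\<in>space M. real i / real n < W \<omega>} \<omega>)"
      using * by (intro Bochner_Integration.integral_cong) auto
    also have "\<dots> = (\<Sum>i\<in>{1..n}. prob {\<omega>\<in>space M. real i / real n < W \<omega>})"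
      by (subst Bochner_Integration.integral_sum) (auto simp: emeasure_eq_measure intro!: integrable_real_indicator)
    finally show "expectation (\<lambda>\<omega>. S (W \<omega>)) = (\<Sum>i\<in>{1..n}. prob {\<omega>\<in>space M. real i / real n < W \<omega>})" .
  qed
  have "real n * expectation U - 1 = expectation (\<lambda>\<omega>. real n * U \<omega> - 1)"
    using int by (simp add: prob_space)
  also have "\<dots> \<le> expectation (\<lambda>\<omega>. S (U \<omega>))"
    using int intS U S by (intro integral_mono) auto
  also have "\<dots> \<le> (\<Sum>i\<in>{1..n}. prob {\<omega>\<in>space M. real i / real n < V \<omega>} + \<delta>)"
    unfolding E[OF assms(1)] using tail by (intro sum_mono)
  also have "\<dots> = expectation (\<lambda>\<omega>. S (V \<omega>)) + real n * \<delta>"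
    unfolding E[OF assms(2)] by (simp add: sum.distrib)
  also have "expectation (\<lambda>\<omega>. S (V \<omega>)) \<le> expectation (\<lambda>\<omega>. real n * V \<omega>)"
    using int intS V S by (intro integral_mono) auto
  finally have "real n * expectation U \<le> real n * (expectation V + \<delta> + 1 / real n)"
    using n(1) by (simp add: distrib_left)
  then have "expectation U \<le> expectation V + \<delta> + 1 / real n"
    using n(1) by simp
  then show "expectation U \<le> expectation V + \<delta> + \<epsilon>"
    using n(2) by linarith
qed

text \<open>Under the limit law some finite maximum \<open>g m\<close> of bumps below
  \<open>f\<close> already has expectation above \<open>c\<close>. It is a difference of monotone
  tests, so its expectations converge, and those of \<open>f\<close> dominate them.\<close>

lemma eventually_expectation_gt:
  assumes Y: "\<And>n. n \<ge> 1 \<Longrightarrow> Y n \<in> measurable M GHP" and Y': "Y' \<in> measurable M GHP"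
    and conv: "\<And>u. monotone_test u \<Longrightarrow> (\<lambda>n. expectation (\<lambda>\<omega>. u (Y n \<omega>))) \<longlonglongrightarrow> expectation (\<lambda>\<omega>. u (Y' \<omega>))"
    and f: "ghp_continuous f" "\<And>x. x \<in> mms_space \<Longrightarrow> 0 \<le> f x" "\<And>x. x \<in> mms_space \<Longrightarrow> f x \<le> B"
    and c: "c < expectation (\<lambda>\<omega>. f (Y' \<omega>))"
  shows "eventually (\<lambda>n. c < expectation (\<lambda>\<omega>. f (Y n \<omega>))) sequentially"
proof -
  define H where "H = {\<beta>\<in>bump_parameters. \<forall>y\<in>mms_space. bump \<beta> y \<le> f y}"
  have in_space: "Y' \<omega> \<in> mms_space" if "\<omega> \<in> space M" for \<omega>
    using measurable_space[OF Y' that] by (simp add: space_GHP)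
  have dense: "\<exists>\<beta>\<in>H. t < bump \<beta> x" if "x \<in> mms_space" "t < f x" for x t
    using ex_bump_below[OF f(1,2) that] unfolding H_def by blast
  have H: "countable H" "H \<noteq> {}"
  proof -
    show "countable H"
      using countable_bump_parameters by (rule countable_subset[rotated]) (auto simp: H_def)
    obtain \<omega> where "\<omega> \<in> space M"
      using not_empty by blast
    then show "H \<noteq> {}"
      using dense[OF in_space, of \<omega> "f (Y' \<omega>) - 1"] by auto
  qed
  define h where "h i = bump (from_nat_into H i)" for i :: nat
  have h: "test_difference (h i)" "\<And>x. 0 \<le> h i x" "\<And>x. x \<in> mms_space \<Longrightarrow> h i x \<le> f x" for i
    using from_nat_into[OF H(2), of i] test_difference_bump bump_nonneg by (auto simp: H_def h_def)
  define g where "g m x = Max ((\<lambda>i. h i x) ` {..m})" for m :: nat and x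
  have g_test: "test_difference (g m)" for m
    unfolding g_def[abs_def] using h(1) by (intro test_difference_Max) auto
  have g_le: "g m x \<le> f x" if "x \<in> mms_space" for m x
    using h(3) that by (auto simp: g_def)
  have g_ge: "h i x \<le> g m x" if "i \<le> m" for i m x
    using that by (auto simp: g_def intro!: Max_ge)
  have g_nonneg: "0 \<le> g m x" for m x
    using g_ge[of 0 m x] h(2)[of 0 x] by linarith
  have g_lim: "(\<lambda>m. g m x) \<longlonglongrightarrow> f x" if x: "x \<in> mms_space" for x
  proof (rule order_tendstoI)
    fix t assume "t < f x"
    then obtain \<beta> where \<beta>: "\<beta> \<in> H" "t < bump \<beta> x"
      using dense[OF x] by blast
    obtain i where i: "from_nat_into H i = \<beta>"
      using from_nat_into_surj[OF H(1) \<beta>(1)] by blast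
    have "t < g m x" if "m \<ge> i" for m
      using g_ge[OF that, of x] \<beta>(2) i by (simp add: h_def)
    then show "eventually (\<lambda>m. t < g m x) sequentially"
      by (auto simp: eventually_sequentially)
  next
    fix t assume "f x < t"
    then show "eventually (\<lambda>m. g m x < t) sequentially"
      by (intro always_eventually allI le_less_trans[OF g_le[OF x]])
  qed
  have test: "ghp_continuous (g m)" for m
  proof -
    obtain u v where "monotone_test u" "monotone_test v" "g m = (\<lambda>x. u x - v x)"
      using g_test[of m] by (auto simp: test_difference_def)
    then show ?thesis
      by (auto simp: monotone_test_def ghp_continuous_iff_tendsto intro!: tendsto_diff)
  qed
  have g_bound: "\<forall>x\<in>mms_space. \<bar>g m x\<bar> \<le> B" for m
  proof
    fix x assume x: "x \<in> mms_space"
    show "\<bar>g m x\<bar> \<le> B"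
      using g_nonneg[of m x] g_le[OF x, of m] f(3)[OF x] by linarith
  qed
  have "(\<lambda>m. expectation (\<lambda>\<omega>. g m (Y' \<omega>))) \<longlonglongrightarrow> expectation (\<lambda>\<omega>. f (Y' \<omega>))"
  proof (rule integral_dominated_convergence[where w = "\<lambda>_. B"])
    show "(\<lambda>\<omega>. f (Y' \<omega>)) \<in> borel_measurable M"
      using measurable_compose[OF Y' ghp_continuous_measurable[OF f(1)]] .
    show "(\<lambda>\<omega>. g m (Y' \<omega>)) \<in> borel_measurable M" for m
      using measurable_compose[OF Y' ghp_continuous_measurable[OF test]] .
    show "AE \<omega> in M. (\<lambda>m. g m (Y' \<omega>)) \<longlonglongrightarrow> f (Y' \<omega>)"
      using g_lim in_space by auto
    show "AE \<omega> in M. norm (g m (Y' \<omega>)) \<le> B" for m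
      using g_bound in_space by auto
  qed auto
  from order_tendstoD(1)[OF this c] obtain m where m: "c < expectation (\<lambda>\<omega>. g m (Y' \<omega>))"
    by (auto simp: eventually_sequentially)
  have g_int: "integrable M (\<lambda>\<omega>. g m (Z \<omega>))" if "Z \<in> measurable M GHP" for Z
    using integrable_ghp_continuous[OF that test g_bound] .
  obtain u v where uv: "monotone_test u" "monotone_test v" "g m = (\<lambda>x. u x - v x)"
    using g_test[of m] by (auto simp: test_difference_def)
  have diff: "expectation (\<lambda>\<omega>. g m (Z \<omega>)) = expectation (\<lambda>\<omega>. u (Z \<omega>)) - expectation (\<lambda>\<omega>. v (Z \<omega>))"
    if "Z \<in> measurable M GHP" for Z
    unfolding uv(3) using integrable_monotone_test[OF that] uv(1,2) by (intro Bochner_Integration.integral_diff)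
  have "eventually (\<lambda>n. c < expectation (\<lambda>\<omega>. u (Y n \<omega>)) - expectation (\<lambda>\<omega>. v (Y n \<omega>))) sequentially"
    using m unfolding diff[OF Y'] by (intro order_tendstoD(1)[OF tendsto_diff[OF conv[OF uv(1)] conv[OF uv(2)]]])
  then show ?thesis
    using eventually_ge_at_top[of 1]
  proof eventually_elim
    case (elim n)
    have "expectation (\<lambda>\<omega>. g m (Y n \<omega>)) \<le> expectation (\<lambda>\<omega>. f (Y n \<omega>))"
    proof (rule integral_mono)
      show "integrable M (\<lambda>\<omega>. f (Y n \<omega>))"
        using f by (intro integrable_ghp_continuous[OF Y[OF elim(2)] f(1), of B]) auto
      show "g m (Y n \<omega>) \<le> f (Y n \<omega>)" if "\<omega> \<in> space M" for \<omega>
        using measurable_space[OF Y[OF elim(2)] that] by (intro g_le) (simp add: space_GHP)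
    qed (rule g_int[OF Y[OF elim(2)]])
    then show ?case
      using elim diff[OF Y[OF elim(2)]] by simp
  qed
qed

text \<open>Differences of monotone tests form a vector lattice, and countably many of them suffice to
approximate any bounded continuous function from below; hence convergence in distribution only has
to be checked against monotone tests.\<close>
lemma conv_distr_of_monotone_tests:
  assumes Y: "\<And>n. n \<ge> 1 \<Longrightarrow> Y n \<in> measurable M GHP" and Y': "Y' \<in> measurable M GHP"
    and conv: "\<And>u. monotone_test u \<Longrightarrow> (\<lambda>n. expectation (\<lambda>\<omega>. u (Y n \<omega>))) \<longlonglongrightarrow> expectation (\<lambda>\<omega>. u (Y' \<omega>))"
  shows "conv_distr M Y Y'"
  unfolding conv_distr_def
proof (intro allI impI, elim conjE exE)
  fix f B assume B: "\<forall>x\<in>mms_space. \<bar>f x\<bar> \<le> B" and f: "ghp_continuous f"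
  have E: "expectation (\<lambda>\<omega>. f (Z \<omega>) + B) = expectation (\<lambda>\<omega>. f (Z \<omega>)) + B"
    "expectation (\<lambda>\<omega>. B - f (Z \<omega>)) = B - expectation (\<lambda>\<omega>. f (Z \<omega>))"
    if "Z \<in> measurable M GHP" for Z
    using integrable_ghp_continuous[OF that f B] by (simp_all add: prob_space)
  \<comment> \<open>The one-sided lemma wants nonnegative functions: \<open>f + B\<close> gives the
    lower bound and \<open>B - f\<close> the upper one.\<close>
  have cont: "ghp_continuous (\<lambda>x. f x + B)" "ghp_continuous (\<lambda>x. B - f x)"
    using f by (auto simp: ghp_continuous_iff_tendsto intro!: tendsto_intros)
  have b: "0 \<le> f x + B" "f x + B \<le> 2 * B" "0 \<le> B - f x" "B - f x \<le> 2 * B" if "x \<in> mms_space" for x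
    using B[rule_format, OF that] by linarith+
  show "(\<lambda>n. expectation (\<lambda>\<omega>. f (Y n \<omega>))) \<longlonglongrightarrow> expectation (\<lambda>\<omega>. f (Y' \<omega>))"
  proof (rule order_tendstoI)
    fix t assume "t < expectation (\<lambda>\<omega>. f (Y' \<omega>))"
    then have "eventually (\<lambda>n. t + B < expectation (\<lambda>\<omega>. f (Y n \<omega>) + B)) sequentially"
      using E[OF Y'] b by (intro eventually_expectation_gt[OF Y Y' conv cont(1), where B = "2 * B"]) simp_all
    then show "eventually (\<lambda>n. t < expectation (\<lambda>\<omega>. f (Y n \<omega>))) sequentially"
      using eventually_ge_at_top[of 1] by eventually_elim (use E[OF Y] in auto)
  next
    fix t assume "expectation (\<lambda>\<omega>. f (Y' \<omega>)) < t"
    then have "eventually (\<lambda>n. B - t < expectation (\<lambda>\<omega>. B - f (Y n \<omega>))) sequentially"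
      using E[OF Y'] b by (intro eventually_expectation_gt[OF Y Y' conv cont(2), where B = "2 * B"]) simp_all
    then show "eventually (\<lambda>n. expectation (\<lambda>\<omega>. f (Y n \<omega>)) < t) sequentially"
      using eventually_ge_at_top[of 1] by eventually_elim (use E[OF Y] in auto)
  qed
qed

end

text \<open>If no relative window works, there are bad pairs at arbitrarily large \<open>n\<close>
  with relative offset below any positive bound. Spread along a sparse sequence they form one shift
  of order \<open>o(n)\<close> that contradicts tameness.\<close>

lemma tame_uniform:
  assumes "tame a" "\<eta> > 0"
  obtains \<gamma> n0 where "\<gamma> > 0" "\<And>n m. n \<ge> n0 \<Longrightarrow> \<bar>real m - real n\<bar> \<le> \<gamma> * real n \<Longrightarrow> \<bar>a m / a n - 1\<bar> < \<eta>"
proof (rule ccontr)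
  assume contra: "\<not> thesis"
  define bad where "bad n m \<longleftrightarrow> \<not> \<bar>a m / a n - 1\<bar> < \<eta>" for n m
  have "\<exists>n\<ge>l. \<exists>m. \<bar>real m - real n\<bar> \<le> real n / real (Suc j) \<and> bad n m" for j l :: nat
  proof (rule ccontr)
    assume "\<not> ?thesis"
    then show False
      using contra that[of "1 / real (Suc j)" l] by (force simp: bad_def)
  qed
  then have "\<forall>j l. \<exists>n. l \<le> n \<and> (\<exists>m. \<bar>real m - real n\<bar> \<le> real n / real (Suc j) \<and> bad n m)"
    by blast
  then obtain N where N: "\<And>j l. l \<le> N j l" "\<And>j l. \<exists>m. \<bar>real m - real (N j l)\<bar> \<le> real (N j l) / real (Suc j) \<and> bad (N j l) m"
    by metis
  \<comment> \<open>Each new index is sought beyond the previous one, with a smaller tolerance, so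
    \<open>r\<close> is strictly increasing and the relative offsets vanish.\<close>
  define r where "r = rec_nat (N 0 0) (\<lambda>j n. N (Suc j) (Suc n))"
  have r_Suc: "r (Suc j) = N (Suc j) (Suc (r j))" and r_0: "r 0 = N 0 0" for j
    by (simp_all add: r_def)
  have r_mono: "strict_mono r"
    unfolding strict_mono_Suc_iff using N(1) r_Suc by (metis Suc_le_lessD)
  have "\<exists>m. \<bar>real m - real (r j)\<bar> \<le> real (r j) / real (Suc j) \<and> bad (r j) m" for j
  proof (cases j)
    case 0
    then show ?thesis
      using N(2)[of 0 0] by (simp add: r_0)
  next
    case (Suc i)
    then show ?thesis
      using N(2)[of "Suc i" "Suc (r i)"] by (simp add: r_Suc)
  qed
  then obtain m where m: "\<And>j. \<bar>real (m j) - real (r j)\<bar> \<le> real (r j) / real (Suc j)" "\<And>j. bad (r j) (m j)"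
    by metis
  \<comment> \<open>Zero shift off the sparse sequence; on it, the shift leads to the bad
    partner.\<close>
  define k where "k n = (if n \<in> range r then int (m (inv r n)) - int n else 0)" for n
  have inj: "inj r"
    using r_mono by (rule strict_mono_imp_inj_on)
  have k: "k (r j) = int (m j) - int (r j)" for j
    using inj by (simp add: k_def)
  have "(\<lambda>n. real_of_int (k n) / real n) \<longlonglongrightarrow> 0"
  proof (rule LIMSEQ_I)
    fix \<epsilon> :: real assume \<epsilon>: "\<epsilon> > 0"
    then obtain j0 :: nat where j0: "1 / real (Suc j0) < \<epsilon>"
      using reals_Archimedean by (metis inverse_eq_divide)
    have "norm (real_of_int (k n) / real n - 0) < \<epsilon>" if n: "n \<ge> r j0" for n
    proof (cases "n \<in> range r")
      case True
      then obtain j where j: "n = r j"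
        by blast
      have "j0 \<le> j"
        using n r_mono by (simp add: j strict_mono_less_eq)
      have "\<bar>real_of_int (k n)\<bar> \<le> real n / real (Suc j)"
        using m(1)[of j] by (simp add: j k)
      then have "\<bar>real_of_int (k n)\<bar> / real n \<le> 1 / real (Suc j)"
        by (cases "n = 0") (auto simp: divide_simps mult.commute)
      also have "\<dots> \<le> 1 / real (Suc j0)"
        using \<open>j0 \<le> j\<close> by (simp add: frac_le)
      finally show ?thesis
        using j0 by simp
    qed (use \<epsilon> in \<open>simp add: k_def\<close>)
    then show "\<exists>no. \<forall>n\<ge>no. norm (real_of_int (k n) / real n - 0) < \<epsilon>"
      by blast
  qed
  then have "(\<lambda>n. a (nat (int n + k n)) / a n) \<longlonglongrightarrow> 1"
    using assms(1) unfolding tame_def by blast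
  then have "(\<lambda>j. a (nat (int (r j) + k (r j))) / a (r j)) \<longlonglongrightarrow> 1"
    using LIMSEQ_subseq_LIMSEQ[OF _ r_mono] by (fastforce simp: o_def)
  then have "(\<lambda>j. a (m j) / a (r j)) \<longlonglongrightarrow> 1"
    by (simp add: k)
  from tendstoD[OF this assms(2)] obtain j where "\<bar>a (m j) / a (r j) - 1\<bar> < \<eta>"
    by (auto simp: eventually_sequentially dist_real_def)
  then show False
    using m(2)[of j] by (simp add: bad_def)
qed

section \<open>Comparison with a random index\<close>

locale monotone_random_index = prob_space M
  for M :: "'w measure" +
  fixes X :: "nat \<Rightarrow> 'w \<Rightarrow> mms" and Xinf :: "'w \<Rightarrow> mms" and N :: "nat \<Rightarrow> 'w \<Rightarrow> nat"
  assumes rv_X: "\<And>n. n \<ge> 1 \<Longrightarrow> X n \<in> measurable M GHP"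
    and rv_Xinf: "Xinf \<in> measurable M GHP"
    and rv_N: "\<And>n. n \<ge> 1 \<Longrightarrow> N n \<in> measurable M (count_space UNIV)"
    and N_pos: "\<And>n \<omega>. n \<ge> 1 \<Longrightarrow> \<omega> \<in> space M \<Longrightarrow> N n \<omega> \<ge> 1"
    and indep: "prob_space.indep_set M
        {(\<lambda>\<omega> n. N (Suc n) \<omega>) -` S \<inter> space M | S.
           S \<in> sets (Pi\<^sub>M UNIV (\<lambda>_. count_space UNIV))}
        {(\<lambda>\<omega>. (\<lambda>n. X (Suc n) \<omega>, Xinf \<omega>)) -` S \<inter> space M | S.
           S \<in> sets (Pi\<^sub>M UNIV (\<lambda>_. GHP) \<Otimes>\<^sub>M GHP)}"
    and mono: "\<And>n. n \<ge> 1 \<Longrightarrow> st_le (distr M GHP (X n)) (distr M GHP (X (Suc n)))"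
begin

text \<open>Independence is given for the whole sequences; here it is specialized to cylinder events
  in one coordinate. The coordinates are \<open>m - 1\<close> and \<open>k - 1\<close> because the
  joint maps start at index 1.\<close>

lemma prob_index_and_value:
  assumes m: "m \<ge> 1" and k: "k \<ge> 1" and A: "A \<in> sets GHP"
  shows "prob {\<omega>\<in>space M. N m \<omega> = j \<and> X k \<omega> \<in> A} =
    prob {\<omega>\<in>space M. N m \<omega> = j} * prob {\<omega>\<in>space M. X k \<omega> \<in> A}"
proof -
  let ?P = "Pi\<^sub>M UNIV (\<lambda>_. count_space UNIV) :: (nat \<Rightarrow> nat) measure"
  let ?Q = "Pi\<^sub>M UNIV (\<lambda>_. GHP) \<Otimes>\<^sub>M GHP :: ((nat \<Rightarrow> mms) \<times> mms) measure"
  have "(\<lambda>s. s (m - 1)) -` {j} \<inter> space ?P \<in> sets ?P"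
    by (rule measurable_sets[of _ _ "count_space UNIV"]) auto
  moreover have "{\<omega>\<in>space M. N m \<omega> = j} =
      (\<lambda>\<omega> n. N (Suc n) \<omega>) -` ((\<lambda>s. s (m - 1)) -` {j} \<inter> space ?P) \<inter> space M"
    using m by (auto simp: space_PiM)
  ultimately have a: "{\<omega>\<in>space M. N m \<omega> = j} \<in> {(\<lambda>\<omega> n. N (Suc n) \<omega>) -` S \<inter> space M | S. S \<in> sets ?P}"
    by blast
  have "(\<lambda>s. fst s (k - 1)) -` A \<inter> space ?Q \<in> sets ?Q"
    by (rule measurable_sets[OF _ A]) measurable
  moreover have "{\<omega>\<in>space M. X k \<omega> \<in> A} =
      (\<lambda>\<omega>. (\<lambda>n. X (Suc n) \<omega>, Xinf \<omega>)) -` ((\<lambda>s. fst s (k - 1)) -` A \<inter> space ?Q) \<inter> space M"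
    using k measurable_space[OF rv_X] measurable_space[OF rv_Xinf]
    by (auto simp: space_PiM space_pair_measure PiE_def extensional_def)
  ultimately have b: "{\<omega>\<in>space M. X k \<omega> \<in> A} \<in>
      {(\<lambda>\<omega>. (\<lambda>n. X (Suc n) \<omega>, Xinf \<omega>)) -` S \<inter> space M | S. S \<in> sets ?Q}"
    by blast
  have "{\<omega>\<in>space M. N m \<omega> = j \<and> X k \<omega> \<in> A} = {\<omega>\<in>space M. N m \<omega> = j} \<inter> {\<omega>\<in>space M. X k \<omega> \<in> A}"
    by blast
  then show ?thesis
    using indep_setD[OF indep a b] by simp
qed

lemma measurable_random_index:
  assumes "m \<ge> 1"
  shows "(\<lambda>\<omega>. X (N m \<omega>) \<omega>) \<in> measurable M GHP"
\<comment> \<open>Indices start at 1, since measurability of \<open>X n\<close> is given from there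
  on.\<close>
proof (rule measurable_compose_countable'[where I = "{1..}"])
  show "N m \<in> measurable M (count_space {1..})"
    using rv_N[OF assms] N_pos[OF assms]
    by (auto simp: measurable_count_space_eq2_countable measurable_def)
qed (use rv_X in auto)

lemma event_N: "m \<ge> 1 \<Longrightarrow> {\<omega>\<in>space M. P (N m \<omega>)} \<in> events"
  using measurable_sets[OF rv_N, of m "{j. P j}"] by (simp add: vimage_def Int_def conj_commute)

lemma event_X: "k \<ge> 1 \<Longrightarrow> A \<in> sets GHP \<Longrightarrow> {\<omega>\<in>space M. X k \<omega> \<in> A} \<in> events"
  using measurable_sets[OF rv_X, of k A] by (simp add: vimage_def Int_def conj_commute)

text \<open>Total probability over the values of \<open>N m\<close> in \<open>K\<close>, each term
  factorized by independence. Only a common lower bound \<open>c\<close> enters, so the lemma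
  applies to increasing sets and to their complements alike.\<close>

lemma prob_random_index_ge:
  assumes m: "m \<ge> 1" and K: "finite K" "\<And>k. k \<in> K \<Longrightarrow> k \<ge> 1" and A: "A \<in> sets GHP"
    and c: "\<And>k. k \<in> K \<Longrightarrow> c \<le> prob {\<omega>\<in>space M. X k \<omega> \<in> A}" "c \<le> 1"
  shows "c - prob {\<omega>\<in>space M. N m \<omega> \<notin> K} \<le> prob {\<omega>\<in>space M. X (N m \<omega>) \<omega> \<in> A}"
proof -
  let ?B = "\<lambda>k. {\<omega>\<in>space M. N m \<omega> = k \<and> X k \<omega> \<in> A}"
  let ?q = "prob {\<omega>\<in>space M. N m \<omega> \<notin> K}"
  have B: "?B k \<in> events" if "k \<in> K" for k
  proof -
    have "?B k = {\<omega>\<in>space M. N m \<omega> = k} \<inter> {\<omega>\<in>space M. X k \<omega> \<in> A}"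
      by blast
    then show ?thesis
      using event_N[OF m, of "\<lambda>j. j = k"] event_X[OF K(2)[OF that] A] by simp
  qed
  have "prob {\<omega>\<in>space M. N m \<omega> \<in> K} = prob (space M - {\<omega>\<in>space M. N m \<omega> \<notin> K})"
    by (rule arg_cong[where f = prob]) auto
  then have q: "prob {\<omega>\<in>space M. N m \<omega> \<in> K} = 1 - ?q"
    using prob_compl[OF event_N[OF m, of "\<lambda>j. j \<notin> K"]] by simp
  have "{\<omega>\<in>space M. N m \<omega> \<in> K} = (\<Union>k\<in>K. {\<omega>\<in>space M. N m \<omega> = k})"
    by auto
  then have sum_N: "(\<Sum>k\<in>K. prob {\<omega>\<in>space M. N m \<omega> = k}) = 1 - ?q"
    using event_N[OF m] K(1) unfolding q[symmetric]
    by (subst finite_measure_finite_Union[symmetric]) (auto simp: disjoint_family_on_def)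
  have "c - ?q \<le> c * (1 - ?q)"
    using c(2) mult_right_mono[of c 1 ?q] by (simp add: algebra_simps)
  also have "\<dots> = (\<Sum>k\<in>K. prob {\<omega>\<in>space M. N m \<omega> = k} * c)"
    unfolding sum_N[symmetric] by (simp add: sum_distrib_left mult.commute)
  also have "\<dots> \<le> (\<Sum>k\<in>K. prob {\<omega>\<in>space M. N m \<omega> = k} * prob {\<omega>\<in>space M. X k \<omega> \<in> A})"
    using c(1) by (intro sum_mono mult_left_mono) auto
  also have "\<dots> = (\<Sum>k\<in>K. prob (?B k))"
    using prob_index_and_value[OF m K(2) A] by (intro sum.cong) auto
  also have "\<dots> = prob (\<Union>k\<in>K. ?B k)"
    using B K(1) by (intro finite_measure_finite_Union[symmetric]) (auto simp: disjoint_family_on_def)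
  also have "\<dots> \<le> prob {\<omega>\<in>space M. X (N m \<omega>) \<omega> \<in> A}"
  proof (rule finite_measure_mono)
    show "{\<omega>\<in>space M. X (N m \<omega>) \<omega> \<in> A} \<in> events"
      using measurable_sets[OF measurable_random_index[OF m] A] by (simp add: vimage_def Int_def conj_commute)
  qed auto
  finally show ?thesis .
qed

lemma prob_increasing_mono:
  assumes "1 \<le> k" "k \<le> n" "A \<in> sets GHP" "increasing_set A"
  shows "prob {\<omega>\<in>space M. X k \<omega> \<in> A} \<le> prob {\<omega>\<in>space M. X n \<omega> \<in> A}"
  using assms(2)
proof (induction n rule: dec_induct)
  case (step n)
  have D: "measure (distr M GHP (X j)) A = prob {\<omega>\<in>space M. X j \<omega> \<in> A}" if "j \<ge> 1" for j
    using measure_distr[OF rv_X[OF that] assms(3)] by (simp add: vimage_def Int_def conj_commute)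
  have n: "n \<ge> 1"
    using assms(1) step(1) by simp
  have "measure (distr M GHP (X n)) A \<le> measure (distr M GHP (X (Suc n))) A"
    using mono[OF n] assms(3,4) unfolding st_le_def by blast
  then have "prob {\<omega>\<in>space M. X n \<omega> \<in> A} \<le> prob {\<omega>\<in>space M. X (Suc n) \<omega> \<in> A}"
    using D[OF n] D[of "Suc n"] by simp
  then show ?case
    using step.IH by linarith
qed simp

context
  fixes u :: "mms \<Rightarrow> real"
  assumes u: "monotone_test u" "\<And>x. x \<in> mms_space \<Longrightarrow> 0 \<le> u x \<and> u x \<le> 1"
begin

lemma greater_set: "{x\<in>mms_space. t < u x} \<in> sets GHP" "increasing_set {x\<in>mms_space. t < u x}"
  using ghp_open_sets[OF ghp_open_greater] monotone_testD[OF u(1)]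
  by (auto simp: increasing_set_def intro: less_le_trans)

lemma le_set: "{x\<in>mms_space. u x \<le> t} \<in> sets GHP"
proof -
  have "{x\<in>mms_space. u x \<le> t} = space GHP - {x\<in>mms_space. t < u x}"
    by (auto simp: space_GHP)
  then show ?thesis
    using greater_set(1)[of t] by auto
qed

lemma measurable_test: "Y \<in> measurable M GHP \<Longrightarrow> (\<lambda>\<omega>. u (Y \<omega>)) \<in> borel_measurable M"
  using measurable_compose[OF _ ghp_continuous_measurable[OF monotone_testD(1)[OF u(1)]]] .

lemma test_in_unit: "Y \<in> measurable M GHP \<Longrightarrow> \<omega> \<in> space M \<Longrightarrow> 0 \<le> u (Y \<omega>) \<and> u (Y \<omega>) \<le> 1"
  using measurable_space[of Y M GHP \<omega>] u(2)[of "Y \<omega>"] by (simp add: space_GHP)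

lemma set_of_test:
  assumes "Y \<in> measurable M GHP"
  shows "{\<omega>\<in>space M. Y \<omega> \<in> {x\<in>mms_space. t < u x}} = {\<omega>\<in>space M. t < u (Y \<omega>)}"
    and "{\<omega>\<in>space M. Y \<omega> \<in> {x\<in>mms_space. u x \<le> t}} = {\<omega>\<in>space M. u (Y \<omega>) \<le> t}"
  using measurable_space[OF assms] by (auto simp: space_GHP)

text \<open>Superlevel sets of \<open>u\<close> are increasing, so for \<open>k \<ge> n\<close> they
  are hit by \<open>X k\<close> at least as often as by \<open>X n\<close>. The cap
  \<open>n'\<close> makes the set of admissible indices finite.\<close>

lemma expectation_le_random_index:
  assumes m: "m \<ge> 1" and n: "n \<ge> 1"
  shows "expectation (\<lambda>\<omega>. u (X n \<omega>)) \<le>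
    expectation (\<lambda>\<omega>. u (X (N m \<omega>) \<omega>)) + prob {\<omega>\<in>space M. N m \<omega> \<notin> {n..n'}}"
proof (rule expectation_le_of_tail_le)
  fix t
  let ?A = "{x\<in>mms_space. t < u x}"
  have "prob {\<omega>\<in>space M. X n \<omega> \<in> ?A} - prob {\<omega>\<in>space M. N m \<omega> \<notin> {n..n'}} \<le>
      prob {\<omega>\<in>space M. X (N m \<omega>) \<omega> \<in> ?A}"
    using n greater_set by (intro prob_random_index_ge[OF m] prob_increasing_mono) auto
  then show "prob {\<omega>\<in>space M. t < u (X n \<omega>)} \<le>
      prob {\<omega>\<in>space M. t < u (X (N m \<omega>) \<omega>)} + prob {\<omega>\<in>space M. N m \<omega> \<notin> {n..n'}}"
    unfolding set_of_test[OF rv_X[OF n]] set_of_test[OF measurable_random_index[OF m]] by linarith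
qed (use measurable_test test_in_unit rv_X[OF n] measurable_random_index[OF m] in auto)

text \<open>The mirror image uses sublevel sets, which for \<open>k \<le> n\<close> are hit by
  \<open>X k\<close> at least as often as by \<open>X n\<close>; complements lead back to
  tails.\<close>

lemma random_index_expectation_le:
  assumes m: "m \<ge> 1" and n: "n \<ge> 1"
  shows "expectation (\<lambda>\<omega>. u (X (N m \<omega>) \<omega>)) \<le>
    expectation (\<lambda>\<omega>. u (X n \<omega>)) + prob {\<omega>\<in>space M. N m \<omega> \<notin> {1..n}}"
proof (rule expectation_le_of_tail_le)
  fix t
  let ?A = "{x\<in>mms_space. u x \<le> t}"
  have compl: "prob {\<omega>\<in>space M. u (Y \<omega>) \<le> t} = 1 - prob {\<omega>\<in>space M. t < u (Y \<omega>)}"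
    if "Y \<in> measurable M GHP" for Y
  proof -
    have [measurable]: "(\<lambda>\<omega>. u (Y \<omega>)) \<in> borel_measurable M"
      using that by (rule measurable_test)
    have "{\<omega>\<in>space M. u (Y \<omega>) \<le> t} = space M - {\<omega>\<in>space M. t < u (Y \<omega>)}"
      by auto
    then show ?thesis
      by (simp add: prob_compl)
  qed
  have "prob {\<omega>\<in>space M. X n \<omega> \<in> ?A} \<le> prob {\<omega>\<in>space M. X k \<omega> \<in> ?A}" if k: "k \<in> {1..n}" for k
  proof -
    have k1: "k \<ge> 1" using k by simp
    have "prob {\<omega>\<in>space M. t < u (X k \<omega>)} \<le> prob {\<omega>\<in>space M. t < u (X n \<omega>)}"
      using prob_increasing_mono[OF k1 _ greater_set, of n t] k
      unfolding set_of_test[OF rv_X[OF n]] set_of_test[OF rv_X[OF k1]] by simp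
    then show ?thesis
      unfolding set_of_test[OF rv_X[OF n]] set_of_test[OF rv_X[OF k1]]
        compl[OF rv_X[OF n]] compl[OF rv_X[OF k1]] by simp
  qed
  then have "prob {\<omega>\<in>space M. X n \<omega> \<in> ?A} - prob {\<omega>\<in>space M. N m \<omega> \<notin> {1..n}} \<le>
      prob {\<omega>\<in>space M. X (N m \<omega>) \<omega> \<in> ?A}"
    using le_set by (intro prob_random_index_ge[OF m]) auto
  then show "prob {\<omega>\<in>space M. t < u (X (N m \<omega>) \<omega>)} \<le>
      prob {\<omega>\<in>space M. t < u (X n \<omega>)} + prob {\<omega>\<in>space M. N m \<omega> \<notin> {1..n}}"
    unfolding set_of_test[OF rv_X[OF n]] set_of_test[OF measurable_random_index[OF m]]
      compl[OF rv_X[OF n]] compl[OF measurable_random_index[OF m]] by linarith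
qed (use measurable_test test_in_unit rv_X[OF n] measurable_random_index[OF m] in auto)

end

end

locale tame_random_index = monotone_random_index M X Xinf N
  for M :: "'w measure" and X Xinf N +
  fixes a b :: "nat \<Rightarrow> real"
  assumes tame_a: "tame a" and tame_b: "tame b"
    and conv_N: "conv_distr M (\<lambda>n \<omega>. scale_mms (a n) (b n) (X (N n \<omega>) \<omega>)) Xinf"
    and N_ratio: "\<And>\<epsilon>. \<epsilon> > 0 \<Longrightarrow>
        (\<lambda>n. measure M {\<omega> \<in> space M. \<bar>real (N n \<omega>) / real n - 1\<bar> > \<epsilon>}) \<longlonglongrightarrow> 0"
begin

lemma scale_pos: "n \<ge> 1 \<Longrightarrow> 0 < a n" "n \<ge> 1 \<Longrightarrow> 0 < b n"
  using tame_a tame_b by (auto simp: tame_def)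

lemma tame_both:
  assumes "\<eta> > 0"
  obtains \<gamma> n0 where "0 < \<gamma>" "\<gamma> \<le> 1/2"
    "\<And>n m. n \<ge> n0 \<Longrightarrow> \<bar>real m - real n\<bar> \<le> \<gamma> * real n \<Longrightarrow> \<bar>a m / a n - 1\<bar> < \<eta>"
    "\<And>n m. n \<ge> n0 \<Longrightarrow> \<bar>real m - real n\<bar> \<le> \<gamma> * real n \<Longrightarrow> \<bar>b m / b n - 1\<bar> < \<eta>"
proof (rule tame_uniform[OF tame_a assms], rule tame_uniform[OF tame_b assms])
  fix \<gamma>1 \<gamma>2 :: real and n1 n2 :: nat
  assume 1: "\<gamma>1 > 0" "\<And>n m. n \<ge> n1 \<Longrightarrow> \<bar>real m - real n\<bar> \<le> \<gamma>1 * real n \<Longrightarrow> \<bar>a m / a n - 1\<bar> < \<eta>"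
    and 2: "\<gamma>2 > 0" "\<And>n m. n \<ge> n2 \<Longrightarrow> \<bar>real m - real n\<bar> \<le> \<gamma>2 * real n \<Longrightarrow> \<bar>b m / b n - 1\<bar> < \<eta>"
  define \<gamma> where "\<gamma> = min (min \<gamma>1 \<gamma>2) (1/2)"
  have le: "\<gamma> * real n \<le> \<gamma>1 * real n" "\<gamma> * real n \<le> \<gamma>2 * real n" for n :: nat
    by (auto simp: \<gamma>_def intro!: mult_right_mono)
  show thesis
  proof (rule that[of \<gamma> "max n1 n2"])
    show "0 < \<gamma>" "\<gamma> \<le> 1/2"
      using 1(1) 2(1) by (auto simp: \<gamma>_def)
  next
    fix n m :: nat assume n: "max n1 n2 \<le> n" "\<bar>real m - real n\<bar> \<le> \<gamma> * real n"
    show "\<bar>a m / a n - 1\<bar> < \<eta>"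
      using n by (intro 1(2) order_trans[OF n(2) le(1)]) auto
    show "\<bar>b m / b n - 1\<bar> < \<eta>"
      using n by (intro 2(2) order_trans[OF n(2) le(2)]) auto
  qed
qed

context
  fixes u :: "mms \<Rightarrow> real"
  assumes u: "monotone_test u" "\<And>x. x \<in> mms_space \<Longrightarrow> 0 \<le> u x \<and> u x \<le> 1"
begin

lemma scaled_test:
  assumes "c > 0" "c' > 0"
  shows "monotone_test (\<lambda>x. u (scale_mms c c' x))"
    "\<And>x. x \<in> mms_space \<Longrightarrow> 0 \<le> u (scale_mms c c' x) \<and> u (scale_mms c c' x) \<le> 1"
  using monotone_test_scale[OF u(1) assms] u(2)[OF scale_mms_in_space[OF _ assms(1)]] by auto

lemma expectation_scaled_mono:
  assumes Z: "Z \<in> measurable M GHP" and c: "0 < c" "c \<le> d" "0 < c'" "c' \<le> d'"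
  shows "expectation (\<lambda>\<omega>. u (scale_mms c c' (Z \<omega>))) \<le> expectation (\<lambda>\<omega>. u (scale_mms d d' (Z \<omega>)))"
proof (rule integral_mono)
  show "integrable M (\<lambda>\<omega>. u (scale_mms c c' (Z \<omega>)))" "integrable M (\<lambda>\<omega>. u (scale_mms d d' (Z \<omega>)))"
    using c by (auto intro!: integrable_monotone_test[OF Z] scaled_test(1))
  fix \<omega> assume "\<omega> \<in> space M"
  then have "Z \<omega> \<in> mms_space"
    using measurable_space[OF Z] by (simp add: space_GHP)
  then show "u (scale_mms c c' (Z \<omega>)) \<le> u (scale_mms d d' (Z \<omega>))"
    using c by (intro monotone_testD(2)[OF u(1)] mms_le_scale_mono scale_mms_in_space) auto
qed

lemma expectation_scale_tendsto:
  assumes l: "\<And>j. l j > 0" "l \<longlonglongrightarrow> 1"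
  shows "(\<lambda>j::nat. expectation (\<lambda>\<omega>. u (scale_mms (l j) (l j) (Xinf \<omega>)))) \<longlonglongrightarrow> expectation (\<lambda>\<omega>. u (Xinf \<omega>))"
proof (rule integral_dominated_convergence[where w = "\<lambda>_. 1"])
  have in_space: "Xinf \<omega> \<in> mms_space" if "\<omega> \<in> space M" for \<omega>
    using measurable_space[OF rv_Xinf that] by (simp add: space_GHP)
  show "(\<lambda>\<omega>. u (Xinf \<omega>)) \<in> borel_measurable M"
    using integrable_monotone_test[OF rv_Xinf u(1)] by simp
  show "(\<lambda>\<omega>. u (scale_mms (l j) (l j) (Xinf \<omega>))) \<in> borel_measurable M" for j
    using integrable_monotone_test[OF rv_Xinf scaled_test(1)[OF l(1) l(1)]] by simp
  show "AE \<omega> in M. (\<lambda>j. u (scale_mms (l j) (l j) (Xinf \<omega>))) \<longlonglongrightarrow> u (Xinf \<omega>)"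
  proof (rule AE_I2)
    fix \<omega> assume "\<omega> \<in> space M"
    from in_space[OF this] show "(\<lambda>j. u (scale_mms (l j) (l j) (Xinf \<omega>))) \<longlonglongrightarrow> u (Xinf \<omega>)"
      by (intro filterlim_compose[OF ghp_continuous_tendsto[OF monotone_testD(1)[OF u(1)]]]
          filterlim_compose[OF filterlim_scale_near_1 l(2)])
  qed
  show "AE \<omega> in M. norm (u (scale_mms (l j) (l j) (Xinf \<omega>))) \<le> 1" for j
    using in_space scaled_test(2)[OF l(1) l(1)] by (intro AE_I2) (simp add: abs_of_nonneg)
qed auto

text \<open>The factor \<open>l\<close> is moved into the test function, to which the assumed
  convergence along \<open>N\<close> applies.\<close>

lemma scaled_random_index_tendsto:
  assumes l: "l > 0"
  shows "(\<lambda>m. expectation (\<lambda>\<omega>. u (scale_mms (l * a m) (l * b m) (X (N m \<omega>) \<omega>))))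
    \<longlonglongrightarrow> expectation (\<lambda>\<omega>. u (scale_mms l l (Xinf \<omega>)))"
proof -
  let ?f = "\<lambda>x. u (scale_mms l l x)"
  have "(\<lambda>m. expectation (\<lambda>\<omega>. ?f (scale_mms (a m) (b m) (X (N m \<omega>) \<omega>)))) \<longlonglongrightarrow> expectation (\<lambda>\<omega>. ?f (Xinf \<omega>))"
    using conv_N[unfolded conv_distr_def, THEN spec, of ?f] scaled_test(1)[OF l l]
    unfolding monotone_test_def by blast
  moreover have "eventually (\<lambda>m. expectation (\<lambda>\<omega>. ?f (scale_mms (a m) (b m) (X (N m \<omega>) \<omega>))) =
      expectation (\<lambda>\<omega>. u (scale_mms (l * a m) (l * b m) (X (N m \<omega>) \<omega>)))) sequentially"
    \<comment> \<open>Merging the two scalings needs a nonnegative mass factor, and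
      \<open>b 0\<close> is arbitrary.\<close>
    using eventually_ge_at_top[of 1]
  proof eventually_elim
    case (elim m)
    then show ?case
      using l scale_pos[OF elim] by (simp add: scale_scale_mms)
  qed
  ultimately show ?thesis
    using Lim_transform_eventually by fast
qed

lemma prob_index_outside_le:
  assumes "m \<ge> 1" "\<And>\<omega>. \<omega> \<in> space M \<Longrightarrow> \<bar>real (N m \<omega>) / real m - 1\<bar> \<le> \<gamma> \<Longrightarrow> N m \<omega> \<in> K"
  shows "prob {\<omega>\<in>space M. N m \<omega> \<notin> K} \<le> prob {\<omega>\<in>space M. \<bar>real (N m \<omega>) / real m - 1\<bar> > \<gamma>}"
proof (rule finite_measure_mono)
  show "{\<omega>\<in>space M. \<bar>real (N m \<omega>) / real m - 1\<bar> > \<gamma>} \<in> events"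
    by (rule event_N[OF assms(1)])
qed (use assms(2) not_less in blast)

text \<open>Scaling the limit by some \<open>l > 1\<close> keeps its expectation below
  \<open>t\<close>. Tameness gives a window of indices \<open>m\<close> in which
  \<open>(a n, b n)\<close> is dominated by \<open>l\<close> times \<open>(a m, b m)\<close>; a
  larger \<open>m\<close> in it has \<open>N m \<ge> n\<close> with high probability.\<close>

lemma eventually_less:
  assumes t: "expectation (\<lambda>\<omega>. u (Xinf \<omega>)) < t"
  shows "eventually (\<lambda>n. expectation (\<lambda>\<omega>. u (scale_mms (a n) (b n) (X n \<omega>))) < t) sequentially"
proof -
  have "(\<lambda>j. 1 + 1 / real (Suc j)) \<longlonglongrightarrow> 1 + 0"
    by (intro tendsto_intros LIMSEQ_inverse_real_of_nat[unfolded inverse_eq_divide])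
  then have "(\<lambda>j. expectation (\<lambda>\<omega>. u (scale_mms (1 + 1 / real (Suc j)) (1 + 1 / real (Suc j)) (Xinf \<omega>))))
      \<longlonglongrightarrow> expectation (\<lambda>\<omega>. u (Xinf \<omega>))"
    by (intro expectation_scale_tendsto) (auto simp: add_pos_pos)
  from order_tendstoD(2)[OF this t] obtain j where
    j: "expectation (\<lambda>\<omega>. u (scale_mms (1 + 1 / real (Suc j)) (1 + 1 / real (Suc j)) (Xinf \<omega>))) < t"
    by (auto simp: eventually_sequentially)
  define l where "l = 1 + 1 / real (Suc j)"
  have l: "l > 1" "expectation (\<lambda>\<omega>. u (scale_mms l l (Xinf \<omega>))) < t"
    using j by (auto simp: l_def)
  have "1 - 1 / l > 0"
    using l(1) by simp
  then obtain \<gamma> n0 where \<gamma>: "0 < \<gamma>" "\<gamma> \<le> 1/2"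
    and a_near: "\<And>n m. n \<ge> n0 \<Longrightarrow> \<bar>real m - real n\<bar> \<le> \<gamma> * real n \<Longrightarrow> \<bar>a m / a n - 1\<bar> < 1 - 1 / l"
    and b_near: "\<And>n m. n \<ge> n0 \<Longrightarrow> \<bar>real m - real n\<bar> \<le> \<gamma> * real n \<Longrightarrow> \<bar>b m / b n - 1\<bar> < 1 - 1 / l"
    using tame_both by metis
  define m where "m n = n + nat \<lfloor>\<gamma> * real n\<rfloor>" for n
  let ?W = "\<lambda>m. expectation (\<lambda>\<omega>. u (scale_mms (l * a m) (l * b m) (X (N m \<omega>) \<omega>)))"
  let ?T = "\<lambda>m. prob {\<omega>\<in>space M. \<bar>real (N m \<omega>) / real m - 1\<bar> > \<gamma> / 4}"
  have "(\<lambda>m. ?W m + ?T m) \<longlonglongrightarrow> expectation (\<lambda>\<omega>. u (scale_mms l l (Xinf \<omega>))) + 0"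
    using l(1) \<gamma>(1) by (intro tendsto_add scaled_random_index_tendsto N_ratio) auto
  then have "eventually (\<lambda>m. ?W m + ?T m < t) sequentially"
    using l(2) order_tendstoD(2) by force
  moreover have "filterlim m sequentially sequentially"
    by (rule filterlim_at_top_mono[OF filterlim_ident]) (simp add: m_def)
  ultimately have "eventually (\<lambda>n. ?W (m n) + ?T (m n) < t) sequentially"
    by (rule eventually_compose_filterlim)
  \<comment> \<open>The bound \<open>2 / \<gamma>\<close> absorbs the floor:
    \<open>m n \<ge> n + \<gamma> * n - 1\<close>, and a fraction \<open>\<gamma> / 4\<close> of
    \<open>m n\<close> is at most \<open>\<gamma> * n / 2\<close>, so
    \<open>(1 - \<gamma> / 4) * m n \<ge> n\<close>.\<close>
  moreover have "eventually (\<lambda>n. n \<ge> max (max 1 n0) (nat \<lceil>2 / \<gamma>\<rceil>)) sequentially"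
    by (rule eventually_ge_at_top)
  ultimately show ?thesis
  proof eventually_elim
    case (elim n)
    then have n: "n \<ge> 1" "n \<ge> n0" "2 / \<gamma> \<le> real n"
      by auto
    have m1: "m n \<ge> 1"
      using n(1) by (simp add: m_def)
    have gn: "2 \<le> \<gamma> * real n"
      using n(3) \<gamma>(1) by (simp add: divide_le_eq mult.commute)
    have mn: "real n + \<gamma> * real n - 1 \<le> real (m n)" "real (m n) \<le> real n + \<gamma> * real n"
      using gn by (simp_all add: m_def)
    have near: "\<bar>real (m n) - real n\<bar> \<le> \<gamma> * real n"
      using mn gn by linarith
    have pos: "0 < a n" "0 < b n"
      using scale_pos[OF n(1)] by auto
    have "1 / l < a (m n) / a n" "1 / l < b (m n) / b n"
      using a_near[OF n(2) near] b_near[OF n(2) near] by linarith+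
    then have le: "a n \<le> l * a (m n)" "b n \<le> l * b (m n)"
      using pos l(1) by (auto simp: field_simps)
    have lower: "real n \<le> (1 - \<gamma> / 4) * real (m n)"
    proof -
      have "\<gamma> / 4 * real (m n) \<le> \<gamma> / 4 * (2 * real n)"
        using mn(2) \<gamma> mult_right_mono[of \<gamma> 1 "real n"] by (intro mult_left_mono) auto
      then show ?thesis
        using mn(1) gn by (simp add: algebra_simps)
    qed
    have "N (m n) \<omega> \<in> {n..2 * m n}" if "\<bar>real (N (m n) \<omega>) / real (m n) - 1\<bar> \<le> \<gamma> / 4" for \<omega>
    proof -
      have "1 - \<gamma> / 4 \<le> real (N (m n) \<omega>) / real (m n)" "real (N (m n) \<omega>) / real (m n) \<le> 2"
        using that \<gamma>(2) by linarith+
      then have "(1 - \<gamma> / 4) * real (m n) \<le> real (N (m n) \<omega>)" "real (N (m n) \<omega>) \<le> 2 * real (m n)"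
        using m1 by (auto simp: field_simps)
      then show ?thesis
        using lower by auto
    qed
    then have tail: "prob {\<omega>\<in>space M. N (m n) \<omega> \<notin> {n..2 * m n}} \<le> ?T (m n)"
      by (intro prob_index_outside_le m1)
    have "expectation (\<lambda>\<omega>. u (scale_mms (a n) (b n) (X n \<omega>))) \<le>
        expectation (\<lambda>\<omega>. u (scale_mms (a n) (b n) (X (N (m n) \<omega>) \<omega>))) + prob {\<omega>\<in>space M. N (m n) \<omega> \<notin> {n..2 * m n}}"
      using expectation_le_random_index[OF scaled_test[OF pos] m1 n(1)] .
    moreover have "expectation (\<lambda>\<omega>. u (scale_mms (a n) (b n) (X (N (m n) \<omega>) \<omega>))) \<le> ?W (m n)"
      using pos le by (intro expectation_scaled_mono measurable_random_index m1)
    ultimately show ?case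
      using tail elim by linarith
  qed
qed

text \<open>Now the limit is shrunk by \<open>1 / l\<close>, and \<open>m\<close> lies below
  \<open>n\<close>, so that \<open>N m \<le> n\<close> with high probability.\<close>

lemma eventually_greater:
  assumes t: "t < expectation (\<lambda>\<omega>. u (Xinf \<omega>))"
  shows "eventually (\<lambda>n. t < expectation (\<lambda>\<omega>. u (scale_mms (a n) (b n) (X n \<omega>)))) sequentially"
proof -
  have "(\<lambda>j. 1 / (1 + 1 / real (Suc j))) \<longlonglongrightarrow> 1 / (1 + 0)"
    by (intro tendsto_intros LIMSEQ_inverse_real_of_nat[unfolded inverse_eq_divide]) simp
  then have "(\<lambda>j. expectation (\<lambda>\<omega>. u (scale_mms (1 / (1 + 1 / real (Suc j))) (1 / (1 + 1 / real (Suc j))) (Xinf \<omega>))))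
      \<longlonglongrightarrow> expectation (\<lambda>\<omega>. u (Xinf \<omega>))"
    by (intro expectation_scale_tendsto) (auto simp: add_pos_pos)
  from order_tendstoD(1)[OF this t] obtain j where
    j: "t < expectation (\<lambda>\<omega>. u (scale_mms (1 / (1 + 1 / real (Suc j))) (1 / (1 + 1 / real (Suc j))) (Xinf \<omega>)))"
    by (auto simp: eventually_sequentially)
  define l where "l = 1 + 1 / real (Suc j)"
  have l: "l > 1" "t < expectation (\<lambda>\<omega>. u (scale_mms (1 / l) (1 / l) (Xinf \<omega>)))"
    using j by (auto simp: l_def)
  have "l - 1 > 0"
    using l(1) by simp
  then obtain \<gamma> n0 where \<gamma>: "0 < \<gamma>" "\<gamma> \<le> 1/2"
    and a_near: "\<And>n m. n \<ge> n0 \<Longrightarrow> \<bar>real m - real n\<bar> \<le> \<gamma> * real n \<Longrightarrow> \<bar>a m / a n - 1\<bar> < l - 1"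
    and b_near: "\<And>n m. n \<ge> n0 \<Longrightarrow> \<bar>real m - real n\<bar> \<le> \<gamma> * real n \<Longrightarrow> \<bar>b m / b n - 1\<bar> < l - 1"
    using tame_both by metis
  define m where "m n = n - nat \<lfloor>\<gamma> * real n\<rfloor>" for n
  have m_eq: "real (m n) = real n - real_of_int \<lfloor>\<gamma> * real n\<rfloor>" for n
  proof -
    have "\<gamma> * real n \<le> 1 * real n"
      using \<gamma> by (intro mult_right_mono) auto
    then have "nat \<lfloor>\<gamma> * real n\<rfloor> \<le> n"
      by linarith
    then show ?thesis
      using \<gamma>(1) by (simp add: m_def of_nat_diff)
  qed
  \<comment> \<open>This is where \<open>\<gamma> \<le> 1/2\<close> is used: the smaller indices
    still tend to infinity.\<close>
  have m_ge: "real n / 2 \<le> real (m n)" for n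
    using m_eq[of n] mult_right_mono[OF \<gamma>(2), of "real n"] by linarith
  let ?W = "\<lambda>m. expectation (\<lambda>\<omega>. u (scale_mms (1 / l * a m) (1 / l * b m) (X (N m \<omega>) \<omega>)))"
  let ?T = "\<lambda>m. prob {\<omega>\<in>space M. \<bar>real (N m \<omega>) / real m - 1\<bar> > \<gamma> / 4}"
  have "(\<lambda>m. ?W m - ?T m) \<longlonglongrightarrow> expectation (\<lambda>\<omega>. u (scale_mms (1 / l) (1 / l) (Xinf \<omega>))) - 0"
    using l(1) \<gamma>(1) by (intro tendsto_diff scaled_random_index_tendsto N_ratio) auto
  then have "eventually (\<lambda>m. t < ?W m - ?T m) sequentially"
    using l(2) order_tendstoD(1) by force
  moreover have "filterlim m sequentially sequentially"
    unfolding filterlim_at_top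
  proof
    fix k
    show "eventually (\<lambda>n. k \<le> m n) sequentially"
      using eventually_ge_at_top[of "2 * k"]
    proof eventually_elim
      case (elim n)
      then show ?case
        using m_ge[of n] by linarith
    qed
  qed
  ultimately have "eventually (\<lambda>n. t < ?W (m n) - ?T (m n)) sequentially"
    by (rule eventually_compose_filterlim)
  moreover have "eventually (\<lambda>n. n \<ge> max (max 1 n0) (nat \<lceil>2 / \<gamma>\<rceil>)) sequentially"
    by (rule eventually_ge_at_top)
  ultimately show ?thesis
  proof eventually_elim
    case (elim n)
    then have n: "n \<ge> 1" "n \<ge> n0" "2 / \<gamma> \<le> real n"
      by auto
    have m1: "m n \<ge> 1"
      using n(1) m_ge[of n] by linarith
    have gn: "2 \<le> \<gamma> * real n"
      using n(3) \<gamma>(1) by (simp add: divide_le_eq mult.commute)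
    have mn: "real (m n) \<le> real n - \<gamma> * real n + 1" "real n - \<gamma> * real n \<le> real (m n)"
      using m_eq[of n] by linarith+
    have near: "\<bar>real (m n) - real n\<bar> \<le> \<gamma> * real n"
      using mn gn by linarith
    have pos: "0 < a n" "0 < b n" "0 < a (m n)" "0 < b (m n)"
      using scale_pos n(1) m1 by auto
    have "a (m n) / a n < l" "b (m n) / b n < l"
      using a_near[OF n(2) near] b_near[OF n(2) near] by linarith+
    then have le: "1 / l * a (m n) \<le> a n" "1 / l * b (m n) \<le> b n"
      using pos l(1) by (auto simp: field_simps)
    have upper: "(1 + \<gamma> / 4) * real (m n) \<le> real n"
    proof -
      have "\<gamma> / 4 * real (m n) \<le> \<gamma> / 4 * real n"
        using mn(1) gn \<gamma>(1) by (intro mult_left_mono) auto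
      then show ?thesis
        using mn(1) gn by (simp add: algebra_simps)
    qed
    have "N (m n) \<omega> \<in> {1..n}" if "\<omega> \<in> space M" "\<bar>real (N (m n) \<omega>) / real (m n) - 1\<bar> \<le> \<gamma> / 4" for \<omega>
    proof -
      have "real (N (m n) \<omega>) / real (m n) \<le> 1 + \<gamma> / 4"
        using that(2) by linarith
      then have "real (N (m n) \<omega>) \<le> (1 + \<gamma> / 4) * real (m n)"
        using m1 by (auto simp: field_simps)
      then show ?thesis
        using upper N_pos[OF m1 that(1)] by auto
    qed
    then have tail: "prob {\<omega>\<in>space M. N (m n) \<omega> \<notin> {1..n}} \<le> ?T (m n)"
      by (intro prob_index_outside_le m1)
    have "expectation (\<lambda>\<omega>. u (scale_mms (a n) (b n) (X (N (m n) \<omega>) \<omega>))) \<le>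
        expectation (\<lambda>\<omega>. u (scale_mms (a n) (b n) (X n \<omega>))) + prob {\<omega>\<in>space M. N (m n) \<omega> \<notin> {1..n}}"
      using random_index_expectation_le[OF scaled_test[OF pos(1,2)] m1 n(1)] .
    moreover have "?W (m n) \<le> expectation (\<lambda>\<omega>. u (scale_mms (a n) (b n) (X (N (m n) \<omega>) \<omega>)))"
      using pos le l(1) by (intro expectation_scaled_mono measurable_random_index m1) auto
    ultimately show ?case
      using tail elim by linarith
  qed
qed

end

lemma monotone_test_tendsto:
  assumes "monotone_test u"
  shows "(\<lambda>n. expectation (\<lambda>\<omega>. u (scale_mms (a n) (b n) (X n \<omega>)))) \<longlonglongrightarrow> expectation (\<lambda>\<omega>. u (Xinf \<omega>))"
proof -
  obtain B where B: "\<forall>x\<in>mms_space. \<bar>u x\<bar> \<le> B"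
    using assms by (rule monotone_test_bounded)
  \<comment> \<open>The comparison lemmas are stated for values in the unit interval; the summand 1
    keeps \<open>C\<close> positive, so the increasing affine map to \<open>v\<close> can be
    inverted.\<close>
  define C where "C = \<bar>B\<bar> + 1"
  have C: "C > 0"
    by (simp add: C_def)
  define v where "v x = 1 / (2 * C) * (u x + C)" for x
  have u_eq: "u x = 2 * C * v x - C" for x
    using C by (simp add: v_def field_simps)
  have v: "monotone_test v"
    unfolding v_def[abs_def] using C assms
    by (intro monotone_test_mult monotone_test_add monotone_test_const) auto
  have v01: "0 \<le> v x \<and> v x \<le> 1" if "x \<in> mms_space" for x
  proof -
    have "\<bar>u x\<bar> \<le> C"
      using B[rule_format, OF that] by (simp add: C_def)
    then show ?thesis
      using C by (auto simp: v_def field_simps abs_le_iff)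
  qed
  have "(\<lambda>n. expectation (\<lambda>\<omega>. v (scale_mms (a n) (b n) (X n \<omega>)))) \<longlonglongrightarrow> expectation (\<lambda>\<omega>. v (Xinf \<omega>))"
    by (intro order_tendstoI eventually_less[OF v v01] eventually_greater[OF v v01])
  then have "(\<lambda>n. 2 * C * expectation (\<lambda>\<omega>. v (scale_mms (a n) (b n) (X n \<omega>))) - C)
      \<longlonglongrightarrow> 2 * C * expectation (\<lambda>\<omega>. v (Xinf \<omega>)) - C"
    by (intro tendsto_intros)
  moreover have E: "expectation (\<lambda>\<omega>. u (Z \<omega>)) = 2 * C * expectation (\<lambda>\<omega>. v (Z \<omega>)) - C"
    if "Z \<in> measurable M GHP" for Z
    unfolding u_eq using integrable_monotone_test[OF that v] by (simp add: prob_space)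
  moreover have "eventually (\<lambda>n. 2 * C * expectation (\<lambda>\<omega>. v (scale_mms (a n) (b n) (X n \<omega>))) - C =
      expectation (\<lambda>\<omega>. u (scale_mms (a n) (b n) (X n \<omega>)))) sequentially"
    using eventually_ge_at_top[of 1]
  proof eventually_elim
    case (elim n)
    show ?case
      using E[OF measurable_compose[OF rv_X[OF elim] measurable_scale_mms[OF scale_pos[OF elim]]]] by simp
  qed
  ultimately show ?thesis
    unfolding E[OF rv_Xinf] by (rule_tac Lim_transform_eventually)
qed

lemma conv_distr_deterministic_index:
  "conv_distr M (\<lambda>n \<omega>. scale_mms (a n) (b n) (X n \<omega>)) Xinf"
  by (intro conv_distr_of_monotone_tests monotone_test_tendsto rv_Xinf
      measurable_compose[OF rv_X measurable_scale_mms] scale_pos)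

end

theorem theorem1p4:
  fixes M :: "'w measure"
    and X :: "nat \<Rightarrow> 'w \<Rightarrow> mms" and Xinf :: "'w \<Rightarrow> mms"
    and N :: "nat \<Rightarrow> 'w \<Rightarrow> nat"
    and a b :: "nat \<Rightarrow> real"
  assumes "prob_space M"
    and rv_X: "\<And>n. n \<ge> 1 \<Longrightarrow> X n \<in> measurable M GHP"
    and rv_Xinf: "Xinf \<in> measurable M GHP"
    and rv_N: "\<And>n. n \<ge> 1 \<Longrightarrow> N n \<in> measurable M (count_space UNIV)"
    and N_pos: "\<And>n \<omega>. n \<ge> 1 \<Longrightarrow> \<omega> \<in> space M \<Longrightarrow> N n \<omega> \<ge> 1"
    and indep: "prob_space.indep_set M
        {(\<lambda>\<omega> n. N (Suc n) \<omega>) -` S \<inter> space M | S.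
           S \<in> sets (Pi\<^sub>M UNIV (\<lambda>_. count_space UNIV))}
        {(\<lambda>\<omega>. (\<lambda>n. X (Suc n) \<omega>, Xinf \<omega>)) -` S \<inter> space M | S.
           S \<in> sets (Pi\<^sub>M UNIV (\<lambda>_. GHP) \<Otimes>\<^sub>M GHP)}"
    and tame_a: "tame a" and tame_b: "tame b"
    and conv_N: "conv_distr M (\<lambda>n \<omega>. scale_mms (a n) (b n) (X (N n \<omega>) \<omega>)) Xinf"
    and N_ratio: "\<And>\<epsilon>. \<epsilon> > 0 \<Longrightarrow>
        (\<lambda>n. measure M {\<omega> \<in> space M. \<bar>real (N n \<omega>) / real n - 1\<bar> > \<epsilon>}) \<longlonglongrightarrow> 0"
    and mono: "\<And>n. n \<ge> 1 \<Longrightarrow> st_le (distr M GHP (X n)) (distr M GHP (X (Suc n)))"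
  shows "conv_distr M (\<lambda>n \<omega>. scale_mms (a n) (b n) (X n \<omega>)) Xinf"
proof -
  interpret prob_space M by fact
  interpret tame_random_index M X Xinf N a b
    by unfold_locales (fact assms)+
  show ?thesis
    by (rule conv_distr_deterministic_index)
qed

end
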